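(* Let $\mathbb{D}$ be the open unit disc and define $$\mathcal{V}=\{z\in\mathbb{D}^3 : z_3^2=z_1z_2\},$$ $$\mathcal{G}=\Big\{z\in\mathbb{D}^3 : |z_1z_2-z_3^2|<(1-|z_3|^2)+\sqrt{1-|z_1|^2}\,\sqrt{1-|z_2|^2}\Big\}.$$ Then $\mathcal{G}$ is convex, and $(\mathcal{G},\mathcal{V})$ is an np pair. Moreover, if $G$ is any balanced domain of holomorphy in $\mathbb{C}^3$ with $\mathcal{V}\subseteq G$, then $(G,\mathcal{V})$ is an np pair if and only if $G\subseteq\mathcal{G}$.
   Context: A set $G\subseteq\mathbb{C}^3$ is balanced if $\zeta z\in G$ whenever $z\in G$, $\zeta\in\mathbb{C}$, $|\zeta|\le1$. Domains of holomorphy are connected. If $\Omega$ is a domain of holomorphy in $\mathbb{C}^n$, an analytic set in $\Omega$ is a relatively closed set $V$ in $\Omega$ which near each of its points is the common zero set of finitely many holomorphic functions. A function $f:V\to\mathbb{C}$ is holomorphic on $V$ if each $\lambda\in V$ has an open neighborhood $U$ in $\mathbb{C}^n$ and a holomorphic function $F$ on $U$ with $F=f$ on $V\cap U$. A Cartan pair $(\Omega,V)$ consists of a domain of holomorphy $\Omega$ and an analytic set $V$ in $\Omega$. The pair $(\Omega,V)$ is an np (norm preserving) pair if it is a Cartan pair and for every bounded holomorphic $f$ on $V$ there is a holomorphic $F$ on $\Omega$ with $F|_V=f$ and $\sup_{\Omega}|F|=\sup_V|f|$. *)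

theory Defs
  imports "HOL-Analysis.Analysis"
begin

text \<open>Holomorphy of functions of several complex variables, to be used for open sets \<open>U\<close>: the real
  Frechet derivative exists at each point of \<open>U\<close> and is complex linear.\<close>

definition holo_on :: "(complex ^ 'n \<Rightarrow> complex) \<Rightarrow> (complex ^ 'n) set \<Rightarrow> bool" where
  "holo_on F U \<longleftrightarrow>
     (\<forall>z\<in>U. \<exists>F'. (F has_derivative F') (at z) \<and> (\<forall>c v. F' (c *s v) = c * F' v))"

text \<open>The usual definition: there is no pair \<open>U\<close>, \<open>W\<close> such that every holomorphic function on
  \<open>\<Omega>\<close> agrees on \<open>U\<close> with a holomorphic function on \<open>W\<close>, where \<open>W\<close> sticks out of \<open>\<Omega>\<close>.\<close>

definition domain_of_holomorphy :: "(complex ^ 'n) set \<Rightarrow> bool" where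
  "domain_of_holomorphy \<Omega> \<longleftrightarrow>
     open \<Omega> \<and> connected \<Omega> \<and> \<Omega> \<noteq> {} \<and>
     \<not> (\<exists>U W. open U \<and> U \<noteq> {} \<and> U \<subseteq> \<Omega> \<inter> W \<and> open W \<and> connected W \<and> \<not> W \<subseteq> \<Omega> \<and>
          (\<forall>f. holo_on f \<Omega> \<longrightarrow> (\<exists>g. holo_on g W \<and> (\<forall>z\<in>U. g z = f z))))"

definition analytic_set_in :: "(complex ^ 'n) set \<Rightarrow> (complex ^ 'n) set \<Rightarrow> bool" where
  "analytic_set_in \<Omega> V \<longleftrightarrow>
     closedin (top_of_set \<Omega>) V \<and>
     (\<forall>p\<in>V. \<exists>U \<F>. open U \<and> p \<in> U \<and> U \<subseteq> \<Omega> \<and> finite \<F> \<and> (\<forall>f\<in>\<F>. holo_on f U) \<and>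
        V \<inter> U = {z \<in> U. \<forall>f\<in>\<F>. f z = 0})"

text \<open>A function on \<open>V\<close> is represented by a total function; only its values on \<open>V\<close> matter.\<close>

definition holo_on_variety :: "(complex ^ 'n \<Rightarrow> complex) \<Rightarrow> (complex ^ 'n) set \<Rightarrow> bool" where
  "holo_on_variety f V \<longleftrightarrow>
     (\<forall>p\<in>V. \<exists>U F. open U \<and> p \<in> U \<and> holo_on F U \<and> (\<forall>z\<in>V \<inter> U. F z = f z))"

definition Cartan_pair :: "(complex ^ 'n) set \<Rightarrow> (complex ^ 'n) set \<Rightarrow> bool" where
  "Cartan_pair \<Omega> V \<longleftrightarrow> domain_of_holomorphy \<Omega> \<and> analytic_set_in \<Omega> V"

text \<open>The suprema are taken in \<open>[0, \<infinity>]\<close>, so that equality forces \<open>F\<close> to be bounded on \<open>\<Omega>\<close>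
  (a supremum in \<^typ>\<open>real\<close> would be meaningless for unbounded \<open>F\<close>).\<close>

definition np_pair :: "(complex ^ 'n) set \<Rightarrow> (complex ^ 'n) set \<Rightarrow> bool" where
  "np_pair \<Omega> V \<longleftrightarrow>
     Cartan_pair \<Omega> V \<and>
     (\<forall>f. holo_on_variety f V \<and> bounded (f ` V) \<longrightarrow>
        (\<exists>F. holo_on F \<Omega> \<and> (\<forall>z\<in>V. F z = f z) \<and>
           (SUP z\<in>\<Omega>. ennreal (cmod (F z))) = (SUP z\<in>V. ennreal (cmod (f z)))))"

definition balanced :: "(complex ^ 'n) set \<Rightarrow> bool" where
  "balanced G \<longleftrightarrow> (\<forall>z\<in>G. \<forall>\<zeta>. cmod \<zeta> \<le> 1 \<longrightarrow> \<zeta> *s z \<in> G)"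

definition tridisc :: "(complex ^ 3) set" where
  "tridisc = {z. \<forall>i. z $ i \<in> ball 0 1}"

definition calV :: "(complex ^ 3) set" where
  "calV = {z \<in> tridisc. (z $ 3)\<^sup>2 = z $ 1 * z $ 2}"

definition calG :: "(complex ^ 3) set" where
  "calG = {z \<in> tridisc.
     cmod (z $ 1 * z $ 2 - (z $ 3)\<^sup>2) <
       (1 - (cmod (z $ 3))\<^sup>2) + sqrt (1 - (cmod (z $ 1))\<^sup>2) * sqrt (1 - (cmod (z $ 2))\<^sup>2)}"

end

(* The map (s, t) |-> (s^2, t^2, s t) sends the bidisc onto calV, so a function f on calV bounded by one
   is an even function phi on the bidisc bounded by one. By Ando's theorem phi has an Agler
   decomposition; evenness splits its model into an even part and an odd part. Eliminating the odd part
   gives phi = A + B M (1 - D M)^-1 C with a unitary matrix (A B; C D) and M = lambda X lambda, where X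
   is a contraction and lambda is the diagonal operator with entries s and t. The blocks of M are the
   blocks of X multiplied by s^2, s t, s t, t^2, so the same formula makes sense with z_1, z_3, z_3, z_2
   in their place, and it is bounded by one as soon as the symmetric matrix (z_1 z_3; z_3 z_2) is a
   strictly contractive Schur multiplier: this is the condition defining calG.
   All this is done on finite sets of nodes, where only matrices occur; a normal family argument then
   yields the extension.

   Conversely calG is convex and balanced. If G contained a point outside calG, a complex linear form
   would separate that point from calG, and by the Schwarz lemma the restriction of this form to calV
   would have no norm preserving extension to G. *)

theory Submission
  imports Defs "HOL-Complex_Analysis.Conformal_Mappings" "HOL-Real_Asymp.Real_Asymp"
begin


section \<open>Finite-dimensional linear algebra\<close>

text \<open>Only finite-dimensional spaces occur, so Ando's theorem has to be reached without
  infinite shifts. In dual form it is an inequality for kernels \<open>L\<close> on the nodes for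
  which multiplication by \<open>s\<close> and by \<open>t\<close> is contractive. The identity (1 -
  |s|^2) + |s|^2 (1 - |t|^2) = (1 - |t|^2) + |t|^2 (1 - |s|^2) yields one unitary, and from it two
  commuting unitaries on functions on a finite cycle are built. Wrap-around spoils a bounded number
  of places at the end of the cycle, which no longer matters as its length grows. Duality then
  returns the Agler decomposition. The square roots in \<open>calG\<close> come from a completion
  problem: the symmetric matrix of \<open>z\<close> is a Schur contraction as soon as some number
  \<beta> makes the Hermitian matrix with unit diagonal and off-diagonal entry \<beta> dominate the
  rank one matrix of each row. Each row confines \<beta> to a disc, and the inequality says that the
  two discs meet. The condition is convex jointly in \<open>z\<close> and \<beta>, which also gives
  convexity of \<open>calG\<close>.\<close>

definition cip :: "'i set \<Rightarrow> ('i \<Rightarrow> complex) \<Rightarrow> ('i \<Rightarrow> complex) \<Rightarrow> complex" where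
  "cip I x y = (\<Sum>i\<in>I. cnj (x i) * y i)"

definition nsq :: "'i set \<Rightarrow> ('i \<Rightarrow> complex) \<Rightarrow> real" where
  "nsq I x = (\<Sum>i\<in>I. (cmod (x i))\<^sup>2)"

lemma cip_self: "cip I x x = of_real (nsq I x)"
  by (simp add: cip_def nsq_def complex_norm_square mult.commute del: of_real_power)

lemma nsq_nonneg [simp]: "nsq I x \<ge> 0"
  by (simp add: nsq_def sum_nonneg)

lemma cip_cnj: "cnj (cip I x y) = cip I y x"
  by (simp add: cip_def mult.commute)

lemma cip_lin_right: "cip I x (\<lambda>i. a * y i + z i) = a * cip I x y + cip I x z"
  by (simp add: cip_def algebra_simps sum.distrib sum_distrib_left)

lemma cip_diff_right: "cip I x (\<lambda>i. y i - z i) = cip I x y - cip I x z"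
  by (simp add: cip_def algebra_simps sum_subtractf)

lemma cip_diff_left: "cip I (\<lambda>i. y i - z i) x = cip I y x - cip I z x"
  by (simp add: cip_def algebra_simps sum_subtractf)

lemma cip_scale_right: "cip I x (\<lambda>i. a * y i) = a * cip I x y"
  by (simp add: cip_def algebra_simps sum_distrib_left)

lemma cip_scale_left: "cip I (\<lambda>i. a * y i) x = cnj a * cip I y x"
  by (simp add: cip_def algebra_simps sum_distrib_left)

lemma cip_sum_right: "cip I x (\<lambda>i. \<Sum>k\<in>K. a k * y k i) = (\<Sum>k\<in>K. a k * cip I x (y k))"
  unfolding cip_def sum_distrib_left by (subst sum.swap) (simp add: ac_simps)

lemma cip_sum_left: "cip I (\<lambda>i. \<Sum>k\<in>K. a k * y k i) x = (\<Sum>k\<in>K. cnj (a k) * cip I (y k) x)"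
  unfolding cip_def by (simp add: sum_distrib_left sum_distrib_right) (subst sum.swap, simp add: ac_simps)

lemma nsq_sum:
  "of_real (nsq I (\<lambda>i. \<Sum>j\<in>J. c j * x j i)) =
     (\<Sum>i\<in>J. \<Sum>j\<in>J. cnj (c i) * c j * cip I (x i) (x j))"
  unfolding cip_self [symmetric] cip_sum_left cip_sum_right sum_distrib_left
  by (simp add: ac_simps)

section \<open>Linear maps and unitaries on spaces of functions\<close>

definition clin :: "(('i \<Rightarrow> complex) \<Rightarrow> 'j \<Rightarrow> complex) \<Rightarrow> bool" where
  "clin T \<longleftrightarrow> (\<forall>a x y. T (\<lambda>i. a * x i + y i) = (\<lambda>j. a * T x j + T y j))"

lemma clinD: "clin T \<Longrightarrow> T (\<lambda>i. a * x i + y i) = (\<lambda>j. a * T x j + T y j)"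
  by (auto simp: clin_def)

lemma clin_zero: assumes "clin T" shows "T (\<lambda>i. 0) = (\<lambda>j. 0)"
proof
  fix j
  show "T (\<lambda>i. 0) j = 0"
    using fun_cong [OF clinD [OF assms, of 1 "\<lambda>i. 0" "\<lambda>i. 0"], of j] by simp
qed

lemma clin_diff: assumes "clin T" shows "T (\<lambda>i. x i - y i) = (\<lambda>j. T x j - T y j)"
  using clinD [OF assms, of "-1" y x] by (simp add: algebra_simps)

lemma clin_sum:
  assumes "clin T" "finite K"
  shows "T (\<lambda>i. \<Sum>k\<in>K. a k * x k i) = (\<lambda>j. \<Sum>k\<in>K. a k * T (x k) j)"
  using assms(2)
proof (induction K rule: finite_induct)
  case empty
  then show ?case by (simp add: clin_zero assms)
next
  case (insert k K)
  then show ?case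
    using clinD [OF assms(1), of "a k" "x k" "\<lambda>i. \<Sum>k\<in>K. a k * x k i"] by simp
qed

lemma clin_compose: "clin S \<Longrightarrow> clin T \<Longrightarrow> clin (\<lambda>x. S (T x))"
  by (auto simp: clin_def)

text \<open>The inverse is part of the data because \<open>dilA\<close> is built from it. The last
  clause keeps vectors supported in \<open>I\<close> supported there; later this makes the iterates
  of a transfer function finite sums in their coordinates.\<close>

definition unitary_pair where
  "unitary_pair I U U' \<longleftrightarrow> clin U \<and> clin U' \<and> (\<forall>x. U (U' x) = x) \<and> (\<forall>x. U' (U x) = x) \<and>
     (\<forall>x y. cip I (U x) (U y) = cip I x y) \<and> (\<forall>x i. i \<notin> I \<longrightarrow> U x i = x i)"

lemma unitary_pairD:
  assumes "unitary_pair I U U'"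
  shows "clin U" "clin U'" "U (U' x) = x" "U' (U x) = x" "cip I (U x) (U y) = cip I x y"
    "i \<notin> I \<Longrightarrow> U x i = x i" "nsq I (U x) = nsq I x" "nsq I (U' x) = nsq I x"
proof -
  show "clin U" "clin U'" "U (U' x) = x" "U' (U x) = x" "i \<notin> I \<Longrightarrow> U x i = x i"
    using assms by (auto simp: unitary_pair_def)
  have *: "cip I (U x) (U y) = cip I x y" for x y
    using assms by (auto simp: unitary_pair_def)
  then show "cip I (U x) (U y) = cip I x y" .
  have **: "nsq I (U x) = nsq I x" for x
    using *[of x x] unfolding cip_self by simp
  then show "nsq I (U x) = nsq I x" .
  show "nsq I (U' x) = nsq I x"
    using **[of "U' x"] assms by (simp add: unitary_pair_def)
qed

lemma unitary_pair_compose: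
  assumes "unitary_pair I U U'" "unitary_pair I S S'"
  shows "unitary_pair I (\<lambda>x. U (S x)) (\<lambda>x. S' (U' x))"
  using assms by (auto simp: unitary_pair_def clin_compose)

text \<open>A Householder reflection with a complex factor: expanding the inner product of two
  images leaves |\<alpha>|^2 |d|^2 - 2 Re \<alpha> times a rank one term. A real factor would only
  reach targets whose inner product with the source is real.\<close>

lemma unitary_pair_reflection:
  assumes d: "\<And>i. i \<notin> I \<Longrightarrow> d i = 0" and \<alpha>: "(cmod \<alpha>)\<^sup>2 * nsq I d = 2 * Re \<alpha>"
  shows "unitary_pair I (\<lambda>x i. x i - \<alpha> * cip I d x * d i) (\<lambda>x i. x i - cnj \<alpha> * cip I d x * d i)"
proof -
  have \<alpha>': "\<alpha> * cnj \<alpha> * cip I d d = \<alpha> + cnj \<alpha>"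
    unfolding cip_self complex_norm_square [symmetric] complex_add_cnj
    using \<alpha> by (metis of_real_mult)
  have lin: "clin (\<lambda>x i. x i - \<beta> * cip I d x * d i)" for \<beta>
    unfolding clin_def cip_lin_right by (simp add: fun_eq_iff algebra_simps)
  have inv: "x i - \<beta> * cip I d x * d i - \<gamma> * cip I d (\<lambda>i. x i - \<beta> * cip I d x * d i) * d i = x i"
    if "\<gamma> * \<beta> * cip I d d = \<gamma> + \<beta>" for x i \<beta> \<gamma>
  proof -
    have *: "cip I d (\<lambda>i. x i - \<beta> * cip I d x * d i) = cip I d x - \<beta> * cip I d x * cip I d d"
      by (simp add: cip_diff_right cip_scale_right)
    have "x i - \<beta> * cip I d x * d i - \<gamma> * cip I d (\<lambda>i. x i - \<beta> * cip I d x * d i) * d i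
       = x i - cip I d x * d i * (\<gamma> + \<beta> - \<gamma> * \<beta> * cip I d d)"
      unfolding * by (simp add: algebra_simps)
    then show ?thesis using that by simp
  qed
  have iso: "cip I (\<lambda>i. x i - \<alpha> * cip I d x * d i) (\<lambda>i. y i - \<alpha> * cip I d y * d i) = cip I x y" for x y
  proof -
    have "cip I (\<lambda>i. x i - \<alpha> * cip I d x * d i) (\<lambda>i. y i - \<alpha> * cip I d y * d i)
       = cip I x y + cip I x d * cip I d y * (\<alpha> * cnj \<alpha> * cip I d d - (\<alpha> + cnj \<alpha>))"
      unfolding cip_diff_right cip_diff_left cip_scale_right cip_scale_left
      by (simp add: cip_cnj algebra_simps)
    then show ?thesis using \<alpha>' by simp
  qed
  show ?thesis
    unfolding unitary_pair_def
  proof (intro conjI allI impI)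
    show "(\<lambda>i. (\<lambda>i. x i - cnj \<alpha> * cip I d x * d i) i
        - \<alpha> * cip I d (\<lambda>i. x i - cnj \<alpha> * cip I d x * d i) * d i) = x" for x
      using \<alpha>' by (intro ext inv) simp
    show "(\<lambda>i. (\<lambda>i. x i - \<alpha> * cip I d x * d i) i
        - cnj \<alpha> * cip I d (\<lambda>i. x i - \<alpha> * cip I d x * d i) * d i) = x" for x
      using \<alpha>' by (intro ext inv) (simp add: ac_simps)
  qed (use lin iso d in auto)
qed

text \<open>One vector at a time: the reflection along \<open>U (x j) - y j\<close> moves \<open>U (x j)\<close> to \<open>y j\<close> and fixes
  the vectors already in place, which are orthogonal to that difference.\<close>

lemma unitary_extension:
  assumes "finite J" "\<And>j i. i \<notin> I \<Longrightarrow> x j i = 0" "\<And>j i. i \<notin> I \<Longrightarrow> y j i = 0" "finite I"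
    and "\<And>j k. j \<in> J \<Longrightarrow> k \<in> J \<Longrightarrow> cip I (x j) (x k) = cip I (y j) (y k)"
  shows "\<exists>U U'. unitary_pair I U U' \<and> (\<forall>j\<in>J. U (x j) = y j)"
  using assms(1,5)
proof (induction J rule: finite_induct)
  case empty
  have "unitary_pair I (\<lambda>x. x) (\<lambda>x. x)" by (simp add: unitary_pair_def clin_def)
  then show ?case by blast
next
  case (insert n J)
  then obtain U U' where U: "unitary_pair I U U'" and Ux: "\<And>j. j \<in> J \<Longrightarrow> U (x j) = y j"
    by (metis insertI2)
  note UD = unitary_pairD [OF U]
  define u where "u = U (x n)"
  define d where "d = (\<lambda>i. u i - y n i)"
  define \<alpha> where "\<alpha> = 1 / cip I d u"
  have d0: "d i = 0" if "i \<notin> I" for i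
    using that assms(2,3) by (simp add: d_def u_def UD(6))
  show ?case
  proof (cases "nsq I d = 0")
    case True
    then have "d i = 0" for i
      using d0 assms(4) by (cases "i \<in> I") (auto simp: nsq_def sum_nonneg_eq_0_iff)
    then have "U (x n) = y n" by (auto simp: d_def u_def)
    then show ?thesis using U Ux by blast
  next
    case False
    have uu: "cip I u u = cip I (y n) (y n)"
      using insert.prems[of n n] UD(5) by (simp add: u_def)
    \<comment> \<open>Equal norms of \<open>u\<close> and \<open>y n\<close> give |d|^2 = 2 Re <d,
      u>. This is the unitarity condition on \<alpha> and shows that its denominator is not
      0.\<close>
    have dd: "cip I d d = 2 * of_real (Re (cip I d u))"
    proof -
      have "cip I d d = cip I d u + cnj (cip I d u)"
        using uu by (simp add: d_def cip_diff_right cip_diff_left cip_cnj)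
      then show ?thesis by (simp add: complex_add_cnj)
    qed
    then have nd: "nsq I d = 2 * Re (cip I d u)"
      unfolding cip_self by (metis Re_complex_of_real of_real_mult of_real_numeral)
    then have n0: "cip I d u \<noteq> 0" using False by auto
    have "(cmod \<alpha>)\<^sup>2 * nsq I d = 2 * Re \<alpha>"
      unfolding nd \<alpha>_def using n0
      by (simp add: norm_divide power_divide Re_divide cmod_power2)
    from unitary_pair_reflection [of I d \<alpha>, OF d0 this]
    have R: "unitary_pair I (\<lambda>x i. x i - \<alpha> * cip I d x * d i) (\<lambda>x i. x i - cnj \<alpha> * cip I d x * d i)"
      by simp
    have "U (x n) i - \<alpha> * cip I d (U (x n)) * d i = y n i" for i
      using n0 unfolding \<alpha>_def u_def[symmetric] by (simp add: d_def)
    moreover have "U (x j) i - \<alpha> * cip I d (U (x j)) * d i = y j i" if "j \<in> J" for i j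
    proof -
      have "cip I d (y j) = 0"
        using insert.prems[of n j] that UD(5)[of "x n" "x j"]
        by (simp add: d_def cip_diff_left u_def flip: Ux)
      then show ?thesis using Ux that by simp
    qed
    ultimately show ?thesis
      using unitary_pair_compose [OF R U] by blast
  qed
qed

text \<open>Hermitian symmetry is a separate clause, since the real part of the form does not see a
  skew-Hermitian summand.\<close>

definition psd :: "'i set \<Rightarrow> ('i \<Rightarrow> 'i \<Rightarrow> complex) \<Rightarrow> bool" where
  "psd J K \<longleftrightarrow> (\<forall>i\<in>J. \<forall>j\<in>J. K j i = cnj (K i j)) \<and>
     (\<forall>c. 0 \<le> Re (\<Sum>i\<in>J. \<Sum>j\<in>J. cnj (c i) * c j * K i j))"

lemma psd_sym: "psd J K \<Longrightarrow> i \<in> J \<Longrightarrow> j \<in> J \<Longrightarrow> K j i = cnj (K i j)"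
  unfolding psd_def by blast

lemma psd_nonneg: "psd J K \<Longrightarrow> 0 \<le> Re (\<Sum>i\<in>J. \<Sum>j\<in>J. cnj (c i) * c j * K i j)"
  unfolding psd_def by blast

lemma psd_subset:
  assumes "psd J K" "finite J" "I \<subseteq> J"
  shows "psd I K"
  unfolding psd_def
proof (intro conjI allI)
  show "\<forall>i\<in>I. \<forall>j\<in>I. K j i = cnj (K i j)" using assms psd_sym[OF assms(1)] by blast
  fix c :: "'a \<Rightarrow> complex"
  define c' where "c' i = (if i \<in> I then c i else 0)" for i
  have "(\<Sum>i\<in>I. \<Sum>j\<in>I. cnj (c i) * c j * K i j) = (\<Sum>i\<in>I. \<Sum>j\<in>I. cnj (c' i) * c' j * K i j)"
    by (simp add: c'_def)
  also have "\<dots> = (\<Sum>i\<in>J. \<Sum>j\<in>I. cnj (c' i) * c' j * K i j)"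
    using assms(2,3) by (intro sum.mono_neutral_left) (auto simp: c'_def)
  also have "\<dots> = (\<Sum>i\<in>J. \<Sum>j\<in>J. cnj (c' i) * c' j * K i j)"
    using assms(2,3) by (intro sum.cong refl sum.mono_neutral_left) (auto simp: c'_def)
  finally show "0 \<le> Re (\<Sum>i\<in>I. \<Sum>j\<in>I. cnj (c i) * c j * K i j)"
    using psd_nonneg [OF assms(1), of c'] by simp
qed

lemma psd_diag:
  assumes "psd J K" "finite J" "i \<in> J"
  shows "K i i = of_real (Re (K i i))" "Re (K i i) \<ge> 0"
proof -
  have "psd {i} K" using psd_subset[of J K "{i}"] assms by auto
  then have "0 \<le> Re (K i i)" using psd_nonneg[of "{i}" K "\<lambda>_. 1"] by simp
  moreover have "Im (K i i) = Im (cnj (K i i))"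
    using psd_sym[OF assms(1,3,3)] by (rule arg_cong)
  ultimately show "K i i = of_real (Re (K i i))" "Re (K i i) \<ge> 0"
    by (auto simp: complex_eq_iff)
qed

text \<open>Nonnegativity of a principal 2 by 2 minor. A zero diagonal entry is treated apart, since
  the usual test vector then says nothing.\<close>

lemma psd_cauchy_schwarz:
  assumes "psd J K" "finite J" "i \<in> J" "j \<in> J"
  shows "(cmod (K i j))\<^sup>2 \<le> Re (K i i) * Re (K j j)"
proof (cases "i = j")
  case True
  have "cmod (K i i) = Re (K i i)"
    using psd_diag[OF assms(1-3)] by (metis abs_of_nonneg norm_of_real)
  then show ?thesis using True by (simp add: power2_eq_square)
next
  case False
  define p q where "p = Re (K i i)" and "q = Re (K j j)"
  have p: "K i i = of_real p" "p \<ge> 0" and q: "K j j = of_real q" "q \<ge> 0"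
    unfolding p_def q_def by (rule psd_diag [OF assms(1,2)]; fact)+
  have P: "psd {i,j} K" using psd_subset[of J K "{i,j}"] assms by auto
  have sym: "K j i = cnj (K i j)" by (rule psd_sym [OF assms(1,3,4)])
  have *: "0 \<le> (cmod a)\<^sup>2 * p + (cmod b)\<^sup>2 * q + 2 * Re (cnj a * b * K i j)" for a b
  proof -
    have "0 \<le> Re (\<Sum>k\<in>{i,j}. \<Sum>l\<in>{i,j}. cnj (if k = i then a else b) * (if l = i then a else b) * K k l)"
      by (rule psd_nonneg [OF P])
    also have "(\<Sum>k\<in>{i,j}. \<Sum>l\<in>{i,j}. cnj (if k = i then a else b) * (if l = i then a else b) * K k l)
      = cnj a * a * of_real p + cnj b * b * of_real q + (cnj a * b * K i j + cnj (cnj a * b * K i j))"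
      using False by (auto simp: sym p q algebra_simps)
    also have "Re \<dots> = (cmod a)\<^sup>2 * p + (cmod b)\<^sup>2 * q + 2 * Re (cnj a * b * K i j)"
      by (simp add: cmod_power2) (simp add: algebra_simps power2_eq_square)
    finally show ?thesis .
  qed
  define r where "r = (cmod (K i j))\<^sup>2"
  have k: "cnj (K i j) * K i j = of_real r"
    by (simp add: r_def complex_norm_square mult.commute del: of_real_power)
  have k': "cnj (of_real t * K i j) * of_real u * K i j = of_real (t * u * r)" for t u
  proof -
    have "cnj (of_real t * K i j) * of_real u * K i j = of_real t * of_real u * (cnj (K i j) * K i j)"
      by simp
    then show ?thesis unfolding k by simp
  qed
  have **: "0 \<le> t\<^sup>2 * r * p + u\<^sup>2 * q + 2 * (t * u * r)" for t u
    using *[of "of_real t * K i j" "of_real u"] unfolding k' Re_complex_of_real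
    by (simp add: norm_mult power_mult_distrib r_def)
  show ?thesis
    unfolding p_def [symmetric] q_def [symmetric] r_def [symmetric]
  proof (cases "p = 0")
    case True
    have "r = 0"
    proof (rule ccontr)
      assume "r \<noteq> 0"
      \<comment> \<open>For \<open>p = 0\<close> and \<open>u = 1\<close> the form is q + 2 t r, and
        this \<open>t\<close> makes it -1.\<close>
      then show False using **[of "- (q + 1) / (2 * r)" 1] True by (simp add: field_simps)
    qed
    then show "r \<le> p * q" using True by simp
  next
    case False
    have "0 \<le> p * (p * q - r)"
      using **[of "-1" p] by (simp add: algebra_simps power2_eq_square)
    then show "r \<le> p * q" using False p by (simp add: zero_le_mult_iff)
  qed
qed

text \<open>Cholesky factorization, one pivot \<open>x\<close> at a time. The new coordinate is
  indexed by \<open>x\<close> itself, so the Gram vectors again live on \<open>J\<close> and all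
  later spaces are indexed by nodes.\<close>

lemma psd_gram:
  assumes "finite J" "psd J K"
  shows "\<exists>a. (\<forall>j i. i \<notin> J \<longrightarrow> a j i = 0) \<and> (\<forall>i\<in>J. \<forall>j\<in>J. K i j = cip J (a i) (a j))"
  using assms
proof (induction J arbitrary: K rule: finite_induct)
  case empty
  then show ?case by (auto intro: exI[of _ "\<lambda>_ _. 0"])
next
  case (insert x J)
  have fin: "finite (insert x J)" using insert by simp
  define p where "p = Re (K x x)"
  have p: "K x x = of_real p" "p \<ge> 0"
    unfolding p_def by (rule psd_diag [OF insert.prems fin], simp)+
  have sym: "K j i = cnj (K i j)" if "i \<in> insert x J" "j \<in> insert x J" for i j
    using insert.prems that by (rule psd_sym)
  have z: "K x j = 0" if "p = 0" "j \<in> insert x J" for j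
    using psd_cauchy_schwarz[OF insert.prems fin, of x j] that by (auto simp: p_def)
  \<comment> \<open>The Schur complement. For a zero pivot the row of \<open>x\<close> vanishes and
    division by 0 gives 0, so \<open>K'\<close> is then \<open>K\<close>.\<close>
  define K' where "K' i j = K i j - K i x * K x j / K x x" for i j
  have "psd J K'"
    unfolding psd_def
  proof (intro conjI allI)
    show "\<forall>i\<in>J. \<forall>j\<in>J. K' j i = cnj (K' i j)"
    proof (intro ballI)
      fix i j assume "i \<in> J" "j \<in> J"
      then show "K' j i = cnj (K' i j)"
        using sym[of i j] sym[of x i] sym[of x j] by (simp add: K'_def p mult.commute)
    qed
    fix c
    define S where "S = (\<Sum>j\<in>J. c j * K x j)"
    \<comment> \<open>This value at \<open>x\<close> minimizes the form, and the minimum is the form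
      of \<open>K'\<close>.\<close>
    define c' where "c' i = (if i = x then - S / K x x else c i)" for i
    have nx: "i \<noteq> x" if "i \<in> J" for i using insert that by auto
    have S': "(\<Sum>i\<in>J. cnj (c i) * K i x) = cnj S"
      unfolding S_def cnj_sum using sym[of x] by (intro sum.cong) auto
    have 1: "cnj (c' x) * c' x * K x x + cnj (c' x) * S + c' x * cnj S = - (cnj S * S / K x x)"
    proof (cases "p = 0")
      case True
      then show ?thesis by (simp add: c'_def p)
    next
      case False
      then show ?thesis by (simp add: c'_def p)
    qed
    have 2: "cnj S * S = (\<Sum>i\<in>J. \<Sum>j\<in>J. cnj (c i) * c j * (K i x * K x j))"
      unfolding S'[symmetric] unfolding S_def sum_product by (simp add: ac_simps)
    have "(\<Sum>i\<in>insert x J. \<Sum>j\<in>insert x J. cnj (c' i) * c' j * K i j)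
      = cnj (c' x) * c' x * K x x + cnj (c' x) * (\<Sum>j\<in>J. c' j * K x j)
        + c' x * (\<Sum>i\<in>J. cnj (c' i) * K i x) + (\<Sum>i\<in>J. \<Sum>j\<in>J. cnj (c' i) * c' j * K i j)"
      using insert.hyps by (simp add: sum.distrib sum_distrib_left mult_ac add_ac)
    also have "\<dots> = cnj (c' x) * c' x * K x x + cnj (c' x) * S + c' x * cnj S
        + (\<Sum>i\<in>J. \<Sum>j\<in>J. cnj (c i) * c j * K i j)"
      unfolding S'[symmetric] unfolding S_def
      using nx by (simp add: c'_def cong: sum.cong)
    also have "\<dots> = (\<Sum>i\<in>J. \<Sum>j\<in>J. cnj (c i) * c j * K' i j)"
      unfolding 1 2
      by (simp add: K'_def right_diff_distrib sum_subtractf sum_divide_distrib)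
    finally have 3: "(\<Sum>i\<in>insert x J. \<Sum>j\<in>insert x J. cnj (c' i) * c' j * K i j)
      = (\<Sum>i\<in>J. \<Sum>j\<in>J. cnj (c i) * c j * K' i j)" .
    have "0 \<le> Re (\<Sum>i\<in>insert x J. \<Sum>j\<in>insert x J. cnj (c' i) * c' j * K i j)"
      by (rule psd_nonneg [OF insert.prems])
    then show "0 \<le> Re (\<Sum>i\<in>J. \<Sum>j\<in>J. cnj (c i) * c j * K' i j)"
      unfolding 3 .
  qed
  from insert.IH[OF this] obtain a where a0: "\<And>j i. i \<notin> J \<Longrightarrow> a j i = 0"
    and a: "\<And>i j. i \<in> J \<Longrightarrow> j \<in> J \<Longrightarrow> K' i j = cip J (a i) (a j)" by blast
  define b where "b j i = (if i = x then if j \<in> insert x J then K x j / of_real (sqrt p) else 0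
      else if j \<in> J then a j i else 0)" for j i
  have nx: "i \<noteq> x" if "i \<in> J" for i using insert that by auto
  have sq: "complex_of_real (sqrt p) * of_real (sqrt p) = of_real p"
    using p by (simp flip: of_real_mult)
  have bb: "cip (insert x J) (b i) (b j) = K i j" if ij: "i \<in> insert x J" "j \<in> insert x J" for i j
  proof -
    have "cip (insert x J) (b i) (b j) = K i x * K x j / K x x + cip J (b i) (b j)"
      using insert.hyps ij sym[of x i] sq by (simp add: cip_def b_def p)
    also have "cip J (b i) (b j) = (if i \<in> J \<and> j \<in> J then cip J (a i) (a j) else 0)"
      using nx by (auto simp: cip_def b_def intro!: sum.neutral)
    finally have eq: "cip (insert x J) (b i) (b j) =
      K i x * K x j / K x x + (if i \<in> J \<and> j \<in> J then cip J (a i) (a j) else 0)" .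
    consider "i \<in> J" "j \<in> J" | "i = x" | "j = x" using ij by blast
    then show ?thesis
    proof cases
      case 1
      then show ?thesis unfolding eq by (simp add: K'_def flip: a)
    next
      case 2
      then show ?thesis unfolding eq using insert.hyps z[of j] ij p by (cases "p = 0") auto
    next
      case 3
      then show ?thesis
        unfolding eq using insert.hyps z[of i] sym[of x i] ij p by (cases "p = 0") auto
    qed
  qed
  have "b j i = 0" if "i \<notin> insert x J" for i j
    using that a0 by (auto simp: b_def)
  then show ?case using bb by (intro exI[of _ b]) auto
qed

section \<open>Commuting isometries and the discrete Fourier transform\<close>

lemma roots_of_unity_orthogonal:
  fixes Q :: nat
  assumes "a < Q" "b < Q"
  defines "\<omega> \<equiv> \<lambda>j::nat. cis (2 * pi * real j / real Q)"
  shows "(\<Sum>j<Q. cnj (\<omega> j ^ a) * \<omega> j ^ b) = (if a = b then of_nat Q else 0)"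
proof -
  define x where "x = cis (2 * pi * (real b - real a) / real Q)"
  have Q: "real Q > 0" using assms by simp
  have *: "cnj (\<omega> j ^ a) * \<omega> j ^ b = x ^ j" for j
    unfolding \<omega>_def x_def Complex.DeMoivre cis_cnj cis_mult
    by (simp add: diff_divide_distrib algebra_simps)
  show ?thesis
  proof (cases "a = b")
    case True
    then show ?thesis unfolding * by (simp add: x_def)
  next
    case False
    have xQ: "x ^ Q = 1"
    proof -
      have "x ^ Q = cis (2 * pi * of_int (int b - int a))"
        unfolding x_def Complex.DeMoivre using Q by simp
      also have "\<dots> = 1" by (rule cis_multiple_2pi) simp
      finally show ?thesis .
    qed
    have "x \<noteq> 1"
    proof
      assume "x = 1"
      then have "cos (2 * pi * (real b - real a) / real Q) = 1"
        by (simp add: x_def complex_eq_iff)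
      then obtain n :: int where "2 * pi * (real b - real a) / real Q = n * 2 * pi"
        using cos_one_2pi_int by auto
      then have "(2 * pi) * (real b - real a) = (2 * pi) * (real_of_int n * real Q)"
        using Q by (simp add: field_simps)
      then have "real b - real a = real_of_int n * real Q"
        using pi_gt_zero by (metis mult_cancel_left mult_eq_0_iff pi_neq_zero zero_neq_numeral)
      then have "real_of_int (int b - int a) = real_of_int (n * int Q)" by simp
      then have n: "int b - int a = n * int Q" by linarith
      then have "n \<noteq> 0" using False by auto
      then have "\<bar>n * int Q\<bar> \<ge> int Q" using Q
        by (simp add: abs_mult)
      then show False using n assms(1,2) by linarith
    qed
    then have "(\<Sum>j<Q. x ^ j) = 0" using geometric_sum[of x Q] xQ by simp
    then show ?thesis unfolding * using False by simp
  qed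
qed

lemma bessel_inequality:
  assumes "finite K" "c > 0"
    and orth: "\<And>k l. k \<in> K \<Longrightarrow> l \<in> K \<Longrightarrow> cip S (e k) (e l) = (if k = l then of_real c else 0)"
  shows "(\<Sum>k\<in>K. (cmod (cip S (e k) h))\<^sup>2) \<le> c * nsq S h"
    and "nsq S (\<lambda>x. \<Sum>k\<in>K. v k * e k x) = c * (\<Sum>k\<in>K. (cmod (v k))\<^sup>2)"
    and "\<And>k. k \<in> K \<Longrightarrow> cip S (e k) (\<lambda>x. \<Sum>k\<in>K. v k * e k x) = of_real c * v k"
proof -
  have coef: "cip S (e k) (\<lambda>x. \<Sum>k\<in>K. v k * e k x) = of_real c * v k" if "k \<in> K" for k v
  proof -
    have "(\<Sum>l\<in>K. v l * cip S (e k) (e l)) = (\<Sum>l\<in>K. if l = k then of_real c * v k else 0)"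
      using that by (intro sum.cong) (auto simp: orth)
    then show ?thesis using that assms(1) by (simp add: cip_sum_right)
  qed
  show "\<And>k. k \<in> K \<Longrightarrow> cip S (e k) (\<lambda>x. \<Sum>k\<in>K. v k * e k x) = of_real c * v k"
    by (rule coef)
  have pars: "nsq S (\<lambda>x. \<Sum>k\<in>K. v k * e k x) = c * (\<Sum>k\<in>K. (cmod (v k))\<^sup>2)" for v
  proof -
    let ?g = "\<lambda>x. \<Sum>k\<in>K. v k * e k x"
    have "of_real (nsq S ?g) = (\<Sum>k\<in>K. cnj (v k) * cip S (e k) ?g)"
      by (simp add: cip_self [symmetric] cip_sum_left)
    also have "\<dots> = (\<Sum>k\<in>K. of_real (c * (cmod (v k))\<^sup>2))"
    proof (rule sum.cong)
      fix k assume "k \<in> K"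
      then have "cnj (v k) * cip S (e k) ?g = of_real c * (v k * cnj (v k))"
        unfolding coef[OF \<open>k \<in> K\<close>] by simp
      also have "\<dots> = of_real (c * (cmod (v k))\<^sup>2)"
        unfolding complex_norm_square [symmetric] by simp
      finally show "cnj (v k) * cip S (e k) ?g = of_real (c * (cmod (v k))\<^sup>2)" .
    qed simp
    also have "\<dots> = of_real (c * (\<Sum>k\<in>K. (cmod (v k))\<^sup>2))"
      by (simp add: sum_distrib_left)
    finally show ?thesis by (simp only: of_real_eq_iff)
  qed
  show "nsq S (\<lambda>x. \<Sum>k\<in>K. v k * e k x) = c * (\<Sum>k\<in>K. (cmod (v k))\<^sup>2)" by (rule pars)
  \<comment> \<open>\<open>?g\<close> is the orthogonal projection of \<open>h\<close> onto the span
    of the \<open>e k\<close>.\<close>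
  define a where "a k = cip S (e k) h / of_real c" for k
  let ?g = "\<lambda>x. \<Sum>k\<in>K. a k * e k x"
  have gh: "cip S ?g h = cip S ?g ?g"
    unfolding cip_sum_left
  proof (rule sum.cong)
    fix k assume "k \<in> K"
    show "cnj (a k) * cip S (e k) h = cnj (a k) * cip S (e k) ?g"
      unfolding coef [OF \<open>k \<in> K\<close>] using assms(2) by (simp add: a_def)
  qed simp
  have hg: "cip S h ?g = cip S ?g ?g"
    using arg_cong [OF gh, of cnj] by (simp only: cip_cnj)
  have "of_real (nsq S (\<lambda>x. h x - ?g x)) = (of_real (nsq S h - nsq S ?g) :: complex)"
    unfolding of_real_diff cip_self [symmetric] cip_diff_right cip_diff_left hg gh
    by simp
  then have "nsq S (\<lambda>x. h x - ?g x) = nsq S h - nsq S ?g" by (simp only: of_real_eq_iff)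
  then have "nsq S ?g \<le> nsq S h" using nsq_nonneg[of S "\<lambda>x. h x - ?g x"] by linarith
  then have "c * (c * (\<Sum>k\<in>K. (cmod (a k))\<^sup>2)) \<le> c * nsq S h"
    unfolding pars using assms(2) by simp
  also have "c * (c * (\<Sum>k\<in>K. (cmod (a k))\<^sup>2)) = (\<Sum>k\<in>K. (cmod (cip S (e k) h))\<^sup>2)"
    using assms(2) by (simp add: a_def norm_divide power_divide sum_distrib_left power2_eq_square)
  finally show "(\<Sum>k\<in>K. (cmod (cip S (e k) h))\<^sup>2) \<le> c * nsq S h" .
qed

definition bipoly :: "(nat \<times> nat \<Rightarrow> complex) \<Rightarrow> nat \<Rightarrow> complex \<Rightarrow> complex \<Rightarrow> complex" where
  "bipoly cf d s t = (\<Sum>q\<in>{..<d} \<times> {..<d}. cf q * (s ^ fst q * t ^ snd q))"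

text \<open>\<open>bipoly cf d\<close> applied to the two backward shifts of a double sequence, seen through the
  discrete Fourier transform on \<open>(\<int>/Q)\<^sup>2\<close>.\<close>

lemma bipoly_shift_bound:
  assumes B: "\<And>s t. cmod s = 1 \<Longrightarrow> cmod t = 1 \<Longrightarrow> cmod (bipoly cf d s t) \<le> B"
  shows "(\<Sum>k\<in>{..<N} \<times> {..<N}.
      (cmod (\<Sum>q\<in>{..<d} \<times> {..<d}. cf q * v (fst k + fst q, snd k + snd q)))\<^sup>2)
    \<le> B\<^sup>2 * (\<Sum>k\<in>{..<N+d} \<times> {..<N+d}. (cmod (v k))\<^sup>2)"
proof (cases "N = 0")
  case True
  then show ?thesis by (simp add: sum_nonneg)
next
  case False
  \<comment> \<open>With this period the indices \<open>k + q\<close> with \<open>k < N\<close> and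
    \<open>q < d\<close> do not wrap around.\<close>
  define Q where "Q = N + d"
  define \<omega> where "\<omega> = (\<lambda>j::nat. cis (2 * pi * real j / real Q))"
  define K where "K = {..<Q} \<times> {..<Q}"
  \<comment> \<open>The conjugate matters: multiplying \<open>g\<close> by a character replaces its
    coefficient at \<open>k\<close> by the one at \<open>k + q\<close>, a backward shift.\<close>
  define e where "e k = (\<lambda>x. cnj (\<omega> (fst x) ^ fst k * \<omega> (snd x) ^ snd k))" for k :: "nat \<times> nat"
  define c where "c = (real Q)\<^sup>2"
  have c: "c > 0" using False by (simp add: c_def Q_def)
  have finK: "finite K" by (simp add: K_def)
  have orth: "cip K (e k) (e l) = (if k = l then of_real c else 0)" if "k \<in> K" "l \<in> K" for k l
  proof -
    have "cip K (e k) (e l) = (\<Sum>x<Q. cnj (\<omega> x ^ fst l) * \<omega> x ^ fst k) * (\<Sum>y<Q. cnj (\<omega> y ^ snd l) * \<omega> y ^ snd k)"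
      unfolding cip_def K_def sum_product sum.cartesian_product e_def
      by (intro sum.cong) (auto simp: algebra_simps)
    also have "\<dots> = (if k = l then of_real c else 0)"
      using that unfolding \<omega>_def
      by (subst (1 2) roots_of_unity_orthogonal) (auto simp: K_def c_def power2_eq_square prod_eq_iff)
    finally show ?thesis .
  qed
  define g where "g = (\<lambda>x. \<Sum>k\<in>K. v k * e k x)"
  define h where "h x = bipoly cf d (\<omega> (fst x)) (\<omega> (snd x)) * g x" for x
  have w: "cip K (e k) h = of_real c * (\<Sum>q\<in>{..<d} \<times> {..<d}. cf q * v (fst k + fst q, snd k + snd q))"
    if k: "k \<in> {..<N} \<times> {..<N}" for k
  proof -
    have h: "h = (\<lambda>x. \<Sum>q\<in>{..<d} \<times> {..<d}. cf q * (\<omega> (fst x) ^ fst q * \<omega> (snd x) ^ snd q * g x))"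
      by (simp add: h_def bipoly_def sum_distrib_right mult.assoc fun_eq_iff)
    have "cip K (e k) h = (\<Sum>q\<in>{..<d} \<times> {..<d}. cf q *
        cip K (e k) (\<lambda>x. \<omega> (fst x) ^ fst q * \<omega> (snd x) ^ snd q * g x))"
      unfolding h cip_sum_right ..
    also have "\<dots> = (\<Sum>q\<in>{..<d} \<times> {..<d}. cf q * (of_real c * v (fst k + fst q, snd k + snd q)))"
    proof (rule sum.cong)
      fix q assume q: "q \<in> {..<d} \<times> {..<d}"
      have "cip K (e k) (\<lambda>x. \<omega> (fst x) ^ fst q * \<omega> (snd x) ^ snd q * g x)
        = cip K (e (fst k + fst q, snd k + snd q)) g"
        unfolding cip_def e_def by (simp add: power_add ac_simps)
      also have "\<dots> = of_real c * v (fst k + fst q, snd k + snd q)"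
        unfolding g_def by (rule bessel_inequality(3) [OF finK c orth]) (use k q in \<open>auto simp: K_def Q_def\<close>)
      finally show "cf q * cip K (e k) (\<lambda>x. \<omega> (fst x) ^ fst q * \<omega> (snd x) ^ snd q * g x)
        = cf q * (of_real c * v (fst k + fst q, snd k + snd q))" by simp
    qed simp
    finally show ?thesis by (simp add: sum_distrib_left mult.left_commute)
  qed
  have "c\<^sup>2 * (\<Sum>k\<in>{..<N} \<times> {..<N}.
      (cmod (\<Sum>q\<in>{..<d} \<times> {..<d}. cf q * v (fst k + fst q, snd k + snd q)))\<^sup>2)
    = (\<Sum>k\<in>{..<N} \<times> {..<N}. (cmod (cip K (e k) h))\<^sup>2)"
    unfolding sum_distrib_left using c by (intro sum.cong) (auto simp: w norm_mult power_mult_distrib)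
  also have "\<dots> \<le> (\<Sum>k\<in>K. (cmod (cip K (e k) h))\<^sup>2)"
    using finK by (intro sum_mono2) (auto simp: K_def Q_def)
  also have "\<dots> \<le> c * nsq K h"
    by (rule bessel_inequality(1) [OF finK c orth])
  also have "nsq K h \<le> B\<^sup>2 * nsq K g"
    unfolding nsq_def sum_distrib_left
  proof (rule sum_mono)
    fix x
    have "cmod (h x) \<le> B * cmod (g x)"
      unfolding h_def norm_mult by (intro mult_right_mono B) (auto simp: \<omega>_def)
    then show "(cmod (h x))\<^sup>2 \<le> B\<^sup>2 * (cmod (g x))\<^sup>2"
      by (metis norm_ge_zero power_mono power_mult_distrib)
  qed
  also have "nsq K g = c * (\<Sum>k\<in>K. (cmod (v k))\<^sup>2)"
    unfolding g_def by (rule bessel_inequality(2) [OF finK c orth])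
  finally have "c\<^sup>2 * (\<Sum>k\<in>{..<N} \<times> {..<N}.
      (cmod (\<Sum>q\<in>{..<d} \<times> {..<d}. cf q * v (fst k + fst q, snd k + snd q)))\<^sup>2)
    \<le> c\<^sup>2 * (B\<^sup>2 * (\<Sum>k\<in>K. (cmod (v k))\<^sup>2))"
    using c by (simp add: power2_eq_square algebra_simps)
  then show ?thesis using c by (simp add: K_def Q_def)
qed

lemma funpow_commute:
  assumes "\<And>x. f (g x) = g (f x)"
  shows "(f ^^ m) ((g ^^ n) x) = (g ^^ n) ((f ^^ m) x)"
proof -
  have *: "f ((g ^^ n) x) = (g ^^ n) (f x)" for x
    by (induction n) (auto simp: assms)
  show ?thesis by (induction m) (auto simp: *)
qed

lemma clin_funpow:
  fixes T :: "('i \<Rightarrow> complex) \<Rightarrow> 'i \<Rightarrow> complex"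
  shows "clin T \<Longrightarrow> clin (T ^^ n)"
proof (induction n)
  case 0
  then show ?case by (simp add: clin_def)
next
  case (Suc n)
  then show ?case using clin_compose[of T "T ^^ n"] by (simp add: comp_def)
qed

text \<open>At each \<open>x\<close> the orbit of \<open>g\<close> is a double sequence on which the
  isometries act as backward shifts, so \<open>bipoly_shift_bound\<close> applies. All members of an
  orbit have the same norm; hence N^2 |P|^2 <= B^2 (N + d)^2 |g|^2, and division by N^2 removes the
  boundary effect in the limit.\<close>

lemma bipoly_commuting_isometries:
  fixes T1 T2 :: "('x \<Rightarrow> complex) \<Rightarrow> 'x \<Rightarrow> complex"
  assumes B: "\<And>s t. cmod s = 1 \<Longrightarrow> cmod t = 1 \<Longrightarrow> cmod (bipoly cf d s t) \<le> B"
    and lin: "clin T1" "clin T2" and comm: "\<And>g. T1 (T2 g) = T2 (T1 g)"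
    and iso: "\<And>g. nsq X (T1 g) = nsq X g" "\<And>g. nsq X (T2 g) = nsq X g"
  shows "nsq X (\<lambda>x. \<Sum>q\<in>{..<d} \<times> {..<d}. cf q * (T1 ^^ fst q) ((T2 ^^ snd q) g) x) \<le> B\<^sup>2 * nsq X g"
proof -
  define P where "P = (\<lambda>x. \<Sum>q\<in>{..<d} \<times> {..<d}. cf q * (T1 ^^ fst q) ((T2 ^^ snd q) g) x)"
  have isop: "nsq X ((T1 ^^ m) ((T2 ^^ n) g)) = nsq X g" for m n g
  proof -
    have "nsq X ((T2 ^^ n) g) = nsq X g" by (induction n) (auto simp: iso)
    then show ?thesis by (induction m) (auto simp: iso)
  qed
  define v where "v x k = (T1 ^^ fst k) ((T2 ^^ snd k) g) x" for x and k :: "nat \<times> nat"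
  have shift: "(T1 ^^ fst k) ((T2 ^^ snd k) P) x
      = (\<Sum>q\<in>{..<d} \<times> {..<d}. cf q * v x (fst k + fst q, snd k + snd q))" for k x
  proof -
    have lin': "clin (\<lambda>g. (T1 ^^ fst k) ((T2 ^^ snd k) g))"
      by (rule clin_compose [OF clin_funpow [OF lin(1)] clin_funpow [OF lin(2)]])
    have "(T1 ^^ fst k) ((T2 ^^ snd k) P) x = (\<Sum>q\<in>{..<d} \<times> {..<d}.
        cf q * (T1 ^^ fst k) ((T2 ^^ snd k) ((T1 ^^ fst q) ((T2 ^^ snd q) g))) x)"
      unfolding P_def by (subst clin_sum [OF lin']) simp_all
    also have "\<dots> = (\<Sum>q\<in>{..<d} \<times> {..<d}. cf q * v x (fst k + fst q, snd k + snd q))"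
      using funpow_commute[of T1 T2, OF comm] by (simp add: v_def funpow_add)
    finally show ?thesis .
  qed
  have main: "(real N)\<^sup>2 * nsq X P \<le> B\<^sup>2 * (real (N + d))\<^sup>2 * nsq X g" for N
  proof -
    have "(real N)\<^sup>2 * nsq X P = (\<Sum>k\<in>{..<N} \<times> {..<N}. nsq X ((T1 ^^ fst k) ((T2 ^^ snd k) P)))"
      unfolding isop by (simp add: power2_eq_square)
    also have "\<dots> = (\<Sum>x\<in>X. \<Sum>k\<in>{..<N} \<times> {..<N}.
        (cmod (\<Sum>q\<in>{..<d} \<times> {..<d}. cf q * v x (fst k + fst q, snd k + snd q)))\<^sup>2)"
      unfolding nsq_def shift by (rule sum.swap)
    also have "\<dots> \<le> (\<Sum>x\<in>X. B\<^sup>2 * (\<Sum>k\<in>{..<N+d} \<times> {..<N+d}. (cmod (v x k))\<^sup>2))"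
      by (intro sum_mono bipoly_shift_bound B)
    also have "\<dots> = B\<^sup>2 * (\<Sum>k\<in>{..<N+d} \<times> {..<N+d}. nsq X ((T1 ^^ fst k) ((T2 ^^ snd k) g)))"
      unfolding nsq_def sum_distrib_left [symmetric] v_def by (subst sum.swap) simp
    also have "\<dots> = B\<^sup>2 * (real (N + d))\<^sup>2 * nsq X g"
      unfolding isop by (simp add: power2_eq_square)
    finally show ?thesis .
  qed
  have "(\<lambda>N. B\<^sup>2 * (real (N + d) / real N)\<^sup>2 * nsq X g) \<longlonglongrightarrow> B\<^sup>2 * 1\<^sup>2 * nsq X g"
    by (intro tendsto_intros) real_asymp
  moreover have "\<forall>\<^sub>F N in sequentially. nsq X P \<le> B\<^sup>2 * (real (N + d) / real N)\<^sup>2 * nsq X g"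
    using eventually_gt_at_top[of 0]
  proof eventually_elim
    case (elim N)
    then show ?case using main[of N] by (simp add: field_simps power_divide)
  qed
  ultimately have "nsq X P \<le> B\<^sup>2 * 1\<^sup>2 * nsq X g"
    by (intro tendsto_lowerbound) auto
  then show ?thesis by (simp add: P_def)
qed

section \<open>Von Neumann's inequality on finite node sets\<close>

lemma nsq_Times: "nsq (A \<times> B) x = (\<Sum>k\<in>A. nsq B (\<lambda>i. x (k, i)))"
  by (simp add: nsq_def sum.cartesian_product)

lemma cip_bool: "cip (UNIV \<times> J) x y =
    cip J (\<lambda>i. x (True, i)) (\<lambda>i. y (True, i)) + cip J (\<lambda>i. x (False, i)) (\<lambda>i. y (False, i))"
proof -
  have "cip (UNIV \<times> J) x y = (\<Sum>b\<in>UNIV. \<Sum>i\<in>J. cnj (x (b, i)) * y (b, i))"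
    unfolding cip_def by (simp add: sum.cartesian_product)
  then show ?thesis by (simp add: cip_def UNIV_bool)
qed

lemma nsq_bool: "nsq (UNIV \<times> J) x = nsq J (\<lambda>i. x (True, i)) + nsq J (\<lambda>i. x (False, i))"
  by (simp add: nsq_Times UNIV_bool)

text \<open>Wrapping around makes the shift norm preserving on a finite index set. The price is that
  the last index does not see its true successor, so identities for sequences hold only away from
  the end.\<close>

definition cyc :: "nat \<Rightarrow> nat \<Rightarrow> nat" where
  "cyc K k = (if k < K then Suc k mod K else k)"

lemma sum_cyc: "(\<Sum>k<K. f (cyc K k)) = (\<Sum>k<K. f k)"
proof -
  have "inj_on (cyc K) {..<K}"
    by (auto simp: inj_on_def cyc_def mod_Suc split: if_splits)
  moreover have "cyc K ` {..<K} \<subseteq> {..<K}" by (auto simp: cyc_def)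
  ultimately have "bij_betw (cyc K) {..<K} {..<K}"
    by (simp add: bij_betw_def endo_inj_surj)
  then show ?thesis by (rule sum.reindex_bij_betw)
qed

text \<open>A unitary \<open>U\<close> with inverse \<open>U'\<close> acts in the second coordinate of functions on
  \<open>(\<int>/K) \<times> bool \<times> J\<close>. With \<open>P\<close> the projection onto the summand \<open>True\<close> and \<open>C\<close> the cyclic backward shift,
  \<open>dilA = U' (1 - P + C P)\<close> and \<open>dilB = (P + C (1 - P)) U\<close> are commuting unitaries with product \<open>C\<close>
  (the Berger-Coburn-Lebow form of a pair of commuting isometries).\<close>

definition dilA where
  "dilA K U' g = (\<lambda>(k, i). U' (\<lambda>j. if fst j then g (cyc K k, j) else g (k, j)) i)"

definition dilB where
  "dilB K U g = (\<lambda>(k, i). U (\<lambda>j. g (if fst i then k else cyc K k, j)) i)"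

lemma dil_clin:
  assumes "clin U" "clin U'"
  shows "clin (dilA K U')" "clin (dilB K U)"
proof -
  have *: "(\<lambda>j. if fst j then a * x (k', j) + y (k', j) else a * x (k, j) + y (k, j))
     = (\<lambda>j. a * (if fst j then x (k', j) else x (k, j)) + (if fst j then y (k', j) else y (k, j)))"
    for a :: complex and x y and k k' :: nat by (simp add: fun_eq_iff)
  show "clin (dilA K U')"
    unfolding clin_def dilA_def by (auto simp: fun_eq_iff * clinD [OF assms(2)])
  show "clin (dilB K U)"
    unfolding clin_def dilB_def by (auto simp: fun_eq_iff clinD [OF assms(1)])
qed

lemma dil_commute:
  assumes "unitary_pair I U U'"
  shows "dilA K U' (dilB K U g) = dilB K U (dilA K U' g)"
proof -
  note UD = unitary_pairD [OF assms]
  have 1: "dilA K U' (dilB K U g) = (\<lambda>(k, i). g (cyc K k, i))"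
  proof -
    have "(\<lambda>j. if fst j then dilB K U g (cyc K k, j) else dilB K U g (k, j))
      = U (\<lambda>j. g (cyc K k, j))" for k
      by (auto simp: dilB_def fun_eq_iff)
    then show ?thesis by (simp add: dilA_def UD(4))
  qed
  have 2: "dilB K U (dilA K U' g) = (\<lambda>(k, i). g (cyc K k, i))"
    unfolding dilB_def dilA_def by (auto simp: UD(3) fun_eq_iff)
  show ?thesis unfolding 1 2 ..
qed

text \<open>Either operator shifts one of the two summands cyclically and leaves the other in place,
  so sums over the cycle do not change.\<close>

lemma dil_isometric:
  fixes U U' :: "(bool \<times> 'j \<Rightarrow> complex) \<Rightarrow> bool \<times> 'j \<Rightarrow> complex"
  assumes "unitary_pair (UNIV \<times> J) U U'"
  shows "nsq ({..<K} \<times> UNIV \<times> J) (dilA K U' g) = nsq ({..<K} \<times> UNIV \<times> J) g"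
    and "nsq ({..<K} \<times> UNIV \<times> J) (dilB K U g) = nsq ({..<K} \<times> UNIV \<times> J) g"
proof -
  note UD = unitary_pairD [OF assms]
  have "nsq ({..<K} \<times> UNIV \<times> J) (dilA K U' g) = (\<Sum>k<K. nsq (UNIV \<times> J)
      (U' (\<lambda>j. if fst j then g (cyc K k, j) else g (k, j))))"
    by (simp add: nsq_Times [of "{..<K}"] dilA_def)
  also have "\<dots> = (\<Sum>k<K. nsq (UNIV \<times> J) (\<lambda>j. if fst j then g (cyc K k, j) else g (k, j)))"
    unfolding UD(8) ..
  also have "\<dots> = (\<Sum>k<K. nsq J (\<lambda>i. g (cyc K k, (True, i))))
      + (\<Sum>k<K. nsq J (\<lambda>i. g (k, (False, i))))"
    by (simp add: nsq_bool sum.distrib)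
  also have "\<dots> = nsq ({..<K} \<times> UNIV \<times> J) g"
    by (subst sum_cyc [of "\<lambda>k. nsq J (\<lambda>i. g (k, (True, i)))"])
      (simp add: nsq_Times [of "{..<K}"] nsq_bool sum.distrib)
  finally show "nsq ({..<K} \<times> UNIV \<times> J) (dilA K U' g) = nsq ({..<K} \<times> UNIV \<times> J) g" .
  have "nsq ({..<K} \<times> UNIV \<times> J) (dilB K U g)
    = (\<Sum>k<K. nsq J (\<lambda>i. U (\<lambda>j. g (k, j)) (True, i)))
      + (\<Sum>k<K. nsq J (\<lambda>i. U (\<lambda>j. g (cyc K k, j)) (False, i)))"
    by (simp add: nsq_Times [of "{..<K}"] nsq_bool dilB_def sum.distrib)
  also have "\<dots> = (\<Sum>k<K. nsq (UNIV \<times> J) (U (\<lambda>j. g (k, j))))"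
    by (subst sum_cyc [of "\<lambda>k. nsq J (\<lambda>i. U (\<lambda>j. g (k, j)) (False, i))"])
      (simp add: nsq_bool sum.distrib)
  also have "\<dots> = nsq ({..<K} \<times> UNIV \<times> J) g"
    unfolding UD(7) by (simp add: nsq_Times [of "{..<K}"])
  finally show "nsq ({..<K} \<times> UNIV \<times> J) (dilB K U g) = nsq ({..<K} \<times> UNIV \<times> J) g" .
qed

text \<open>Ando's inequality in disguise: on the space with Gram matrix \<open>L\<close> the
  hypotheses say that the commuting diagonal operators with entries \<open>s j\<close> and
  \<open>t j\<close> are contractions. The conclusion is tested only against the all-ones vector,
  which is what \<open>kernel_cone_duality\<close> asks for.\<close>

lemma von_neumann_kernel:
  fixes s t :: "'j \<Rightarrow> complex"
  assumes J: "finite J" and st: "\<And>j. j \<in> J \<Longrightarrow> cmod (s j) < 1" "\<And>j. j \<in> J \<Longrightarrow> cmod (t j) < 1"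
    and Ls: "psd J (\<lambda>i j. (1 - cnj (s i) * s j) * L i j)"
    and Lt: "psd J (\<lambda>i j. (1 - cnj (t i) * t j) * L i j)"
    and B: "\<And>s t. cmod s = 1 \<Longrightarrow> cmod t = 1 \<Longrightarrow> cmod (bipoly cf d s t) \<le> B"
  shows "0 \<le> Re (\<Sum>i\<in>J. \<Sum>j\<in>J.
    (of_real (B\<^sup>2) - cnj (bipoly cf d (s i) (t i)) * bipoly cf d (s j) (t j)) * L i j)"
proof -
  define I where "I = (UNIV :: bool set) \<times> J"
  have finI: "finite I" using J by (simp add: I_def)
  obtain a where a0: "\<And>j i. i \<notin> J \<Longrightarrow> a j i = 0"
    and a: "\<And>i j. i \<in> J \<Longrightarrow> j \<in> J \<Longrightarrow> (1 - cnj (s i) * s j) * L i j = cip J (a i) (a j)"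
    using psd_gram [OF J Ls] by blast
  obtain b where b0: "\<And>j i. i \<notin> J \<Longrightarrow> b j i = 0"
    and b: "\<And>i j. i \<in> J \<Longrightarrow> j \<in> J \<Longrightarrow> (1 - cnj (t i) * t j) * L i j = cip J (b i) (b j)"
    using psd_gram [OF J Lt] by blast
  \<comment> \<open>\<open>e\<close> and \<open>e'\<close> have the same Gram matrix because 1 - |s
    t|^2 splits as (1 - |s|^2) + |s|^2 (1 - |t|^2) and also with \<open>s\<close> and
    \<open>t\<close> exchanged.\<close>
  define e where "e j = (\<lambda>(c, i). if c then a j i else s j * b j i)" for j
  define e' where "e' j = (\<lambda>(c, i). if c then t j * a j i else b j i)" for j
  define z where "z j = s j * t j" for j
  have ee: "cip I (e i) (e j) = (1 - cnj (z i) * z j) * L i j" if "i \<in> J" "j \<in> J" for i j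
    by (simp add: I_def cip_bool e_def cip_scale_left cip_scale_right z_def
        flip: a [OF that] b [OF that]) (simp add: algebra_simps)
  have ee': "cip I (e' i) (e' j) = (1 - cnj (z i) * z j) * L i j" if "i \<in> J" "j \<in> J" for i j
    by (simp add: I_def cip_bool e'_def cip_scale_left cip_scale_right z_def
        flip: a [OF that] b [OF that]) (simp add: algebra_simps)
  have "\<exists>U U'. unitary_pair I U U' \<and> (\<forall>j\<in>J. U (e j) = e' j)"
  proof (rule unitary_extension [OF J _ _ finI])
    show "e j i = 0" "e' j i = 0" if "i \<notin> I" for j i
      using that a0 b0 by (auto simp: e_def e'_def I_def split_beta mem_Times_iff)
    show "cip I (e j) (e k) = cip I (e' j) (e' k)" if "j \<in> J" "k \<in> J" for j k
      unfolding ee [OF that] ee' [OF that] ..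
  qed
  then obtain U U' where U: "unitary_pair I U U'" and Ue: "\<And>j. j \<in> J \<Longrightarrow> U (e j) = e' j" by blast
  note UD = unitary_pairD [OF U]
  have Ue': "U' (e' j) = e j" if "j \<in> J" for j using UD(4) Ue that by metis
  \<comment> \<open>On the first \<open>r\<close> places \<open>g\<close> is a combination of the
    sequences \<open>z j ^ k * e j\<close>. There \<open>dilA\<close> multiplies the coefficient of
    index \<open>j\<close> by \<open>s j\<close>, and \<open>dilB\<close> by \<open>t j\<close>.
    Each application costs one place, since place \<open>k\<close> looks at place
    \<open>k + 1\<close>.\<close>
  define fam where "fam \<gamma> r g \<longleftrightarrow> (\<forall>k<r. \<forall>i. g (k, i) = (\<Sum>j\<in>J. \<gamma> j * z j ^ k * e j i))"
    for \<gamma> r and g :: "nat \<times> bool \<times> 'j \<Rightarrow> complex"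
  have famA: "fam (\<lambda>j. \<gamma> j * s j) (r - 1) (dilA K U' g)" if "fam \<gamma> r g" "r \<le> K" for \<gamma> r K g
    unfolding fam_def
  proof (intro allI impI)
    fix k and i :: "bool \<times> 'j" assume k: "k < r - 1"
    have "(\<lambda>j. if fst j then g (cyc K k, j) else g (k, j))
      = (\<lambda>j. \<Sum>n\<in>J. (\<gamma> n * s n * z n ^ k) * e' n j)"
    proof
      fix j :: "bool \<times> 'j"
      have g: "g (k', i) = (\<Sum>j\<in>J. \<gamma> j * z j ^ k' * e j i)" if "k' < r" for k' i
        using \<open>fam \<gamma> r g\<close> that unfolding fam_def by blast
      obtain c i where ci: "j = (c, i)" by (cases j)
      have "cyc K k = Suc k" using k that by (simp add: cyc_def)
      then show "(if fst j then g (cyc K k, j) else g (k, j)) = (\<Sum>n\<in>J. (\<gamma> n * s n * z n ^ k) * e' n j)"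
        using k by (simp add: ci g e_def e'_def z_def ac_simps)
    qed
    then have "dilA K U' g (k, i) = (\<Sum>n\<in>J. (\<gamma> n * s n * z n ^ k) * U' (e' n) i)"
      by (simp add: dilA_def clin_sum [OF UD(2) J])
    then show "dilA K U' g (k, i) = (\<Sum>j\<in>J. \<gamma> j * s j * z j ^ k * e j i)"
      by (simp add: Ue')
  qed
  have famB: "fam (\<lambda>j. \<gamma> j * t j) (r - 1) (dilB K U g)" if "fam \<gamma> r g" "r \<le> K" for \<gamma> r K g
    unfolding fam_def
  proof (intro allI impI)
    fix k and i :: "bool \<times> 'j" assume k: "k < r - 1"
    have Ug: "U (\<lambda>j. g (k', j)) i = (\<Sum>n\<in>J. (\<gamma> n * z n ^ k') * e' n i)" if k': "k' < r" for k' i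
    proof -
      have "(\<lambda>j. g (k', j)) = (\<lambda>j. \<Sum>n\<in>J. (\<gamma> n * z n ^ k') * e n j)"
        using k' \<open>fam \<gamma> r g\<close> unfolding fam_def by blast
      then show ?thesis by (simp add: clin_sum [OF UD(1) J] Ue)
    qed
    have "cyc K k = Suc k" using k that by (simp add: cyc_def)
    moreover obtain c n where ci: "i = (c, n)" by (cases i)
    ultimately show "dilB K U g (k, i) = (\<Sum>j\<in>J. \<gamma> j * t j * z j ^ k * e j i)"
      using k by (simp add: ci dilB_def Ug e_def e'_def z_def ac_simps)
  qed
  have famAn: "fam (\<lambda>j. \<gamma> j * s j ^ m) (r - m) ((dilA K U' ^^ m) g)" if "fam \<gamma> r g" "r \<le> K" for \<gamma> r K g m
  proof (induction m)
    case 0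
    then show ?case using that by simp
  next
    case (Suc m)
    then show ?case using famA [OF Suc] that by (simp add: ac_simps)
  qed
  have famBn: "fam (\<lambda>j. \<gamma> j * t j ^ m) (r - m) ((dilB K U ^^ m) g)" if "fam \<gamma> r g" "r \<le> K" for \<gamma> r K g m
  proof (induction m)
    case 0
    then show ?case using that by simp
  next
    case (Suc m)
    then show ?case using famB [OF Suc] that by (simp add: ac_simps)
  qed
  define p where "p j = bipoly cf d (s j) (t j)" for j
  \<comment> \<open>By \<open>f_eq\<close> this is the energy of the first \<open>n\<close> places.
    As |z j| < 1, it tends to the form of \<open>L\<close>.\<close>
  define f where "f c n = Re (\<Sum>i\<in>J. \<Sum>j\<in>J. cnj (c i) * c j * (1 - (cnj (z i) * z j) ^ n) * L i j)"
    for c :: "'j \<Rightarrow> complex" and n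
  have f_eq: "f c n = (\<Sum>k<n. nsq I (\<lambda>i. \<Sum>j\<in>J. (c j * z j ^ k) * e j i))" for c n
  proof -
    have "complex_of_real (\<Sum>k<n. nsq I (\<lambda>i. \<Sum>j\<in>J. (c j * z j ^ k) * e j i))
      = (\<Sum>k<n. \<Sum>i\<in>J. \<Sum>j\<in>J. cnj (c i) * c j * L i j * ((1 - cnj (z i) * z j) * (cnj (z i) * z j) ^ k))"
      unfolding of_real_sum nsq_sum by (intro sum.cong refl) (simp add: ee power_mult_distrib)
    also have "\<dots> = (\<Sum>i\<in>J. \<Sum>j\<in>J. cnj (c i) * c j * L i j * ((1 - cnj (z i) * z j) * (\<Sum>k<n. (cnj (z i) * z j) ^ k)))"
      unfolding sum_distrib_left by (subst sum.swap, rule sum.cong [OF refl], subst sum.swap) simp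
    also have "\<dots> = (\<Sum>i\<in>J. \<Sum>j\<in>J. cnj (c i) * c j * (1 - (cnj (z i) * z j) ^ n) * L i j)"
      unfolding one_diff_power_eq [symmetric] by (simp add: ac_simps)
    finally show ?thesis unfolding f_def by (metis Re_complex_of_real)
  qed
  have ineq: "f p n \<le> B\<^sup>2 * f (\<lambda>_. 1) (n + 2 * d)" for n
  proof -
    \<comment> \<open>Each term applies either operator fewer than \<open>d\<close> times, so the
      first \<open>n\<close> places stay correct.\<close>
    define K where "K = n + 2 * d"
    define X where "X = {..<K} \<times> I"
    define v where "v = (\<lambda>(k, i). \<Sum>j\<in>J. z j ^ k * e j i)"
    define w where "w = (\<lambda>x. \<Sum>q\<in>{..<d} \<times> {..<d}.
        cf q * (dilA K U' ^^ fst q) ((dilB K U ^^ snd q) v) x)"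
    have v: "fam (\<lambda>_. 1) K v" by (simp add: fam_def v_def)
    have w: "w (k, i) = (\<Sum>j\<in>J. (p j * z j ^ k) * e j i)" if "k < n" for k i
    proof -
      have "(dilA K U' ^^ fst q) ((dilB K U ^^ snd q) v) (k, i)
        = (\<Sum>j\<in>J. s j ^ fst q * t j ^ snd q * z j ^ k * e j i)" if "q \<in> {..<d} \<times> {..<d}" for q
      proof -
        have "fam (\<lambda>j. 1 * t j ^ snd q * s j ^ fst q) (K - snd q - fst q)
            ((dilA K U' ^^ fst q) ((dilB K U ^^ snd q) v))"
          by (intro famAn famBn v) auto
        moreover have "k < K - snd q - fst q"
          using that \<open>k < n\<close> by (auto simp: K_def)
        ultimately have "(dilA K U' ^^ fst q) ((dilB K U ^^ snd q) v) (k, i)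
          = (\<Sum>j\<in>J. (1 * t j ^ snd q * s j ^ fst q) * z j ^ k * e j i)"
          unfolding fam_def by blast
        then show ?thesis by (simp add: ac_simps)
      qed
      then have "w (k, i) = (\<Sum>q\<in>{..<d} \<times> {..<d}. cf q * (\<Sum>j\<in>J. s j ^ fst q * t j ^ snd q * z j ^ k * e j i))"
        unfolding w_def by (intro sum.cong) auto
      also have "\<dots> = (\<Sum>j\<in>J. (p j * z j ^ k) * e j i)"
        unfolding p_def bipoly_def sum_distrib_left sum_distrib_right
        by (subst sum.swap) (simp add: ac_simps)
      finally show ?thesis .
    qed
    have "f p n = (\<Sum>k<n. nsq I (\<lambda>i. w (k, i)))"
      unfolding f_eq by (simp add: w)
    also have "\<dots> \<le> (\<Sum>k<K. nsq I (\<lambda>i. w (k, i)))"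
      by (intro sum_mono2) (auto simp: K_def)
    also have "\<dots> = nsq X w" by (simp add: X_def nsq_Times)
    also have "\<dots> \<le> B\<^sup>2 * nsq X v"
      unfolding w_def X_def I_def
      by (rule bipoly_commuting_isometries [OF B dil_clin [OF UD(1,2)]
            dil_commute [OF U] dil_isometric [OF U [unfolded I_def]]])
    also have "nsq X v = f (\<lambda>_. 1) K"
      unfolding f_eq X_def nsq_Times by (simp add: v_def)
    finally show ?thesis by (simp add: K_def)
  qed
  have zlim: "(\<lambda>n. (cnj (z i) * z j) ^ n) \<longlonglongrightarrow> 0" if ij: "i \<in> J" "j \<in> J" for i j
  proof -
    have "cmod (cnj (z i) * z j) < 1"
    proof -
      have "cmod (z k) < 1" if "k \<in> J" for k
        using st that mult_strict_mono[of "cmod (s k)" 1 "cmod (t k)" 1]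
        by (simp add: z_def norm_mult)
      then show ?thesis
        using ij mult_strict_mono[of "cmod (z i)" 1 "cmod (z j)" 1] by (simp add: norm_mult)
    qed
    then show ?thesis by (rule LIMSEQ_power_zero)
  qed
  have lim: "f c \<longlonglongrightarrow> Re (\<Sum>i\<in>J. \<Sum>j\<in>J. cnj (c i) * c j * (1 - 0) * L i j)" for c
    unfolding f_def
    by (intro tendsto_Re tendsto_sum tendsto_mult tendsto_diff tendsto_const zlim)
  have "Re (\<Sum>i\<in>J. \<Sum>j\<in>J. cnj (p i) * p j * (1 - 0) * L i j)
      \<le> B\<^sup>2 * Re (\<Sum>i\<in>J. \<Sum>j\<in>J. cnj 1 * 1 * (1 - 0) * L i j)"
  proof (rule LIMSEQ_le [OF lim])
    show "(\<lambda>n. B\<^sup>2 * f (\<lambda>_. 1) (n + 2 * d)) \<longlonglongrightarrow>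
        B\<^sup>2 * Re (\<Sum>i\<in>J. \<Sum>j\<in>J. cnj 1 * 1 * (1 - 0) * L i j)"
      by (intro tendsto_intros LIMSEQ_ignore_initial_segment lim)
    show "\<exists>N. \<forall>n\<ge>N. f p n \<le> B\<^sup>2 * f (\<lambda>_. 1) (n + 2 * d)" using ineq by blast
  qed
  also have "\<dots> = Re (\<Sum>i\<in>J. \<Sum>j\<in>J. of_real (B\<^sup>2) * L i j)"
    by (simp add: sum_distrib_left del: of_real_power)
  finally show ?thesis
    unfolding p_def [symmetric]
    by (simp add: left_diff_distrib sum_subtractf del: of_real_power)
qed

section \<open>Polynomial approximation on the bidisc\<close>

definition tcoef :: "(complex \<Rightarrow> complex) \<Rightarrow> nat \<Rightarrow> complex" where
  "tcoef g k = (deriv ^^ k) g 0 / fact k"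

lemma tcoef_sums:
  "g holomorphic_on ball 0 1 \<Longrightarrow> cmod z < 1 \<Longrightarrow> (\<lambda>k. tcoef g k * z ^ k) sums g z"
  using holomorphic_power_series[of g 0 1 z] by (simp add: tcoef_def)

lemma tcoef_bound:
  assumes g: "g holomorphic_on ball 0 1" and B: "\<And>z. cmod z < 1 \<Longrightarrow> cmod (g z) \<le> 1"
  shows "cmod (tcoef g k) \<le> 1"
proof -
  have *: "cmod (tcoef g k) * r ^ k \<le> 1" if r: "0 < r" "r < 1" for r
  proof -
    have "cmod ((deriv ^^ k) g 0) \<le> fact k * 1 / r ^ k"
    proof (rule Cauchy_inequality)
      show "g holomorphic_on ball 0 r" using g r by (auto elim: holomorphic_on_subset)
      show "continuous_on (cball 0 r) g"
        using g r by (intro holomorphic_on_imp_continuous_on) (auto elim: holomorphic_on_subset)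
      show "cmod (g x) \<le> 1" if "cmod (0 - x) = r" for x using B[of x] that r by simp
    qed (use r in auto)
    then show ?thesis using r by (simp add: tcoef_def norm_divide field_simps)
  qed
  have "((\<lambda>r. cmod (tcoef g k) * r ^ k) \<longlongrightarrow> cmod (tcoef g k) * 1 ^ k) (at_left 1)"
    by (intro tendsto_intros)
  moreover have "\<forall>\<^sub>F r in at_left 1. cmod (tcoef g k) * r ^ k \<le> 1"
    using eventually_at_left_real [OF zero_less_one] by eventually_elim (simp add: *)
  ultimately have "cmod (tcoef g k) * 1 ^ k \<le> 1"
    by (rule tendsto_upperbound) simp
  then show ?thesis by simp
qed

lemma tcoef_tail:
  assumes g: "g holomorphic_on ball 0 1" and B: "\<And>z. cmod z < 1 \<Longrightarrow> cmod (g z) \<le> 1"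
    and z: "cmod z \<le> r" "r < 1"
  shows "cmod (g z - (\<Sum>k<M. tcoef g k * z ^ k)) \<le> r ^ M / (1 - r)"
proof -
  have r: "0 \<le> r" using z(1) norm_ge_zero[of z] by linarith
  have S: "(\<lambda>k. tcoef g k * z ^ k) sums g z"
    by (rule tcoef_sums [OF g]) (use z in simp)
  then have T: "(\<lambda>k. tcoef g (k + M) * z ^ (k + M)) sums (g z - (\<Sum>k<M. tcoef g k * z ^ k))"
    using sums_iff_shift'[of "\<lambda>k. tcoef g k * z ^ k" M "g z"] by simp
  have G: "(\<lambda>k. r ^ M * r ^ k) sums (r ^ M * (1 / (1 - r)))"
    using r z(2) by (intro sums_mult geometric_sums) simp
  have le: "cmod (tcoef g (k + M) * z ^ (k + M)) \<le> r ^ M * r ^ k" for k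
  proof -
    have "cmod (tcoef g (k + M) * z ^ (k + M)) \<le> 1 * r ^ (k + M)"
      unfolding norm_mult norm_power using z by (intro mult_mono tcoef_bound g B power_mono) auto
    then show ?thesis by (simp add: power_add mult.commute)
  qed
  have "cmod (g z - (\<Sum>k<M. tcoef g k * z ^ k)) \<le> r ^ M * (1 / (1 - r))"
    by (rule norm_sums_le [OF T G le])
  then show ?thesis by simp
qed

text \<open>Separate holomorphy with joint continuity, so that one-variable theory suffices. Values
  outside the open bidisc are unconstrained.\<close>

definition schur_bidisc :: "(complex \<Rightarrow> complex \<Rightarrow> complex) \<Rightarrow> bool" where
  "schur_bidisc \<phi> \<longleftrightarrow> (\<forall>t. cmod t < 1 \<longrightarrow> (\<lambda>s. \<phi> s t) holomorphic_on ball 0 1) \<and>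
     (\<forall>s. cmod s < 1 \<longrightarrow> \<phi> s holomorphic_on ball 0 1) \<and>
     (\<forall>s t. cmod s < 1 \<longrightarrow> cmod t < 1 \<longrightarrow> cmod (\<phi> s t) \<le> 1) \<and>
     continuous_on (ball 0 1 \<times> ball 0 1) (\<lambda>(s, t). \<phi> s t)"

lemma schur_bidiscD:
  assumes "schur_bidisc \<phi>"
  shows "cmod t < 1 \<Longrightarrow> (\<lambda>s. \<phi> s t) holomorphic_on ball 0 1"
    and "cmod s < 1 \<Longrightarrow> \<phi> s holomorphic_on ball 0 1"
    and "cmod s < 1 \<Longrightarrow> cmod t < 1 \<Longrightarrow> cmod (\<phi> s t) \<le> 1"
    and "continuous_on (ball 0 1 \<times> ball 0 1) (\<lambda>(s, t). \<phi> s t)"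
  using assms by (simp_all add: schur_bidisc_def)

text \<open>After the lower coefficients, holomorphic by induction, are removed and the rest is
  divided by s^m, the value at a small real \<open>s\<close> differs from the coefficient by an
  error that is uniform in \<open>t\<close>, because |\<phi>| <= 1. So the coefficient is a uniform
  limit of holomorphic functions.\<close>

lemma tcoef_holomorphic:
  fixes \<phi> :: "complex \<Rightarrow> complex \<Rightarrow> complex"
  assumes \<phi>: "schur_bidisc \<phi>"
  shows "(\<lambda>t. tcoef (\<lambda>s. \<phi> s t) m) holomorphic_on ball 0 1"
proof (induction m rule: less_induct)
  case (less m)
  note hol1 = schur_bidiscD(1) [OF \<phi>] and hol2 = schur_bidiscD(2) [OF \<phi>] and B = schur_bidiscD(3) [OF \<phi>]
  define \<sigma> where "\<sigma> n = inverse (of_nat (n + 2) :: real)" for n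
  have \<sigma>: "0 < \<sigma> n" "\<sigma> n < 1" for n by (auto simp: \<sigma>_def field_simps)
  define q where "q n t = (\<phi> (of_real (\<sigma> n)) t - (\<Sum>k<m. tcoef (\<lambda>s. \<phi> s t) k * of_real (\<sigma> n) ^ k)) / of_real (\<sigma> n) ^ m"
    for n t
  have q: "q n holomorphic_on ball 0 1" for n
    unfolding q_def using \<sigma>[of n] by (intro holomorphic_intros hol2 less) auto
  have est: "cmod (q n t - tcoef (\<lambda>s. \<phi> s t) m) \<le> \<sigma> n / (1 - \<sigma> n)" if t: "cmod t < 1" for n t
  proof -
    define E where "E = \<phi> (of_real (\<sigma> n)) t - (\<Sum>k<Suc m. tcoef (\<lambda>s. \<phi> s t) k * of_real (\<sigma> n) ^ k)"
    have E: "cmod E \<le> \<sigma> n ^ Suc m / (1 - \<sigma> n)"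
      unfolding E_def using \<sigma>[of n] t by (intro tcoef_tail hol1) (auto intro: B)
    have "q n t - tcoef (\<lambda>s. \<phi> s t) m = E / of_real (\<sigma> n) ^ m"
      using \<sigma>(1)[of n] by (simp add: q_def E_def field_simps)
    then have "cmod (q n t - tcoef (\<lambda>s. \<phi> s t) m) = cmod E / \<sigma> n ^ m"
      using \<sigma>(1)[of n] by (simp add: norm_divide norm_power)
    also have "\<dots> \<le> (\<sigma> n ^ Suc m / (1 - \<sigma> n)) / \<sigma> n ^ m"
      using \<sigma>(1)[of n] by (intro divide_right_mono E) simp
    finally show ?thesis using \<sigma>(1)[of n] by simp
  qed
  have lim: "(\<lambda>n. \<sigma> n / (1 - \<sigma> n)) \<longlonglongrightarrow> 0"
    unfolding \<sigma>_def by real_asymp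
  have unif: "uniform_limit (ball 0 1) q (\<lambda>t. tcoef (\<lambda>s. \<phi> s t) m) sequentially"
  proof (rule uniform_limitI)
    fix e :: real assume "e > 0"
    then have "\<forall>\<^sub>F n in sequentially. \<sigma> n / (1 - \<sigma> n) < e"
      using order_tendstoD(2) [OF lim] by simp
    then show "\<forall>\<^sub>F n in sequentially. \<forall>t\<in>ball 0 1. dist (q n t) (tcoef (\<lambda>s. \<phi> s t) m) < e"
    proof eventually_elim
      case (elim n)
      show ?case
      proof
        fix t :: complex assume "t \<in> ball 0 1"
        then show "dist (q n t) (tcoef (\<lambda>s. \<phi> s t) m) < e"
          using est[of t n] elim by (simp add: dist_norm)
      qed
    qed
  qed
  show ?case
  proof (rule holomorphic_uniform_sequence [OF open_ball q])
    fix x :: complex assume "x \<in> ball 0 1"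
    then obtain d where "d > 0" "cball x d \<subseteq> ball 0 1"
      using open_contains_cball open_ball by metis
    then show "\<exists>d>0. cball x d \<subseteq> ball 0 1 \<and>
        uniform_limit (cball x d) q (\<lambda>t. tcoef (\<lambda>s. \<phi> s t) m) sequentially"
      using uniform_limit_on_subset [OF unif] by blast
  qed
qed

text \<open>Taylor expansion in \<open>s\<close>, then of each coefficient in \<open>t\<close>. All
  coefficient functions are bounded by 1, so shrinking the arguments by \<open>r\<close> makes both
  tails geometric, uniformly on the closed bidisc.\<close>

lemma bipoly_approximation:
  fixes \<phi> :: "complex \<Rightarrow> complex \<Rightarrow> complex"
  assumes \<phi>: "schur_bidisc \<phi>"
    and r: "0 < r" "r < 1" and "\<epsilon> > 0"
  shows "\<exists>cf d. \<forall>s t. cmod s \<le> 1 \<longrightarrow> cmod t \<le> 1 \<longrightarrow>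
    cmod (\<phi> (of_real r * s) (of_real r * t) - bipoly cf d s t) \<le> \<epsilon>"
proof -
  note hol1 = schur_bidiscD(1) [OF \<phi>] and B = schur_bidiscD(3) [OF \<phi>]
  define a where "a m t = tcoef (\<lambda>s. \<phi> s t) m" for m t
  have hola: "a m holomorphic_on ball 0 1" for m
    unfolding a_def by (rule tcoef_holomorphic [OF \<phi>])
  have Ba: "cmod (a m t) \<le> 1" if "cmod t < 1" for m t
    unfolding a_def by (rule tcoef_bound) (use hol1 B that in auto)
  \<comment> \<open>The summands bound the tail in \<open>s\<close> and the accumulated tails in
    \<open>t\<close>.\<close>
  have "(\<lambda>M. r ^ M / (1 - r) + r ^ M / (1 - r) * (1 / (1 - r))) \<longlonglongrightarrow>
      0 / (1 - r) + 0 / (1 - r) * (1 / (1 - r))"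
    using r by (intro tendsto_intros LIMSEQ_power_zero) auto
  then have "\<forall>\<^sub>F M in sequentially. r ^ M / (1 - r) + r ^ M / (1 - r) * (1 / (1 - r)) < \<epsilon>"
    using order_tendstoD(2) \<open>\<epsilon> > 0\<close> by fastforce
  then obtain M where M: "r ^ M / (1 - r) + r ^ M / (1 - r) * (1 / (1 - r)) < \<epsilon>"
    by (auto simp: eventually_sequentially)
  define cf where "cf q = of_real (r ^ fst q * r ^ snd q) * tcoef (a (fst q)) (snd q)" for q
  show ?thesis
  proof (intro exI[of _ cf] exI[of _ M] allI impI)
    fix s t :: complex assume st: "cmod s \<le> 1" "cmod t \<le> 1"
    define s' t' where "s' = of_real r * s" and "t' = of_real r * t"
    have st': "cmod s' \<le> r" "cmod t' \<le> r" using st r by (auto simp: s'_def t'_def norm_mult)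
    have bi: "bipoly cf M s t = (\<Sum>m<M. (\<Sum>n<M. tcoef (a m) n * t' ^ n) * s' ^ m)"
      unfolding bipoly_def cf_def s'_def t'_def sum_distrib_right sum.cartesian_product
      by (intro sum.cong) (auto simp: power_mult_distrib)
    have 1: "cmod (\<phi> s' t' - (\<Sum>m<M. a m t' * s' ^ m)) \<le> r ^ M / (1 - r)"
      unfolding a_def using st' r by (intro tcoef_tail hol1) (auto intro: B)
    have "cmod ((\<Sum>m<M. a m t' * s' ^ m) - bipoly cf M s t)
       = cmod (\<Sum>m<M. (a m t' - (\<Sum>n<M. tcoef (a m) n * t' ^ n)) * s' ^ m)"
      by (simp add: bi sum_subtractf left_diff_distrib)
    also have "\<dots> \<le> (\<Sum>m<M. r ^ M / (1 - r) * r ^ m)"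
    proof (rule order_trans [OF norm_sum sum_mono])
      fix m
      have "cmod (a m t' - (\<Sum>n<M. tcoef (a m) n * t' ^ n)) \<le> r ^ M / (1 - r)"
        using st' r by (intro tcoef_tail hola Ba) auto
      then show "cmod ((a m t' - (\<Sum>n<M. tcoef (a m) n * t' ^ n)) * s' ^ m) \<le> r ^ M / (1 - r) * r ^ m"
        unfolding norm_mult norm_power using st' r by (intro mult_mono power_mono) auto
    qed
    also have "\<dots> = r ^ M / (1 - r) * (\<Sum>m<M. r ^ m)" by (simp add: sum_distrib_left)
    also have "\<dots> \<le> r ^ M / (1 - r) * (1 / (1 - r))"
    proof (rule mult_left_mono)
      show "(\<Sum>m<M. r ^ m) \<le> 1 / (1 - r)"
        using r by (simp add: sum_gp_strict field_simps)
    qed (use r in auto)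
    finally have "cmod ((\<Sum>m<M. a m t' * s' ^ m) - bipoly cf M s t) \<le> r ^ M / (1 - r) * (1 / (1 - r))" .
    then have "cmod (\<phi> s' t' - bipoly cf M s t) \<le> \<epsilon>"
      using 1 M norm_triangle_ineq[of "\<phi> s' t' - (\<Sum>m<M. a m t' * s' ^ m)"
          "(\<Sum>m<M. a m t' * s' ^ m) - bipoly cf M s t"] by simp
    then show "cmod (\<phi> (of_real r * s) (of_real r * t) - bipoly cf M s t) \<le> \<epsilon>"
      by (simp add: s'_def t'_def)
  qed
qed

text \<open>The polynomial case is applied to approximants of \<phi> shrunk by \<open>r n\<close>,
  which are bounded by \<open>1 + \<epsilon> n\<close> on the torus. Only the finitely many values
  at nodes have to converge.\<close>

lemma von_neumann_kernel_holomorphic: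
  fixes s t :: "'j \<Rightarrow> complex" and \<phi> :: "complex \<Rightarrow> complex \<Rightarrow> complex"
  assumes J: "finite J" and st: "\<And>j. j \<in> J \<Longrightarrow> cmod (s j) < 1" "\<And>j. j \<in> J \<Longrightarrow> cmod (t j) < 1"
    and Ls: "psd J (\<lambda>i j. (1 - cnj (s i) * s j) * L i j)"
    and Lt: "psd J (\<lambda>i j. (1 - cnj (t i) * t j) * L i j)"
    and \<phi>: "schur_bidisc \<phi>"
  shows "0 \<le> Re (\<Sum>i\<in>J. \<Sum>j\<in>J. (1 - cnj (\<phi> (s i) (t i)) * \<phi> (s j) (t j)) * L i j)"
proof -
  note B = schur_bidiscD(3) [OF \<phi>] and cont = schur_bidiscD(4) [OF \<phi>]
  define r where "r n = 1 - inverse (real (n + 2))" for n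
  define \<epsilon> where "\<epsilon> n = inverse (real (n + 1))" for n
  have r: "0 < r n" "r n < 1" for n by (auto simp: r_def field_simps)
  have \<epsilon>: "0 < \<epsilon> n" for n by (auto simp: \<epsilon>_def)
  have "\<forall>n. \<exists>cf d. \<forall>s t. cmod s \<le> 1 \<longrightarrow> cmod t \<le> 1 \<longrightarrow>
    cmod (\<phi> (of_real (r n) * s) (of_real (r n) * t) - bipoly cf d s t) \<le> \<epsilon> n"
    using bipoly_approximation [OF \<phi> r \<epsilon>] by blast
  then obtain cf d where ap: "\<And>n s t. cmod s \<le> 1 \<Longrightarrow> cmod t \<le> 1 \<Longrightarrow>
    cmod (\<phi> (of_real (r n) * s) (of_real (r n) * t) - bipoly (cf n) (d n) s t) \<le> \<epsilon> n"
    by metis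
  have in1: "cmod (of_real (r n) * x) < 1" if "cmod x \<le> 1" for n x
  proof -
    have "cmod (of_real (r n) * x) \<le> r n * 1"
      unfolding norm_mult using r[of n] that by (intro mult_mono) auto
    then show ?thesis using r[of n] by linarith
  qed
  define p where "p n j = bipoly (cf n) (d n) (s j) (t j)" for n j
  have ineq: "0 \<le> Re (\<Sum>i\<in>J. \<Sum>j\<in>J. (of_real ((1 + \<epsilon> n)\<^sup>2) - cnj (p n i) * p n j) * L i j)" for n
    unfolding p_def
  proof (rule von_neumann_kernel [OF J st Ls Lt])
    fix \<sigma> \<tau> :: complex assume *: "cmod \<sigma> = 1" "cmod \<tau> = 1"
    have "cmod (\<phi> (of_real (r n) * \<sigma>) (of_real (r n) * \<tau>)) \<le> 1"
      by (rule B; rule in1) (use * in auto)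
    then show "cmod (bipoly (cf n) (d n) \<sigma> \<tau>) \<le> 1 + \<epsilon> n"
      using ap[of \<sigma> \<tau> n] * norm_triangle_ineq2[of "bipoly (cf n) (d n) \<sigma> \<tau>" "\<phi> (of_real (r n) * \<sigma>) (of_real (r n) * \<tau>)"]
      by (simp add: norm_minus_commute)
  qed auto
  have \<epsilon>0: "\<epsilon> \<longlonglongrightarrow> 0" unfolding \<epsilon>_def by real_asymp
  have r1: "r \<longlonglongrightarrow> 1" unfolding r_def by real_asymp
  have plim: "(\<lambda>n. p n j) \<longlonglongrightarrow> \<phi> (s j) (t j)" if "j \<in> J" for j
  proof -
    have "(\<lambda>n. (\<lambda>(s, t). \<phi> s t) (of_real (r n) * s j, of_real (r n) * t j)) \<longlonglongrightarrow> (\<lambda>(s, t). \<phi> s t) (s j, t j)"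
    proof (rule continuous_on_tendsto_compose [OF cont])
      have "(\<lambda>n. (of_real (r n) * s j, of_real (r n) * t j)) \<longlonglongrightarrow> (of_real 1 * s j, of_real 1 * t j)"
        by (intro tendsto_intros r1)
      then show "(\<lambda>n. (of_real (r n) * s j, of_real (r n) * t j)) \<longlonglongrightarrow> (s j, t j)" by simp
    qed (use st that in1 in \<open>auto intro!: always_eventually less_imp_le\<close>)
    then have 1: "(\<lambda>n. \<phi> (of_real (r n) * s j) (of_real (r n) * t j)) \<longlonglongrightarrow> \<phi> (s j) (t j)" by simp
    have "(\<lambda>n. \<phi> (of_real (r n) * s j) (of_real (r n) * t j) - p n j) \<longlonglongrightarrow> 0"
      by (rule Lim_null_comparison [OF _ \<epsilon>0])
        (use ap st that in \<open>auto simp: p_def less_imp_le intro!: always_eventually\<close>)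
    from tendsto_diff [OF 1 this] show ?thesis by simp
  qed
  have "(\<lambda>n. Re (\<Sum>i\<in>J. \<Sum>j\<in>J. (of_real ((1 + \<epsilon> n)\<^sup>2) - cnj (p n i) * p n j) * L i j))
      \<longlonglongrightarrow> Re (\<Sum>i\<in>J. \<Sum>j\<in>J. (of_real ((1 + 0)\<^sup>2) - cnj (\<phi> (s i) (t i)) * \<phi> (s j) (t j)) * L i j)"
    by (intro tendsto_intros plim \<epsilon>0)
  then have "0 \<le> Re (\<Sum>i\<in>J. \<Sum>j\<in>J. (of_real ((1 + 0)\<^sup>2) - cnj (\<phi> (s i) (t i)) * \<phi> (s j) (t j)) * L i j)"
    by (rule tendsto_lowerbound) (use ineq in auto)
  then show ?thesis by simp
qed

section \<open>Agler decomposition by duality\<close>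

text \<open>Tychonoff's theorem, in the form that serves both the minimization in
  \<open>kernel_cone_duality\<close> and the choice of a subsequence in
  \<open>holo_montel\<close>.\<close>

lemma compact_PiE_UNIV:
  fixes S :: "'a \<Rightarrow> 'b::topological_space set"
  assumes "\<And>i. compact (S i)"
  shows "compact (PiE UNIV S)"
proof -
  have "product_topology (\<lambda>i. euclidean :: 'b topology) (UNIV :: 'a set) = euclidean"
    by (simp add: topology_eq open_fun_def flip: open_openin)
  then show ?thesis
    using assms compactin_PiE[of "\<lambda>i::'a. euclidean :: 'b topology" UNIV S] by simp
qed

lemma psd_cong:
  assumes "psd J K" "\<And>i j. i \<in> J \<Longrightarrow> j \<in> J \<Longrightarrow> K i j = K' i j"
  shows "psd J K'"
  unfolding psd_def
proof (intro conjI ballI allI)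
  fix i j assume "i \<in> J" "j \<in> J"
  then show "K' j i = cnj (K' i j)" using psd_sym [OF assms(1)] assms(2) by metis
next
  fix c
  have "(\<Sum>i\<in>J. \<Sum>j\<in>J. cnj (c i) * c j * K' i j) = (\<Sum>i\<in>J. \<Sum>j\<in>J. cnj (c i) * c j * K i j)"
    using assms(2) by (intro sum.cong) auto
  then show "0 \<le> Re (\<Sum>i\<in>J. \<Sum>j\<in>J. cnj (c i) * c j * K' i j)"
    using psd_nonneg [OF assms(1), of c] by simp
qed

lemma psd_rank_one: "psd J (\<lambda>i j. cnj (d i) * d j)"
  unfolding psd_def
proof (intro conjI allI ballI)
  fix c
  have "(\<Sum>i\<in>J. \<Sum>j\<in>J. cnj (c i) * c j * (cnj (d i) * d j)) = cnj (\<Sum>i\<in>J. c i * d i) * (\<Sum>i\<in>J. c i * d i)"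
    unfolding cnj_sum sum_product by (simp add: ac_simps)
  also have "\<dots> = of_real ((cmod (\<Sum>i\<in>J. c i * d i))\<^sup>2)"
    by (simp add: complex_norm_square mult.commute del: of_real_power)
  finally show "0 \<le> Re (\<Sum>i\<in>J. \<Sum>j\<in>J. cnj (c i) * c j * (cnj (d i) * d j))"
    by (simp only: Re_complex_of_real) simp
qed simp

lemma psd_add_scale:
  assumes "psd J K" "psd J K'" "0 \<le> a" "0 \<le> b"
  shows "psd J (\<lambda>i j. of_real a * K i j + of_real b * K' i j)"
  unfolding psd_def
proof (intro conjI ballI allI)
  fix i j assume ij: "i \<in> J" "j \<in> J"
  show "of_real a * K j i + of_real b * K' j i = cnj (of_real a * K i j + of_real b * K' i j)"
    unfolding psd_sym [OF assms(1) ij] psd_sym [OF assms(2) ij] by simp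
next
  fix c
  have "(\<Sum>i\<in>J. \<Sum>j\<in>J. cnj (c i) * c j * (of_real a * K i j + of_real b * K' i j))
    = of_real a * (\<Sum>i\<in>J. \<Sum>j\<in>J. cnj (c i) * c j * K i j) + of_real b * (\<Sum>i\<in>J. \<Sum>j\<in>J. cnj (c i) * c j * K' i j)"
    by (simp add: sum_distrib_left sum.distrib algebra_simps)
  then show "0 \<le> Re (\<Sum>i\<in>J. \<Sum>j\<in>J. cnj (c i) * c j * (of_real a * K i j + of_real b * K' i j))"
    using psd_nonneg [OF assms(1), of c] psd_nonneg [OF assms(2), of c] assms(3,4) by simp
qed

text \<open>The one-sided first variation at a minimum: divide by \<open>e\<close> and let it tend
  to 0.\<close>

lemma first_order_nonneg:
  assumes "\<And>e::real. 0 < e \<Longrightarrow> e \<le> 1 \<Longrightarrow> 0 \<le> 2 * e * a + e\<^sup>2 * b"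
  shows "0 \<le> a"
proof -
  have "((\<lambda>e. 2 * a + e * b) \<longlongrightarrow> 2 * a + 0 * b) (at_right 0)"
    by (intro tendsto_intros)
  moreover have "\<forall>\<^sub>F e in at_right (0::real). 0 \<le> 2 * a + e * b"
    using eventually_at_right_real [OF zero_less_one]
  proof eventually_elim
    case (elim e)
    then have "0 \<le> e * (2 * a + e * b)"
      using assms[of e] by (simp add: algebra_simps power2_eq_square)
    then show ?case using elim by (simp add: zero_le_mult_iff)
  qed
  ultimately have "0 \<le> 2 * a + 0 * b" by (rule tendsto_lowerbound) simp
  then show ?thesis by simp
qed

text \<open>The residual of the best approximation of \<open>R\<close> from the cone of admissible sums, with its sign
  changed, is the functional that would separate \<open>R\<close> from the cone.\<close>

lemma kernel_cone_duality:
  fixes s t :: "'j \<Rightarrow> complex" and R :: "'j \<Rightarrow> 'j \<Rightarrow> complex"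
  assumes J: "finite J" and st: "\<And>j. j \<in> J \<Longrightarrow> cmod (s j) < 1" "\<And>j. j \<in> J \<Longrightarrow> cmod (t j) < 1"
    and R: "\<And>i j. R j i = cnj (R i j)"
    and dual: "\<And>L. psd J (\<lambda>i j. (1 - cnj (s i) * s j) * L i j) \<Longrightarrow>
        psd J (\<lambda>i j. (1 - cnj (t i) * t j) * L i j) \<Longrightarrow> 0 \<le> Re (\<Sum>i\<in>J. \<Sum>j\<in>J. R i j * L i j)"
  shows "\<exists>\<Gamma>1 \<Gamma>2. psd J \<Gamma>1 \<and> psd J \<Gamma>2 \<and> (\<forall>i\<in>J. \<forall>j\<in>J.
    R i j = (1 - cnj (s i) * s j) * \<Gamma>1 i j + (1 - cnj (t i) * t j) * \<Gamma>2 i j)"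
proof -
  \<comment> \<open>The Boolean tag holds the two unknown kernels in one variable
    \<open>x\<close>.\<close>
  define A where "A x i j = (1 - cnj (s i) * s j) * x (True, i, j) + (1 - cnj (t i) * t j) * x (False, i, j)"
    for x :: "bool \<times> 'j \<times> 'j \<Rightarrow> complex" and i j
  define h where "h x = (\<Sum>i\<in>J. \<Sum>j\<in>J. (cmod (R i j - A x i j))\<^sup>2)" for x
  define X :: "(bool \<times> 'j \<times> 'j \<Rightarrow> complex) set" where "X = {x. (\<forall>c. psd J (\<lambda>i j. x (c, i, j))) \<and> (\<forall>c i j. i \<notin> J \<or> j \<notin> J \<longrightarrow> x (c, i, j) = 0)}"
  have psdX: "psd J (\<lambda>i j. x (c, i, j))" if "x \<in> X" for x c using that by (auto simp: X_def)
  have X0: "(\<lambda>_. 0) \<in> X" by (simp add: X_def psd_def)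
  have Xadd: "(\<lambda>k. of_real a * x k + of_real b * y k) \<in> X" if "x \<in> X" "y \<in> X" "0 \<le> a" "0 \<le> b" for x y a b
  proof -
    have "psd J (\<lambda>i j. of_real a * x (c, i, j) + of_real b * y (c, i, j))" for c
      by (rule psd_add_scale) (use that psdX in auto)
    then show ?thesis using that by (auto simp: X_def)
  qed
  \<comment> \<open>On the diagonal both summands of \<open>A x\<close> are nonnegative with
    positive factors 1 - |s|^2 and 1 - |t|^2. So a bound on \<open>A x\<close> bounds the diagonals
    of both kernels, and Cauchy-Schwarz bounds all other entries: the sublevel set of
    \<open>h\<close> lies in a compact box.\<close>
  define w where "w i = 1 / (1 - (cmod (s i))\<^sup>2) + 1 / (1 - (cmod (t i))\<^sup>2)" for i
  define m where "m i = (cmod (R i i) + sqrt (h (\<lambda>_. 0))) * w i" for i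
  define M where "M = (\<Sum>i\<in>J. m i)"
  have st1: "1 - (cmod (s i))\<^sup>2 > 0" "1 - (cmod (t i))\<^sup>2 > 0" if "i \<in> J" for i
    using st[OF that] by (simp_all add: abs_square_less_1)
  have h0: "h x \<ge> 0" for x by (simp add: h_def sum_nonneg)
  have m0: "m i \<ge> 0" if "i \<in> J" for i
    using st1[OF that] h0 by (simp add: m_def w_def)
  have diag: "Re (x (c, i, i)) \<le> M" if x: "x \<in> X" "h x \<le> h (\<lambda>_. 0)" and i: "i \<in> J" for x c i
  proof -
    have p: "x (c, i, i) = of_real (Re (x (c, i, i)))" "0 \<le> Re (x (c, i, i))" for c
      by (rule psd_diag [OF psdX [OF x(1)] J i])+
    have "(cmod (R i i - A x i i))\<^sup>2 \<le> (\<Sum>j\<in>J. (cmod (R i j - A x i j))\<^sup>2)"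
      using J i by (intro member_le_sum) auto
    also have "\<dots> \<le> h x"
      unfolding h_def using J i
      by (intro member_le_sum [of i J "\<lambda>i. \<Sum>j\<in>J. (cmod (R i j - A x i j))\<^sup>2"]) (auto intro: sum_nonneg)
    also have "\<dots> \<le> h (\<lambda>_. 0)" by (rule x(2))
    finally have "cmod (R i i - A x i i) \<le> sqrt (h (\<lambda>_. 0))"
      by (rule real_le_rsqrt)
    then have "cmod (A x i i) \<le> cmod (R i i) + sqrt (h (\<lambda>_. 0))"
      using norm_triangle_ineq2[of "A x i i" "R i i"] by (simp add: norm_minus_commute)
    moreover define a b where "a = (1 - (cmod (s i))\<^sup>2) * Re (x (True, i, i))"
      and "b = (1 - (cmod (t i))\<^sup>2) * Re (x (False, i, i))"
    have ab: "0 \<le> a" "0 \<le> b"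
      using st1[OF i] p(2) by (simp_all add: a_def b_def less_imp_le)
    moreover have "cmod (A x i i) = a + b"
    proof -
      have "A x i i = of_real (a + b)"
        unfolding A_def a_def b_def
        by (subst p(1)[of True], subst p(1)[of False])
          (simp add: complex_norm_square mult.commute del: of_real_power)
      then show ?thesis using ab by (simp del: of_real_add)
    qed
    ultimately have le: "a \<le> cmod (R i i) + sqrt (h (\<lambda>_. 0))" "b \<le> cmod (R i i) + sqrt (h (\<lambda>_. 0))"
      by linarith+
    define v where "v = cmod (R i i) + sqrt (h (\<lambda>_. 0))"
    have v: "v \<ge> 0" using h0 by (simp add: v_def)
    have "Re (x (True, i, i)) \<le> v * (1 / (1 - (cmod (s i))\<^sup>2))" "Re (x (False, i, i)) \<le> v * (1 / (1 - (cmod (t i))\<^sup>2))"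
      using le st1[OF i] by (simp_all add: field_simps v_def a_def b_def)
    moreover have "0 \<le> v * (1 / (1 - (cmod (s i))\<^sup>2))" "0 \<le> v * (1 / (1 - (cmod (t i))\<^sup>2))"
      using v st1[OF i] by simp_all
    ultimately have "Re (x (c, i, i)) \<le> m i"
      unfolding m_def v_def [symmetric] w_def distrib_left by (cases c) auto
    also have "m i \<le> M" unfolding M_def using J i m0 by (intro member_le_sum) auto
    finally show ?thesis .
  qed
  define C where "C = PiE UNIV (\<lambda>k::bool \<times> 'j \<times> 'j. if snd k \<in> J \<times> J then cball (0::complex) M else {0})"
  have M0: "M \<ge> 0" using m0 by (simp add: M_def sum_nonneg)
  have inC: "x \<in> C" if x: "x \<in> X" "h x \<le> h (\<lambda>_. 0)" for x
  proof -
    have "cmod (x (c, i, j)) \<le> M" if ij: "i \<in> J" "j \<in> J" for c i j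
    proof -
      have "(cmod (x (c, i, j)))\<^sup>2 \<le> Re (x (c, i, i)) * Re (x (c, j, j))"
        by (rule psd_cauchy_schwarz [OF psdX [OF x(1)] J ij])
      also have "\<dots> \<le> M * M"
        using diag [OF x] ij M0 psd_diag(2) [OF psdX [OF x(1)] J] by (intro mult_mono) auto
      finally show ?thesis using M0 by (simp add: power2_eq_square abs_le_square_iff [of "cmod _" M, unfolded power2_eq_square, symmetric])
    qed
    then show ?thesis using x(1) by (auto simp: C_def X_def)
  qed
  have "closed X"
    unfolding X_def psd_def Ball_def
    by (intro closed_Collect_conj closed_Collect_all closed_Collect_imp open_Collect_const
        closed_Collect_eq closed_Collect_le continuous_intros continuous_on_product_coordinates)
  moreover have "compact C"
    unfolding C_def by (rule compact_PiE_UNIV) auto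
  ultimately have "compact (C \<inter> X)" by (rule compact_Int_closed [rotated])
  moreover have "C \<inter> X \<noteq> {}" using inC [OF X0] X0 by auto
  moreover have "continuous_on (C \<inter> X) h"
    unfolding h_def A_def
    by (intro continuous_intros continuous_on_subset [OF continuous_on_product_coordinates subset_UNIV])
  ultimately obtain x0 where x0: "x0 \<in> C \<inter> X" and min': "\<And>x. x \<in> C \<inter> X \<Longrightarrow> h x0 \<le> h x"
    using continuous_attains_inf by metis
  have min: "h x0 \<le> h x" if "x \<in> X" for x
  proof (cases "h x \<le> h (\<lambda>_. 0)")
    case True
    then show ?thesis using min' inC that by blast
  next
    case False
    then show ?thesis using min'[of "\<lambda>_. 0"] inC [OF X0] X0 by simp
  qed
  have x0X: "x0 \<in> X" using x0 by simp
  define D where "D i j = R i j - A x0 i j" for i j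
  define ipD where "ipD y = Re (\<Sum>i\<in>J. \<Sum>j\<in>J. cnj (D i j) * y i j)" for y :: "'j \<Rightarrow> 'j \<Rightarrow> complex"
  have expand: "h (\<lambda>k. x0 k + of_real e * y k) = h x0 - 2 * e * ipD (A y)
      + e\<^sup>2 * (\<Sum>i\<in>J. \<Sum>j\<in>J. (cmod (A y i j))\<^sup>2)" for e y
  proof -
    have "(cmod (R i j - A (\<lambda>k. x0 k + of_real e * y k) i j))\<^sup>2
        = (cmod (R i j - A x0 i j))\<^sup>2 - 2 * e * Re (cnj (D i j) * A y i j) + e\<^sup>2 * (cmod (A y i j))\<^sup>2" for i j
    proof -
      have "R i j - A (\<lambda>k. x0 k + of_real e * y k) i j = D i j - of_real e * A y i j"
        by (simp add: D_def A_def algebra_simps)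
      then show ?thesis
        unfolding D_def [symmetric] by (simp add: cmod_power2) (simp add: power2_eq_square algebra_simps)
    qed
    then show ?thesis
      by (simp add: h_def ipD_def sum.distrib sum_subtractf sum_distrib_left distrib_left)
  qed
  have var: "ipD (A y) \<le> 0" if "y \<in> X" for y
  proof -
    have "0 \<le> - ipD (A y)"
    proof (rule first_order_nonneg)
      fix e :: real assume "0 < e" "e \<le> 1"
      then have "(\<lambda>k. of_real 1 * x0 k + of_real e * y k) \<in> X"
        by (intro Xadd x0X that) auto
      from min [OF this] show "0 \<le> 2 * e * - ipD (A y) + e\<^sup>2 * (\<Sum>i\<in>J. \<Sum>j\<in>J. (cmod (A y i j))\<^sup>2)"
        using expand[of e y] by simp
    qed
    then show ?thesis by simp
  qed
  \<comment> \<open>The cone also contains \<open>x0\<close> times \<open>1 - e\<close>, so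
    \<open>x0\<close> may be moved towards 0.\<close>
  have var0: "0 \<le> ipD (A x0)"
  proof (rule first_order_nonneg)
    fix e :: real assume e: "0 < e" "e \<le> 1"
    then have "(\<lambda>k. of_real (1 - e) * x0 k + of_real 0 * x0 k) \<in> X"
      by (intro Xadd x0X) auto
    also have "(\<lambda>k. of_real (1 - e) * x0 k + of_real 0 * x0 k) = (\<lambda>k. x0 k + of_real (- e) * x0 k)"
      by (simp add: algebra_simps)
    finally have "(\<lambda>k. x0 k + of_real (- e) * x0 k) \<in> X" .
    from min [OF this] show "0 \<le> 2 * e * ipD (A x0) + e\<^sup>2 * (\<Sum>i\<in>J. \<Sum>j\<in>J. (cmod (A x0 i j))\<^sup>2)"
      unfolding expand by simp
  qed
  have Dsym: "D j i = cnj (D i j)" if "i \<in> J" "j \<in> J" for i j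
    unfolding D_def A_def
    using R[of j i] psd_sym [OF psdX [OF x0X] that, of True] psd_sym [OF psdX [OF x0X] that, of False]
    by (simp add: mult.commute)
  have "0 \<le> Re (\<Sum>i\<in>J. \<Sum>j\<in>J. R i j * - cnj (D i j))"
  proof (rule dual)
    have gen: "psd J (\<lambda>i j. (1 - cnj (u i) * u j) * - cnj (D i j))"
      if u: "\<And>y i j. A (\<lambda>(c', i, j). if c' = c then y i j else 0) i j = (1 - cnj (u i) * u j) * y i j" for u c
      unfolding psd_def
    proof (intro conjI ballI allI)
      fix i j assume ij: "i \<in> J" "j \<in> J"
      show "(1 - cnj (u j) * u i) * - cnj (D j i) = cnj ((1 - cnj (u i) * u j) * - cnj (D i j))"
        unfolding Dsym [OF ij] by (simp add: mult.commute)
    next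
      fix d
      \<comment> \<open>A rank one kernel in slot \<open>c\<close> as direction turns the first
        variation into positivity of the candidate functional at \<open>d\<close>.\<close>
      define y where "y i j = (if i \<in> J \<and> j \<in> J then cnj (d i) * d j else 0)" for i j
      have "psd J y"
        by (rule psd_cong [OF psd_rank_one[of J d]]) (simp add: y_def)
      moreover have "psd J (\<lambda>i j. 0)" by (simp add: psd_def)
      ultimately have "psd J (\<lambda>i j. if c' = c then y i j else 0)" for c' by (cases "c' = c") simp_all
      then have yX: "(\<lambda>(c', i, j). if c' = c then y i j else 0) \<in> X"
        by (simp add: X_def) (simp add: y_def)
      have "0 \<le> - ipD (\<lambda>i j. (1 - cnj (u i) * u j) * y i j)"
      proof -
        have "A (\<lambda>(c', i, j). if c' = c then y i j else 0) = (\<lambda>i j. (1 - cnj (u i) * u j) * y i j)"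
          by (intro ext u)
        with var [OF yX] show ?thesis by simp
      qed
      also have "\<dots> = Re (\<Sum>i\<in>J. \<Sum>j\<in>J. cnj (d i) * d j * ((1 - cnj (u i) * u j) * - cnj (D i j)))"
        unfolding ipD_def by (simp add: y_def sum_negf [symmetric] mult_ac cong: sum.cong)
      finally show "0 \<le> Re (\<Sum>i\<in>J. \<Sum>j\<in>J. cnj (d i) * d j * ((1 - cnj (u i) * u j) * - cnj (D i j)))" .
    qed
    show "psd J (\<lambda>i j. (1 - cnj (s i) * s j) * - cnj (D i j))" by (rule gen [of True]) (simp add: A_def)
    show "psd J (\<lambda>i j. (1 - cnj (t i) * t j) * - cnj (D i j))" by (rule gen [of False]) (simp add: A_def)
  qed
  also have "\<dots> = - ipD R"
    by (simp add: ipD_def sum_negf mult.commute)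
  finally have "ipD R \<le> 0" by simp
  moreover have "ipD R = ipD D + ipD (A x0)"
  proof -
    have "R i j = D i j + A x0 i j" for i j by (simp add: D_def)
    then have "R = (\<lambda>i j. D i j + A x0 i j)" by (intro ext)
    then have "ipD R = ipD (\<lambda>i j. D i j + A x0 i j)" by (rule arg_cong)
    then show ?thesis by (simp add: ipD_def distrib_left sum.distrib)
  qed
  moreover have "ipD D = h x0"
  proof -
    have "Re (cnj (D i j) * D i j) = (cmod (D i j))\<^sup>2" for i j
      unfolding cmod_power2 by (simp add: power2_eq_square)
    then show ?thesis by (simp add: ipD_def h_def D_def)
  qed
  \<comment> \<open>\<open>h x0\<close> is <D, D> = <D, R> - <D, A x0>, and both terms are at most
    0.\<close>
  ultimately have "h x0 = 0" using var0 h0[of x0] by linarith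
  then have "D i j = 0" if "i \<in> J" "j \<in> J" for i j
    using that J unfolding h_def D_def
    by (simp add: sum_nonneg_eq_0_iff sum_nonneg)
  then have "R i j = A x0 i j" if "i \<in> J" "j \<in> J" for i j
    using that by (simp add: D_def)
  then show ?thesis
    using psdX [OF x0X] unfolding A_def by blast
qed

text \<open>Duality asks only for nonnegative pairing with admissible \<open>L\<close>, which is
  \<open>von_neumann_kernel_holomorphic\<close>. Gram vectors of the two kernels then form the
  model.\<close>

lemma agler_decomposition:
  fixes s t :: "'j \<Rightarrow> complex" and \<phi> :: "complex \<Rightarrow> complex \<Rightarrow> complex"
  assumes J: "finite J" and st: "\<And>j. j \<in> J \<Longrightarrow> cmod (s j) < 1" "\<And>j. j \<in> J \<Longrightarrow> cmod (t j) < 1"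
    and \<phi>: "schur_bidisc \<phi>"
  shows "\<exists>u v. (\<forall>i j. i \<notin> J \<longrightarrow> u j i = 0 \<and> v j i = 0) \<and> (\<forall>i\<in>J. \<forall>j\<in>J.
    1 - cnj (\<phi> (s i) (t i)) * \<phi> (s j) (t j) =
      (1 - cnj (s i) * s j) * cip J (u i) (u j) + (1 - cnj (t i) * t j) * cip J (v i) (v j))"
proof -
  have "\<exists>\<Gamma>1 \<Gamma>2. psd J \<Gamma>1 \<and> psd J \<Gamma>2 \<and> (\<forall>i\<in>J. \<forall>j\<in>J.
    1 - cnj (\<phi> (s i) (t i)) * \<phi> (s j) (t j)
      = (1 - cnj (s i) * s j) * \<Gamma>1 i j + (1 - cnj (t i) * t j) * \<Gamma>2 i j)"
  proof (rule kernel_cone_duality [OF J st])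
    show "0 \<le> Re (\<Sum>i\<in>J. \<Sum>j\<in>J. (1 - cnj (\<phi> (s i) (t i)) * \<phi> (s j) (t j)) * L i j)"
      if "psd J (\<lambda>i j. (1 - cnj (s i) * s j) * L i j)" "psd J (\<lambda>i j. (1 - cnj (t i) * t j) * L i j)" for L
      by (rule von_neumann_kernel_holomorphic [OF J st that \<phi>])
  qed (simp_all add: mult.commute)
  then obtain \<Gamma>1 \<Gamma>2 where \<Gamma>: "psd J \<Gamma>1" "psd J \<Gamma>2"
    and eq: "\<And>i j. i \<in> J \<Longrightarrow> j \<in> J \<Longrightarrow> 1 - cnj (\<phi> (s i) (t i)) * \<phi> (s j) (t j)
      = (1 - cnj (s i) * s j) * \<Gamma>1 i j + (1 - cnj (t i) * t j) * \<Gamma>2 i j" by blast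
  obtain u where u: "\<And>j i. i \<notin> J \<Longrightarrow> u j i = 0" "\<And>i j. i \<in> J \<Longrightarrow> j \<in> J \<Longrightarrow> \<Gamma>1 i j = cip J (u i) (u j)"
    using psd_gram [OF J \<Gamma>(1)] by blast
  obtain v where v: "\<And>j i. i \<notin> J \<Longrightarrow> v j i = 0" "\<And>i j. i \<in> J \<Longrightarrow> j \<in> J \<Longrightarrow> \<Gamma>2 i j = cip J (v i) (v j)"
    using psd_gram [OF J \<Gamma>(2)] by blast
  show ?thesis
    by (intro exI[of _ u] exI[of _ v]) (use u v eq in auto)
qed

section \<open>Realization of even functions\<close>

definition vec1 :: "complex \<Rightarrow> ('i \<Rightarrow> complex) \<Rightarrow> 'i option \<Rightarrow> complex" where
  "vec1 c x = case_option c x"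

lemma vec1_simps [simp]: "vec1 c x None = c" "vec1 c x (Some i) = x i"
  by (simp_all add: vec1_def)

lemma vec1_diff: "(\<lambda>i. vec1 a x i - vec1 b y i) = vec1 (a - b) (\<lambda>i. x i - y i)"
  by (auto simp: vec1_def fun_eq_iff split: option.split)

lemma cip_option:
  "finite H \<Longrightarrow> cip (insert None (Some ` H)) x y = cnj (x None) * y None + cip H (\<lambda>i. x (Some i)) (\<lambda>i. y (Some i))"
  by (simp add: cip_def sum.reindex)

lemma nsq_option:
  "finite H \<Longrightarrow> nsq (insert None (Some ` H)) x = (cmod (x None))\<^sup>2 + nsq H (\<lambda>i. x (Some i))"
  by (simp add: nsq_def sum.reindex)

lemma nsq_zero [simp]: "nsq I (\<lambda>_. 0) = 0"
  by (simp add: nsq_def)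

text \<open>The transfer function \<open>A + B M (1 - D M)\<^sup>-\<^sup>1 C\<close> of a unitary \<open>W = (A B; C D)\<close> at a strict contraction
  \<open>M\<close>, approached through \<open>transfer_state W M n\<close>, the partial sums of the Neumann series of
  \<open>(1 - D M)\<^sup>-\<^sup>1 C\<close>.\<close>

fun transfer_state where
  "transfer_state W M 0 = (\<lambda>_. 0)"
| "transfer_state W M (Suc n) = (\<lambda>h. W (vec1 1 (M (transfer_state W M n))) (Some h))"

definition transfer where
  "transfer W M n = W (vec1 1 (M (transfer_state W M n))) None"

text \<open>These facts depend only on \<open>W\<close> being unitary and \<open>M\<close>
  contracting by the factor \<open>r\<close>; how \<open>M\<close> arises from \<open>z\<close>
  enters later.\<close>

locale contractive_transfer =
  fixes H :: "'h set" and W W' :: "('h option \<Rightarrow> complex) \<Rightarrow> 'h option \<Rightarrow> complex"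
    and M :: "('h \<Rightarrow> complex) \<Rightarrow> 'h \<Rightarrow> complex" and r :: real
  assumes H: "finite H" and W: "unitary_pair (insert None (Some ` H)) W W'"
    and M: "clin M" and r: "0 \<le> r" "r < 1" and contr: "\<And>u. nsq H (M u) \<le> r\<^sup>2 * nsq H u"
begin

abbreviation "u \<equiv> transfer_state W M"
abbreviation "F \<equiv> transfer W M"

text \<open>The input 1 cancels in a difference and \<open>W\<close> preserves norms, so the errors
  of the output and of the new state together are controlled by the contracted error of the old
  state.\<close>

lemma W_step:
  assumes "W (vec1 1 (M x)) = vec1 a x'" "W (vec1 1 (M y)) = vec1 b y'"
  shows "(cmod (a - b))\<^sup>2 + nsq H (\<lambda>i. x' i - y' i) \<le> r\<^sup>2 * nsq H (\<lambda>i. x i - y i)"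
proof -
  note WD = unitary_pairD [OF W]
  have "vec1 (a - b) (\<lambda>i. x' i - y' i) = W (\<lambda>i. vec1 1 (M x) i - vec1 1 (M y) i)"
    unfolding vec1_diff [symmetric] assms [symmetric] clin_diff [OF WD(1)] ..
  also have "\<dots> = W (vec1 0 (M (\<lambda>i. x i - y i)))"
    unfolding vec1_diff clin_diff [OF M] by simp
  finally have "nsq (insert None (Some ` H)) (vec1 (a - b) (\<lambda>i. x' i - y' i))
      = nsq (insert None (Some ` H)) (vec1 0 (M (\<lambda>i. x i - y i)))"
    by (simp only: WD(7))
  then show ?thesis
    using contr[of "\<lambda>i. x i - y i"] by (simp add: nsq_option [OF H])
qed

lemma state_step: "W (vec1 1 (M (u n))) = vec1 (F n) (u (Suc n))"
  by (auto simp: transfer_def vec1_def fun_eq_iff split: option.split)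

lemma energy: "(cmod (F n))\<^sup>2 + nsq H (u (Suc n)) \<le> 1 + r\<^sup>2 * nsq H (u n)"
proof -
  have "nsq (insert None (Some ` H)) (vec1 (F n) (u (Suc n))) = nsq (insert None (Some ` H)) (vec1 1 (M (u n)))"
    unfolding state_step [symmetric] by (rule unitary_pairD(7) [OF W])
  then show ?thesis using contr[of "u n"] by (simp add: nsq_option [OF H])
qed

lemma energy_0: "(cmod (F 0))\<^sup>2 + nsq H (u (Suc 0)) \<le> 1"
  using energy[of 0] by (simp del: transfer_state.simps(2))

lemma state_diff: "nsq H (\<lambda>i. u (Suc n) i - u n i) \<le> (r\<^sup>2) ^ n"
proof (induction n)
  case 0
  have "nsq H (u (Suc 0)) \<le> 1" using energy_0 zero_le_power2[of "cmod (F 0)"] by linarith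
  then show ?case by simp
next
  case (Suc n)
  have "nsq H (\<lambda>i. u (Suc (Suc n)) i - u (Suc n) i) \<le> r\<^sup>2 * nsq H (\<lambda>i. u (Suc n) i - u n i)"
    using W_step [OF state_step[of "Suc n"] state_step[of n]]
      zero_le_power2[of "cmod (F (Suc n) - F n)"] by linarith
  also have "\<dots> \<le> r\<^sup>2 * (r\<^sup>2) ^ n" by (intro mult_left_mono Suc) simp
  finally show ?case by (simp del: transfer_state.simps)
qed

lemma transfer_diff: "cmod (F (Suc n) - F n) \<le> r ^ n"
proof (rule power2_le_imp_le)
  have "(cmod (F (Suc n) - F n))\<^sup>2 \<le> r\<^sup>2 * nsq H (\<lambda>i. u (Suc n) i - u n i)"
    using W_step [OF state_step[of "Suc n"] state_step[of n]]
      nsq_nonneg[of H "\<lambda>i. u (Suc (Suc n)) i - u (Suc n) i"] by linarith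
  also have "\<dots> \<le> 1 * (r\<^sup>2) ^ n"
    using r by (intro mult_mono state_diff) (auto simp: power_le_one)
  finally show "(cmod (F (Suc n) - F n))\<^sup>2 \<le> (r ^ n)\<^sup>2"
    by (simp add: power_mult [symmetric] mult.commute)
qed (use r in simp)

text \<open>The approximants may exceed 1 in modulus. A bound that depends only on \<open>r\<close>
  gives the local boundedness asked for by \<open>holo_on_bounded_limit\<close>.\<close>

lemma transfer_bounded: "cmod (F n) \<le> 1 + 1 / (1 - r)"
proof -
  have "cmod (F n) \<le> cmod (F 0) + (\<Sum>k<n. r ^ k)"
  proof (induction n)
    case (Suc n)
    then show ?case
      using norm_triangle_ineq2[of "F (Suc n)" "F n"] transfer_diff[of n] by simp
  qed simp
  moreover have "cmod (F 0) \<le> 1"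
  proof (rule power2_le_imp_le)
    have "(cmod (F 0))\<^sup>2 \<le> 1" using energy_0 nsq_nonneg[of H "u (Suc 0)"] by linarith
    then show "(cmod (F 0))\<^sup>2 \<le> 1\<^sup>2" by simp
  qed simp
  moreover have "(\<Sum>k<n. r ^ k) \<le> 1 / (1 - r)"
    using r by (simp add: sum_gp_strict divide_right_mono)
  ultimately show ?thesis by simp
qed

lemma transfer_convergent: "convergent F"
proof -
  have "summable (\<lambda>n. F (Suc n) - F n)"
    using r by (intro summable_comparison_test' [OF summable_geometric transfer_diff]) simp
  then have "convergent (\<lambda>n. \<Sum>k<n. F (Suc k) - F k)"
    by (simp add: summable_iff_convergent)
  then have "convergent (\<lambda>n. (\<Sum>k<n. F (Suc k) - F k) + F 0)"
    by (intro convergent_add convergent_const)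
  then show ?thesis by (simp add: sum_lessThan_telescope)
qed

text \<open>If |l| > 1, then from some step on each output carries away more energy than the unit
  fed in, so the energy of the state falls by a fixed amount per step and would become
  negative.\<close>

lemma transfer_limit_le_1:
  assumes "F \<longlonglongrightarrow> l"
  shows "cmod l \<le> 1"
proof (rule ccontr)
  assume "\<not> cmod l \<le> 1"
  then have "1 < (cmod l)\<^sup>2" by (simp add: one_less_power)
  then obtain \<epsilon> where \<epsilon>: "0 < \<epsilon>" "1 + \<epsilon> < (cmod l)\<^sup>2"
    using dense[of 0 "(cmod l)\<^sup>2 - 1"] by fastforce
  have "(\<lambda>n. (cmod (F n))\<^sup>2) \<longlonglongrightarrow> (cmod l)\<^sup>2" by (intro tendsto_intros assms)
  from order_tendstoD(1) [OF this \<epsilon>(2)] obtain N where N: "\<And>n. n \<ge> N \<Longrightarrow> 1 + \<epsilon> < (cmod (F n))\<^sup>2"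
    by (auto simp: eventually_sequentially)
  have dec: "nsq H (u (N + k)) \<le> nsq H (u N) - real k * \<epsilon>" for k
  proof (induction k)
    case (Suc k)
    have "r\<^sup>2 * nsq H (u (N + k)) \<le> 1 * nsq H (u (N + k))"
      using r by (intro mult_right_mono) (auto simp: power_le_one)
    then have "nsq H (u (Suc (N + k))) \<le> nsq H (u (N + k)) - \<epsilon>"
      using energy[of "N + k"] N[of "N + k"] by linarith
    then show ?case using Suc by (simp add: algebra_simps del: transfer_state.simps)
  qed simp
  obtain k where "nsq H (u N) < real k * \<epsilon>"
    using reals_Archimedean3 [OF \<epsilon>(1)] by blast
  then show False using dec[of k] nsq_nonneg[of H "u (N + k)"] by linarith
qed

text \<open>A state that reproduces itself attracts the iteration started at 0. This is how the node
  vectors of the realization determine values of the transfer function.\<close>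

lemma transfer_fixed_point:
  assumes "W (vec1 1 (M x)) = vec1 \<phi> x"
  shows "F \<longlonglongrightarrow> \<phi>"
proof -
  have x: "nsq H (\<lambda>i. x i - u n i) \<le> (r\<^sup>2) ^ n * nsq H x" for n
  proof (induction n)
    case (Suc n)
    have "nsq H (\<lambda>i. x i - u (Suc n) i) \<le> r\<^sup>2 * nsq H (\<lambda>i. x i - u n i)"
      using W_step [OF assms state_step[of n]] zero_le_power2[of "cmod (\<phi> - F n)"] by linarith
    also have "\<dots> \<le> r\<^sup>2 * ((r\<^sup>2) ^ n * nsq H x)" by (intro mult_left_mono Suc) simp
    finally show ?case by (simp del: transfer_state.simps)
  qed simp
  have F: "(cmod (\<phi> - F n))\<^sup>2 \<le> r\<^sup>2 * ((r\<^sup>2) ^ n * nsq H x)" for n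
  proof -
    have "(cmod (\<phi> - F n))\<^sup>2 \<le> r\<^sup>2 * nsq H (\<lambda>i. x i - u n i)"
      using W_step [OF assms state_step[of n]] nsq_nonneg[of H "\<lambda>i. x i - u (Suc n) i"] by linarith
    also have "\<dots> \<le> r\<^sup>2 * ((r\<^sup>2) ^ n * nsq H x)" by (intro mult_left_mono x) simp
    finally show ?thesis .
  qed
  have "\<bar>r\<^sup>2\<bar> < 1" using r by (simp add: abs_square_less_1)
  then have "(\<lambda>n. r\<^sup>2 * ((r\<^sup>2) ^ n * nsq H x)) \<longlonglongrightarrow> r\<^sup>2 * (0 * nsq H x)"
    by (intro tendsto_intros LIMSEQ_power_zero) simp
  then have "(\<lambda>n. (cmod (\<phi> - F n))\<^sup>2) \<longlonglongrightarrow> 0"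
    by (intro Lim_null_comparison [of "\<lambda>n. (cmod (\<phi> - F n))\<^sup>2"]) (use F in auto)
  then have "(\<lambda>n. sqrt ((cmod (\<phi> - F n))\<^sup>2)) \<longlonglongrightarrow> sqrt 0" by (intro tendsto_intros)
  then have "(\<lambda>n. \<phi> - F n) \<longlonglongrightarrow> 0" by (simp add: tendsto_norm_zero_iff)
  from tendsto_diff [OF tendsto_const[of \<phi>] this] show ?thesis by simp
qed

end

text \<open>The Schur product of \<open>X\<close>, as a block matrix with blocks indexed by
  \<open>'b\<close>, with the scalar matrix \<open>Z\<close>. Cutting the argument down to summand
  \<open>c\<close> picks the column block \<open>c\<close>.\<close>

definition block_mult ::
    "(('b \<times> 'j \<Rightarrow> complex) \<Rightarrow> 'b::finite \<times> 'j \<Rightarrow> complex) \<Rightarrow> ('b \<Rightarrow> 'b \<Rightarrow> complex) \<Rightarrow>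
      ('b \<times> 'j \<Rightarrow> complex) \<Rightarrow> 'b \<times> 'j \<Rightarrow> complex" where
  "block_mult X Z x = (\<lambda>h. \<Sum>c\<in>UNIV. Z (fst h) c * X (\<lambda>k. if fst k = c then x k else 0) h)"

definition block_diag :: "('b \<Rightarrow> complex) \<Rightarrow> ('b \<times> 'j \<Rightarrow> complex) \<Rightarrow> 'b \<times> 'j \<Rightarrow> complex" where
  "block_diag d x = (\<lambda>h. d (fst h) * x h)"

lemma block_mult_clin:
  assumes "clin X"
  shows "clin (block_mult X Z)"
proof -
  have "X (\<lambda>k. if fst k = c then a * x k + y k else 0) =
      (\<lambda>h. a * X (\<lambda>k. if fst k = c then x k else 0) h + X (\<lambda>k. if fst k = c then y k else 0) h)" for a c x y
  proof -
    have "(\<lambda>k. if fst k = c then a * x k + y k else 0)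
      = (\<lambda>k. a * (if fst k = c then x k else 0) + (if fst k = c then y k else 0))"
      by (auto simp: fun_eq_iff)
    then show ?thesis by (simp add: clinD [OF assms])
  qed
  note X = this
  show ?thesis
    unfolding clin_def block_mult_def
  proof (intro allI ext)
    fix a x y and h :: "'a \<times> 'b"
    show "(\<Sum>c\<in>UNIV. Z (fst h) c * X (\<lambda>k. if fst k = c then a * x k + y k else 0) h) =
      a * (\<Sum>c\<in>UNIV. Z (fst h) c * X (\<lambda>k. if fst k = c then x k else 0) h) +
      (\<Sum>c\<in>UNIV. Z (fst h) c * X (\<lambda>k. if fst k = c then y k else 0) h)"
      unfolding X by (simp add: sum.distrib sum_distrib_left distrib_left mult_ac)
  qed
qed

text \<open>A rank one Schur factor acts as diagonal operators on both sides. This identifies the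
  operator at a node and is the building block of \<open>block_mult_contractive\<close>.\<close>

lemma block_mult_rank_one:
  assumes "clin X" and "\<And>b c. Z b c = p b * q c"
  shows "block_mult X Z x = block_diag p (X (block_diag q x))"
proof
  fix h
  have "block_diag q x = (\<lambda>k. \<Sum>c\<in>UNIV. q c * (if fst k = c then x k else 0))"
    by (auto simp: block_diag_def fun_eq_iff if_distrib cong: if_cong)
  then have "X (block_diag q x) h = (\<Sum>c\<in>UNIV. q c * X (\<lambda>k. if fst k = c then x k else 0) h)"
    by (simp add: clin_sum [OF assms(1)])
  then show "block_mult X Z x h = block_diag p (X (block_diag q x)) h"
    by (simp add: block_mult_def assms(2) block_diag_def sum_distrib_left mult.assoc)
qed

lemma block_mult_sum:
  "block_mult X (\<lambda>b c. \<Sum>k\<in>K. Z k b c) x = (\<lambda>h. \<Sum>k\<in>K. block_mult X (Z k) x h)"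
  unfolding block_mult_def sum_distrib_right by (subst sum.swap) simp

lemma cmod_sum_mult_square_le:
  assumes "(\<Sum>k\<in>K. (cmod (a k))\<^sup>2) \<le> 1"
  shows "(cmod (\<Sum>k\<in>K. a k * b k))\<^sup>2 \<le> (\<Sum>k\<in>K. (cmod (b k))\<^sup>2)"
proof -
  have "cmod (\<Sum>k\<in>K. a k * b k) \<le> (\<Sum>k\<in>K. cmod (a k) * cmod (b k))"
    by (rule order_trans [OF norm_sum]) (simp add: norm_mult)
  then have "(cmod (\<Sum>k\<in>K. a k * b k))\<^sup>2 \<le> (\<Sum>k\<in>K. cmod (a k) * cmod (b k))\<^sup>2"
    by (rule power_mono) simp
  also have "\<dots> \<le> (\<Sum>k\<in>K. (cmod (a k))\<^sup>2) * (\<Sum>k\<in>K. (cmod (b k))\<^sup>2)"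
    by (rule Cauchy_Schwarz_ineq_sum)
  also have "\<dots> \<le> 1 * (\<Sum>k\<in>K. (cmod (b k))\<^sup>2)"
    by (intro mult_right_mono assms sum_nonneg) simp
  finally show ?thesis by simp
qed

text \<open>The easy half of the factorization theorem for Schur multipliers: \<open>y\<close> turns
  \<open>u\<close> into a column of weighted copies of no larger total norm, \<open>X\<close> acts
  on each copy, and \<open>x\<close> recombines them by Cauchy-Schwarz.\<close>

lemma block_mult_contractive:
  assumes X: "unitary_pair (UNIV \<times> J) X X'"
    and Z: "\<And>b c. Z b c = (\<Sum>k\<in>UNIV. x b k * y c k)"
    and x: "\<And>b. (\<Sum>k\<in>UNIV. (cmod (x b k))\<^sup>2) \<le> 1" and y: "\<And>c. (\<Sum>k\<in>UNIV. (cmod (y c k))\<^sup>2) \<le> 1"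
  shows "nsq (UNIV \<times> J) (block_mult X Z u) \<le> nsq (UNIV \<times> J) (u :: 'b::finite \<times> 'j \<Rightarrow> complex)"
proof -
  note XD = unitary_pairD [OF X]
  define v where "v k = block_diag (\<lambda>c. y c k) u" for k
  have "Z = (\<lambda>b c. \<Sum>k\<in>UNIV. x b k * y c k)" using Z by (intro ext) 
  then have eq: "block_mult X Z u = (\<lambda>h. \<Sum>k\<in>UNIV. x (fst h) k * X (v k) h)"
    unfolding v_def
    by (simp only: block_mult_sum block_mult_rank_one [OF XD(1)]) (simp add: block_diag_def)
  have "nsq (UNIV \<times> J) (block_mult X Z u) \<le> (\<Sum>h\<in>UNIV \<times> J. \<Sum>k\<in>UNIV. (cmod (X (v k) h))\<^sup>2)"
    unfolding eq nsq_def by (intro sum_mono cmod_sum_mult_square_le x)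
  also have "\<dots> = (\<Sum>k\<in>UNIV. nsq (UNIV \<times> J) (X (v k)))"
    unfolding nsq_def by (rule sum.swap)
  also have "\<dots> = (\<Sum>k\<in>UNIV. nsq (UNIV \<times> J) (v k))"
    unfolding XD(7) ..
  also have "\<dots> = (\<Sum>h\<in>UNIV \<times> J. (\<Sum>k\<in>UNIV. (cmod (y (fst h) k))\<^sup>2) * (cmod (u h))\<^sup>2)"
    unfolding nsq_def v_def block_diag_def sum_distrib_right
    by (subst sum.swap) (simp add: norm_mult power_mult_distrib)
  also have "\<dots> \<le> (\<Sum>h\<in>UNIV \<times> J. 1 * (cmod (u h))\<^sup>2)"
    by (intro sum_mono mult_right_mono y) simp
  finally show ?thesis by (simp add: nsq_def)
qed

lemma block_mult_scale: "block_mult X (\<lambda>b c. a * Z b c) x = (\<lambda>h. a * block_mult X Z x h)"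
  by (simp add: block_mult_def sum_distrib_left mult.assoc)

section \<open>Models and realizations of even functions\<close>

definition lam :: "complex \<times> complex \<Rightarrow> bool \<Rightarrow> complex" where
  "lam p b = (if b then fst p else snd p)"

text \<open>Comparing the decomposition at \<open>(\<plusminus>p, \<plusminus>q)\<close> separates the even part \<open>e\<close> and the odd part \<open>d\<close> of the
  model.\<close>

lemma even_agler_model:
  fixes \<phi> :: "complex \<Rightarrow> complex \<Rightarrow> complex"
  assumes J: "finite J" and JD: "J \<subseteq> ball 0 1 \<times> ball 0 1" and neg: "uminus ` J \<subseteq> J"
    and \<phi>: "schur_bidisc \<phi>"
    and even: "\<And>s t. \<phi> (- s) (- t) = \<phi> s t"
  obtains e d where "\<forall>p h. h \<notin> UNIV \<times> J \<longrightarrow> e p h = 0 \<and> d p h = 0"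
    and "\<forall>p\<in>J. \<forall>q\<in>J.
      cip (UNIV \<times> J) (block_diag (lam p) (e p)) (block_diag (lam q) (e q)) = cip (UNIV \<times> J) (d p) (d q)"
    and "\<forall>p\<in>J. \<forall>q\<in>J. 1 + cip (UNIV \<times> J) (block_diag (lam p) (d p)) (block_diag (lam q) (d q)) =
      cnj (\<phi> (fst p) (snd p)) * \<phi> (fst q) (snd q) + cip (UNIV \<times> J) (e p) (e q)"
proof -
  define H where "H = (UNIV :: bool set) \<times> J"
  have "\<exists>u v. (\<forall>i j. i \<notin> J \<longrightarrow> u j i = 0 \<and> v j i = 0) \<and> (\<forall>i\<in>J. \<forall>j\<in>J.
    1 - cnj (\<phi> (fst i) (snd i)) * \<phi> (fst j) (snd j) =
      (1 - cnj (fst i) * fst j) * cip J (u i) (u j) + (1 - cnj (snd i) * snd j) * cip J (v i) (v j))"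
  proof (rule agler_decomposition [where s = fst and t = snd and \<phi> = \<phi>, OF J _ _ \<phi>])
    show "cmod (fst j) < 1" "cmod (snd j) < 1" if "j \<in> J" for j
      using JD that by auto
  qed
  then obtain u v where uv0: "\<And>i j. i \<notin> J \<Longrightarrow> u j i = 0 \<and> v j i = 0"
    and uv: "\<And>i j. i \<in> J \<Longrightarrow> j \<in> J \<Longrightarrow> 1 - cnj (\<phi> (fst i) (snd i)) * \<phi> (fst j) (snd j) =
      (1 - cnj (fst i) * fst j) * cip J (u i) (u j) + (1 - cnj (snd i) * snd j) * cip J (v i) (v j)"
    by blast
  define w where "w p = (\<lambda>h. if fst h then u p (snd h) else v p (snd h))" for p
  define W where "W p = block_diag (lam p) (w p)" for p
  define f where "f p = \<phi> (fst p) (snd p)" for p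
  have main: "1 - cnj (f p) * f q = cip H (w p) (w q) - cip H (W p) (W q)" if "p \<in> J" "q \<in> J" for p q
    unfolding f_def uv [OF that]
    by (simp add: H_def cip_bool w_def W_def block_diag_def lam_def cip_scale_left cip_scale_right algebra_simps)
  have neg': "- p \<in> J" if "p \<in> J" for p using neg that by blast
  have fneg: "f (- p) = f p" for p using even by (simp add: f_def)
  define e where "e p = (\<lambda>h. (1/2) * (w p h + w (- p) h))" for p
  define d where "d p = (\<lambda>h. (1/2) * (w p h - w (- p) h))" for p
  have ad: "cip H (\<lambda>h. x h + y h) z = cip H x z + cip H y z"
       "cip H z (\<lambda>h. x h + y h) = cip H z x + cip H z y" for x y z
    by (simp_all add: cip_def algebra_simps sum.distrib)
  \<comment> \<open>\<open>lam\<close> is odd in the node, so multiplication by it exchanges even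
    and odd parts.\<close>
  have de: "block_diag (lam p) (e p) = (\<lambda>h. (1/2) * (W p h - W (- p) h))"
           "block_diag (lam p) (d p) = (\<lambda>h. (1/2) * (W p h + W (- p) h))" for p
    by (auto simp: e_def d_def W_def block_diag_def lam_def fun_eq_iff algebra_simps)
  have main': "cip H (block_diag (lam p) (e p)) (block_diag (lam q) (e q)) = cip H (d p) (d q)"
    "1 + cip H (block_diag (lam p) (d p)) (block_diag (lam q) (d q)) = cnj (f p) * f q + cip H (e p) (e q)"
    if p: "p \<in> J" and q: "q \<in> J" for p q
  proof -
    define c where "c = 1 - cnj (f p) * f q"
    have aux: "x = c + y" if "c = x - y" for x y using that by simp
    \<comment> \<open>The four sign choices share the constant \<open>c\<close> because
      \<open>f\<close> is even.\<close>
    note m = main [OF p q, unfolded fneg, folded c_def, THEN aux]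
      main [OF neg' [OF p] q, unfolded fneg, folded c_def, THEN aux]
      main [OF p neg' [OF q], unfolded fneg, folded c_def, THEN aux]
      main [OF neg' [OF p] neg' [OF q], unfolded fneg, folded c_def, THEN aux]
    have f: "cnj (f p) * f q = 1 - c" by (simp add: c_def)
    show "cip H (block_diag (lam p) (e p)) (block_diag (lam q) (e q)) = cip H (d p) (d q)"
      "1 + cip H (block_diag (lam p) (d p)) (block_diag (lam q) (d q)) = cnj (f p) * f q + cip H (e p) (e q)"
      unfolding de unfolding e_def d_def cip_scale_left cip_scale_right cip_diff_left cip_diff_right ad m f
      by (simp_all add: field_simps)
  qed
  have "e p h = 0 \<and> d p h = 0" if "h \<notin> H" for p h
    using that uv0 by (auto simp: e_def d_def w_def H_def mem_Times_iff)
  then show thesis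
    using main' by (intro that [folded H_def f_def, of e d]) simp_all
qed

text \<open>Both identities of the model equate Gram matrices. So \<open>unitary_extension\<close>
  gives \<open>X\<close> taking the weighted even part to the odd part, and \<open>W\<close> taking
  1 and the weighted odd part to \<phi> and the even part. Composition removes \<open>d\<close> and
  leaves \<open>e p\<close> as the self-reproducing state at the node.\<close>

lemma even_realization:
  fixes \<phi> :: "complex \<Rightarrow> complex \<Rightarrow> complex"
  assumes J: "finite J" and JD: "J \<subseteq> ball 0 1 \<times> ball 0 1" and neg: "uminus ` J \<subseteq> J"
    and \<phi>: "schur_bidisc \<phi>"
    and even: "\<And>s t. \<phi> (- s) (- t) = \<phi> s t"
  shows "\<exists>X X' W W'. unitary_pair (UNIV \<times> J) X X' \<and> unitary_pair (insert None (Some ` (UNIV \<times> J))) W W' \<and>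
    (\<forall>p\<in>J. \<exists>x. W (vec1 1 (block_mult X (\<lambda>b c. lam p b * lam p c) x)) = vec1 (\<phi> (fst p) (snd p)) x)"
proof -
  define H where "H = (UNIV :: bool set) \<times> J"
  have H: "finite H" using J by (simp add: H_def)
  obtain e d where *: "\<forall>p h. h \<notin> H \<longrightarrow> e p h = 0 \<and> d p h = 0"
    "\<forall>p\<in>J. \<forall>q\<in>J. cip H (block_diag (lam p) (e p)) (block_diag (lam q) (e q)) = cip H (d p) (d q)"
    "\<forall>p\<in>J. \<forall>q\<in>J. 1 + cip H (block_diag (lam p) (d p)) (block_diag (lam q) (d q)) =
      cnj (\<phi> (fst p) (snd p)) * \<phi> (fst q) (snd q) + cip H (e p) (e q)"
    by (rule even_agler_model [OF J JD neg \<phi> even, folded H_def])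
  note ed0 = *(1) [rule_format] and dd = *(2) [rule_format] and ee = *(3) [rule_format]
  have "\<exists>X X'. unitary_pair H X X' \<and> (\<forall>p\<in>J. X (block_diag (lam p) (e p)) = d p)"
  proof (rule unitary_extension [OF J _ _ H])
    show "block_diag (lam j) (e j) i = 0" "d j i = 0" if "i \<notin> H" for i j
      using ed0 [OF that] by (simp_all add: block_diag_def)
  qed (rule dd)
  then obtain X X' where X: "unitary_pair H X X'"
    and Xe: "\<And>p. p \<in> J \<Longrightarrow> X (block_diag (lam p) (e p)) = d p" by blast
  let ?I = "insert None (Some ` H)"
  have "\<exists>W W'. unitary_pair ?I W W' \<and>
      (\<forall>p\<in>J. W (vec1 1 (block_diag (lam p) (d p))) = vec1 (\<phi> (fst p) (snd p)) (e p))"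
  proof (rule unitary_extension [OF J])
    show "vec1 1 (block_diag (lam j) (d j)) i = 0" "vec1 (\<phi> (fst j) (snd j)) (e j) i = 0"
      if i: "i \<notin> ?I" for i j
    proof -
      obtain h where "i = Some h" "h \<notin> H" using i by (cases i) auto
      then show "vec1 1 (block_diag (lam j) (d j)) i = 0" "vec1 (\<phi> (fst j) (snd j)) (e j) i = 0"
        using ed0 by (simp_all add: block_diag_def)
    qed
    show "finite ?I" using H by simp
    show "cip ?I (vec1 1 (block_diag (lam j) (d j))) (vec1 1 (block_diag (lam k) (d k))) =
      cip ?I (vec1 (\<phi> (fst j) (snd j)) (e j)) (vec1 (\<phi> (fst k) (snd k)) (e k))" if "j \<in> J" "k \<in> J" for j k
      using ee [OF that] by (simp add: cip_option [OF H])
  qed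
  then obtain W W' where W: "unitary_pair ?I W W'"
    and We: "\<And>p. p \<in> J \<Longrightarrow> W (vec1 1 (block_diag (lam p) (d p))) = vec1 (\<phi> (fst p) (snd p)) (e p)" by blast
  have "\<forall>p\<in>J. \<exists>x. W (vec1 1 (block_mult X (\<lambda>b c. lam p b * lam p c) x)) = vec1 (\<phi> (fst p) (snd p)) x"
  proof
    fix p assume p: "p \<in> J"
    have "block_mult X (\<lambda>b c. lam p b * lam p c) (e p) = block_diag (lam p) (d p)"
      unfolding block_mult_rank_one [OF unitary_pairD(1) [OF X] refl] Xe [OF p] ..
    then have "W (vec1 1 (block_mult X (\<lambda>b c. lam p b * lam p c) (e p))) = vec1 (\<phi> (fst p) (snd p)) (e p)"
      by (simp only: We [OF p])
    then show "\<exists>x. W (vec1 1 (block_mult X (\<lambda>b c. lam p b * lam p c) x)) = vec1 (\<phi> (fst p) (snd p)) x"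
      by (rule exI[of _ "e p"])
  qed
  with X W show ?thesis
    unfolding H_def
    by (intro exI[of _ X] exI[of _ X'] exI[of _ W] exI[of _ W'] conjI)
qed

section \<open>Holomorphic functions of several variables\<close>

lemma norm_vec_scale: "norm (c *s v) = cmod c * norm (v :: complex ^ 'n)"
  unfolding norm_vec_def by (simp add: norm_mult L2_set_right_distrib)

lemma bounded_linear_vec_scale: "bounded_linear (\<lambda>c. c *s (v :: complex ^ 'n))"
  unfolding linear_conv_bounded_linear [symmetric]
  by (rule linearI) (simp_all add: vec_eq_iff algebra_simps scaleR_conv_of_real [where 'a = complex])

lemma scaleR_vec_scale: "r *\<^sub>R (v :: complex ^ 'n) = of_real r *s v"
  by (simp add: vec_eq_iff scaleR_conv_of_real [where 'a = complex])

lemma holo_onD: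
  assumes "holo_on F U" "z \<in> U"
  obtains F' where "(F has_derivative F') (at z)" "\<And>c v. F' (c *s v) = c * F' v"
  using assms unfolding holo_on_def by blast

lemma holo_on_subset: "holo_on F U \<Longrightarrow> V \<subseteq> U \<Longrightarrow> holo_on F V"
  unfolding holo_on_def by blast

lemma holo_on_const: "holo_on (\<lambda>z. c) U"
  unfolding holo_on_def by (auto intro!: exI[of _ "\<lambda>_. 0"])

lemma holo_on_coord: "holo_on (\<lambda>z. z $ i) U"
  unfolding holo_on_def
  by (auto intro!: exI[of _ "\<lambda>z. z $ i"] bounded_linear_imp_has_derivative bounded_linear_vec_nth)

lemma holo_on_add:
  assumes "holo_on F U" "holo_on G U"
  shows "holo_on (\<lambda>z. F z + G z) U"
  unfolding holo_on_def
proof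
  fix z assume z: "z \<in> U"
  obtain F' where F': "(F has_derivative F') (at z)" "\<And>c v. F' (c *s v) = c * F' v"
    using holo_onD [OF assms(1) z] by blast
  obtain G' where G': "(G has_derivative G') (at z)" "\<And>c v. G' (c *s v) = c * G' v"
    using holo_onD [OF assms(2) z] by blast
  show "\<exists>H. ((\<lambda>z. F z + G z) has_derivative H) (at z) \<and> (\<forall>c v. H (c *s v) = c * H v)"
    by (intro exI[of _ "\<lambda>h. F' h + G' h"] conjI has_derivative_add F' G') (simp add: F' G' algebra_simps)
qed

lemma holo_on_mult:
  assumes "holo_on F U" "holo_on G U"
  shows "holo_on (\<lambda>z. F z * G z) U"
  unfolding holo_on_def
proof
  fix z assume z: "z \<in> U"
  obtain F' where F': "(F has_derivative F') (at z)" "\<And>c v. F' (c *s v) = c * F' v"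
    using holo_onD [OF assms(1) z] by blast
  obtain G' where G': "(G has_derivative G') (at z)" "\<And>c v. G' (c *s v) = c * G' v"
    using holo_onD [OF assms(2) z] by blast
  show "\<exists>H. ((\<lambda>z. F z * G z) has_derivative H) (at z) \<and> (\<forall>c v. H (c *s v) = c * H v)"
    by (intro exI[of _ "\<lambda>h. F z * G' h + F' h * G z"] conjI has_derivative_mult F' G') (simp add: F' G' algebra_simps)
qed

lemma holo_on_inverse:
  assumes "holo_on F U" "\<And>z. z \<in> U \<Longrightarrow> F z \<noteq> 0"
  shows "holo_on (\<lambda>z. inverse (F z)) U"
  unfolding holo_on_def
proof
  fix z assume z: "z \<in> U"
  obtain F' where F': "(F has_derivative F') (at z)" "\<And>c v. F' (c *s v) = c * F' v"
    using holo_onD [OF assms(1) z] by blast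
  then show "\<exists>H. ((\<lambda>z. inverse (F z)) has_derivative H) (at z) \<and> (\<forall>c v. H (c *s v) = c * H v)"
    using assms(2) [OF z]
    by (intro exI[of _ "\<lambda>h. - (inverse (F z) * F' h * inverse (F z))"] conjI Deriv.has_derivative_inverse)
      auto
qed

lemma holo_on_cmult: "holo_on F U \<Longrightarrow> holo_on (\<lambda>z. c * F z) U"
  by (intro holo_on_mult holo_on_const)

lemma holo_on_diff: "holo_on F U \<Longrightarrow> holo_on G U \<Longrightarrow> holo_on (\<lambda>z. F z - G z) U"
  using holo_on_add [of F U "\<lambda>z. -1 * G z"] holo_on_cmult [of G U "-1"] by simp

lemma holo_on_sum:
  "(\<And>k. k \<in> K \<Longrightarrow> holo_on (F k) U) \<Longrightarrow> holo_on (\<lambda>z. \<Sum>k\<in>K. F k z) U"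
  by (induction K rule: infinite_finite_induct) (auto intro: holo_on_const holo_on_add)

lemma holo_on_imp_isCont: "holo_on F U \<Longrightarrow> z \<in> U \<Longrightarrow> isCont F z"
  by (meson holo_onD has_derivative_continuous)

lemma holo_on_imp_continuous_on: "holo_on F U \<Longrightarrow> continuous_on U F"
  by (auto intro: continuous_at_imp_continuous_on holo_on_imp_isCont)

lemma holo_chain_curve:
  fixes F :: "complex ^ 'n \<Rightarrow> complex"
  assumes "(F has_derivative F') (at (\<gamma> \<zeta>))" "\<And>c v. F' (c *s v) = c * F' v"
    and "(\<gamma> has_derivative (\<lambda>h. h *s w)) (at \<zeta>)"
  shows "((\<lambda>\<zeta>. F (\<gamma> \<zeta>)) has_field_derivative F' w) (at \<zeta>)"
  using has_derivative_compose [OF assms(3,1)] assms(2)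
  by (simp add: has_field_derivative_def mult.commute [of _ "F' w"])

lemma holo_slice_derivative:
  fixes F :: "complex ^ 'n \<Rightarrow> complex"
  assumes "(F has_derivative F') (at (z + \<zeta> *s v))" "\<And>c v. F' (c *s v) = c * F' v"
  shows "((\<lambda>\<zeta>. F (z + \<zeta> *s v)) has_field_derivative F' v) (at \<zeta>)"
proof -
  have "((\<lambda>\<zeta>. z + \<zeta> *s v) has_derivative (\<lambda>h. 0 + h *s v)) (at \<zeta>)"
    by (intro has_derivative_add has_derivative_const bounded_linear_imp_has_derivative
        bounded_linear_vec_scale)
  then show ?thesis
    using holo_chain_curve [of F F' "\<lambda>\<zeta>. z + \<zeta> *s v", OF assms] by simp
qed

lemma holo_slice:
  assumes "holo_on F U" "\<And>\<zeta>. \<zeta> \<in> A \<Longrightarrow> z + \<zeta> *s v \<in> U" "open A"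
  shows "(\<lambda>\<zeta>. F (z + \<zeta> *s v)) holomorphic_on A"
  unfolding holomorphic_on_open [OF assms(3)]
  using assms(1,2) holo_slice_derivative holo_onD by metis

text \<open>Cauchy estimates on the complex line through \<open>z\<close> and \<open>z + h\<close>,
  scaled so that the unit disc goes into the ball and \<open>z + h\<close> has parameter
  \<open>r\<close>, at most 1/2; the constant 2 bounds 1 / (1 - r). The bounds depend on
  \<open>F\<close> only through \<open>C\<close>, hence hold uniformly in bounded families.\<close>

lemma holo_estimates:
  fixes F :: "complex ^ 'n \<Rightarrow> complex"
  assumes F: "holo_on F U" and R: "R > 0" "ball z R \<subseteq> U" and C: "C > 0" "\<And>w. w \<in> ball z R \<Longrightarrow> cmod (F w) \<le> C"
    and h: "norm h \<le> R / 2"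
  shows "cmod (F (z + h) - F z) \<le> 2 * C / R * norm h"
    and "(F has_derivative F') (at z) \<Longrightarrow> (\<And>c v. F' (c *s v) = c * F' v) \<Longrightarrow>
      cmod (F (z + h) - F z - F' h) \<le> 2 * C / R\<^sup>2 * (norm h)\<^sup>2"
proof -
  define r where "r = norm h / R"
  have r: "0 \<le> r" "r \<le> 1/2" using h R by (auto simp: r_def field_simps)
  define v where "v = of_real (R / norm h) *s h"
  have hv: "h = of_real r *s v"
    using R by (cases "h = 0") (auto simp: v_def r_def vec_eq_iff)
  have vR: "norm v \<le> R"
    using R by (cases "h = 0") (auto simp: v_def norm_vec_scale norm_divide)
  define g where "g \<zeta> = F (z + \<zeta> *s v) / of_real C" for \<zeta>
  have in_ball: "z + \<zeta> *s v \<in> ball z R" if "cmod \<zeta> < 1" for \<zeta>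
  proof -
    have "cmod \<zeta> * norm v \<le> cmod \<zeta> * R" using vR by (simp add: mult_left_mono)
    also have "\<dots> < 1 * R" using that R by (intro mult_strict_right_mono) auto
    finally show ?thesis by (simp add: dist_norm norm_vec_scale)
  qed
  have hol: "g holomorphic_on ball 0 1"
    unfolding g_def using in_ball R C(1)
    by (intro holomorphic_intros holo_slice [OF F]) auto
  have bd: "cmod (g \<zeta>) \<le> 1" if "cmod \<zeta> < 1" for \<zeta>
    using C(2) [OF in_ball [OF that]] C(1) by (simp add: g_def norm_divide field_simps)
  have tail: "cmod (g (of_real r) - (\<Sum>k<M. tcoef g k * of_real r ^ k)) \<le> 2 * r ^ M" for M
  proof -
    have "cmod (g (of_real r) - (\<Sum>k<M. tcoef g k * of_real r ^ k)) \<le> r ^ M / (1 - r)"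
      using r by (intro tcoef_tail hol bd) auto
    also have "\<dots> \<le> r ^ M / (1/2)" using r by (intro divide_left_mono) auto
    finally show ?thesis by simp
  qed
  have gr: "g (of_real r) = F (z + h) / of_real C" by (simp add: g_def flip: hv)
  have g0: "tcoef g 0 = F z / of_real C" by (simp add: tcoef_def g_def)
  have "cmod ((F (z + h) - F z) / of_real C) \<le> 2 * r"
    using tail[of 1] by (simp add: gr g0 diff_divide_distrib)
  then show "cmod (F (z + h) - F z) \<le> 2 * C / R * norm h"
    using C(1) R(1) by (simp add: norm_divide r_def field_simps)
  assume F': "(F has_derivative F') (at z)" "\<And>c v. F' (c *s v) = c * F' v"
  have "((\<lambda>\<zeta>. F (z + \<zeta> *s v)) has_field_derivative F' v) (at 0)"
    by (rule holo_slice_derivative) (use F' in auto)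
  then have "(g has_field_derivative F' v / of_real C) (at 0)"
    unfolding g_def by (rule DERIV_cdivide)
  then have "tcoef g 1 = F' v / of_real C"
    by (simp add: tcoef_def DERIV_imp_deriv)
  moreover have "F' h = F' v * of_real r" using F'(2)[of "of_real r" v] by (simp add: hv [symmetric] mult.commute)
  ultimately have "(F (z + h) - F z - F' h) / of_real C = g (of_real r) - (\<Sum>k<2. tcoef g k * of_real r ^ k)"
    by (simp add: gr g0 numeral_2_eq_2 diff_divide_distrib)
  then have "cmod ((F (z + h) - F z - F' h) / of_real C) \<le> 2 * r ^ 2"
    using tail[of 2] by simp
  then show "cmod (F (z + h) - F z - F' h) \<le> 2 * C / R\<^sup>2 * (norm h)\<^sup>2"
    using C(1) R(1) by (simp add: norm_divide r_def field_simps)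
qed

text \<open>For terms that can be compared, uniformly in \<open>n\<close>, with sequences known to
  converge: derivatives with difference quotients, values with values at dense points.\<close>

lemma convergent_approx:
  fixes x :: "nat \<Rightarrow> complex"
  assumes "\<And>\<epsilon>. \<epsilon> > 0 \<Longrightarrow> \<exists>a. convergent a \<and> (\<forall>n. cmod (x n - a n) \<le> \<epsilon>)"
  shows "convergent x"
proof -
  have "Cauchy x"
    unfolding Cauchy_iff
  proof (intro allI impI)
    fix e :: real assume e: "0 < e"
    obtain a where a: "convergent a" "\<And>n. cmod (x n - a n) \<le> e / 4"
      using assms[of "e / 4"] e by auto
    obtain M where M: "\<And>m n. m \<ge> M \<Longrightarrow> n \<ge> M \<Longrightarrow> cmod (a m - a n) < e / 4"
      using convergent_Cauchy [OF a(1)] e unfolding Cauchy_iff by (metis zero_less_divide_iff zero_less_numeral)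
    have "cmod (x m - x n) < e" if "m \<ge> M" "n \<ge> M" for m n
    proof -
      have "cmod (x m - x n) \<le> cmod (x m - a m) + cmod (a m - a n) + cmod (a n - x n)"
        using norm_triangle_ineq[of "x m - a m + (a m - a n)" "a n - x n"]
          norm_triangle_ineq[of "x m - a m" "a m - a n"] by simp
      then show ?thesis
        using a(2)[of m] a(2)[of n] M [OF that] e by (simp add: norm_minus_commute[of "a n"])
    qed
    then show "\<exists>M. \<forall>m\<ge>M. \<forall>n\<ge>M. cmod (x m - x n) < e" by blast
  qed
  then show ?thesis by (simp add: Cauchy_convergent_iff)
qed

text \<open>Derivatives converge because difference quotients, which converge by assumption,
  approximate them uniformly in \<open>n\<close>. The quadratic remainder estimate then passes to
  the limit.\<close>

lemma holo_on_bounded_limit: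
  fixes F :: "nat \<Rightarrow> complex ^ 'n \<Rightarrow> complex"
  assumes F: "\<And>n. holo_on (F n) U"
    and bd: "\<And>z. z \<in> U \<Longrightarrow> \<exists>R>0. \<exists>C>0. ball z R \<subseteq> U \<and> (\<forall>n. \<forall>w\<in>ball z R. cmod (F n w) \<le> C)"
    and lim: "\<And>z. z \<in> U \<Longrightarrow> (\<lambda>n. F n z) \<longlonglongrightarrow> f z"
  shows "holo_on f U"
  unfolding holo_on_def
proof
  fix z assume z: "z \<in> U"
  obtain R C where R: "R > 0" "ball z R \<subseteq> U" and C: "C > 0" "\<And>n w. w \<in> ball z R \<Longrightarrow> cmod (F n w) \<le> C"
    using bd [OF z] by blast
  have "\<forall>n. \<exists>F'. (F n has_derivative F') (at z) \<and> (\<forall>c v. F' (c *s v) = c * F' v)"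
    using F z unfolding holo_on_def by blast
  then obtain D where D: "\<And>n. (F n has_derivative D n) (at z)" "\<And>n c v. D n (c *s v) = c * D n v"
    by metis
  define K where "K = 2 * C / R\<^sup>2"
  have K: "K \<ge> 0" using C by (simp add: K_def)
  have est: "cmod (F n (z + h) - F n z - D n h) \<le> K * (norm h)\<^sup>2" if "norm h \<le> R / 2" for n h
    unfolding K_def by (rule holo_estimates(2) [OF F R C that D])
  have in_U: "z + h \<in> U" if "norm h \<le> R / 2" for h
    using R that by (auto simp: dist_norm subset_iff)
  have conv: "convergent (\<lambda>n. D n v)" for v
  proof (rule convergent_approx)
    fix \<epsilon> :: real assume \<epsilon>: "\<epsilon> > 0"
    define p where "p = norm v + 1"
    have p: "p > 0" "norm v \<le> p" by (simp_all add: p_def add_nonneg_pos)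
    \<comment> \<open>The first bound keeps the increment within \<open>R / 2\<close>, the second
      makes the error at most \<epsilon>; the added 1 excludes a zero denominator.\<close>
    define t where "t = min (R / 2 / p) (\<epsilon> / (K * (norm v)\<^sup>2 + 1))"
    have pos: "0 < K * (norm v)\<^sup>2 + 1"
      using K by (simp add: add_nonneg_pos)
    have t: "t > 0" using R \<epsilon> p pos by (simp add: t_def)
    have t1: "norm (of_real t *s v) \<le> R / 2"
    proof -
      have "t * norm v \<le> R / 2 / p * p"
        using t R p by (intro mult_mono) (auto simp: t_def)
      also have "\<dots> = R / 2" using p by simp
      finally show ?thesis using t by (simp add: norm_vec_scale)
    qed
    have t2: "t * (K * (norm v)\<^sup>2) \<le> \<epsilon>"
    proof -
      have "t * (K * (norm v)\<^sup>2) \<le> \<epsilon> / (K * (norm v)\<^sup>2 + 1) * (K * (norm v)\<^sup>2 + 1)"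
        using t K \<epsilon> pos by (intro mult_mono) (auto simp: t_def)
      then show ?thesis using pos by simp
    qed
    define a where "a n = (F n (z + of_real t *s v) - F n z) / of_real t" for n
    have "convergent a"
      unfolding a_def using lim in_U [OF t1] z t
      by (intro convergentI [of _ "(f (z + of_real t *s v) - f z) / of_real t"] tendsto_intros) auto
    moreover have "cmod (D n v - a n) \<le> \<epsilon>" for n
    proof -
      have "D n v - a n = - (F n (z + of_real t *s v) - F n z - D n (of_real t *s v)) / of_real t"
        using t by (simp add: a_def D(2) field_simps)
      then have "cmod (D n v - a n) = cmod (F n (z + of_real t *s v) - F n z - D n (of_real t *s v)) / t"
        using t by (simp only: norm_divide norm_minus_cancel norm_of_real abs_of_pos)
      also have "\<dots> \<le> K * (norm (of_real t *s v))\<^sup>2 / t"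
        using t by (intro divide_right_mono est t1) simp
      also have "\<dots> = t * (K * (norm v)\<^sup>2)"
        using t by (simp add: norm_vec_scale power2_eq_square)
      finally show ?thesis using t2 by simp
    qed
    ultimately show "\<exists>a. convergent a \<and> (\<forall>n. cmod (D n v - a n) \<le> \<epsilon>)" by blast
  qed
  define L where "L v = lim (\<lambda>n. D n v)" for v
  have L: "(\<lambda>n. D n v) \<longlonglongrightarrow> L v" for v
    using conv unfolding L_def by (simp add: convergent_LIMSEQ_iff)
  have Lc: "L (c *s v) = c * L v" for c v
  proof (rule LIMSEQ_unique)
    show "(\<lambda>n. D n (c *s v)) \<longlonglongrightarrow> L (c *s v)" by (rule L)
    show "(\<lambda>n. D n (c *s v)) \<longlonglongrightarrow> c * L v" unfolding D(2) by (intro tendsto_intros L)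
  qed
  have La: "L (v + w) = L v + L w" for v w
  proof (rule LIMSEQ_unique)
    show "(\<lambda>n. D n (v + w)) \<longlonglongrightarrow> L (v + w)" by (rule L)
    have "D n (v + w) = D n v + D n w" for n
      using has_derivative_bounded_linear [OF D(1)] by (rule real_vector.linear_add [OF bounded_linear.linear])
    then show "(\<lambda>n. D n (v + w)) \<longlonglongrightarrow> L v + L w" by (simp add: tendsto_add L)
  qed
  have BL: "bounded_linear L"
    unfolding linear_conv_bounded_linear [symmetric]
    by (rule linearI) (simp_all add: La Lc scaleR_vec_scale, simp add: scaleR_conv_of_real)
  have est': "cmod (f (z + h) - f z - L h) \<le> K * (norm h)\<^sup>2" if "norm h \<le> R / 2" for h
  proof (rule tendsto_upperbound)
    show "(\<lambda>n. cmod (F n (z + h) - F n z - D n h)) \<longlonglongrightarrow> cmod (f (z + h) - f z - L h)"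
      by (intro tendsto_intros lim L in_U that z)
  qed (use est that in auto)
  have "(\<lambda>h. norm (f (z + h) - f z - L h) / norm h) \<midarrow>0\<rightarrow> 0"
  proof (rule Lim_null_comparison)
    have "\<forall>\<^sub>F h in at (0 :: complex ^ 'n). norm h < R / 2"
      using R(1) by (intro eventually_at_ball [THEN eventually_mono, of "R/2"]) auto
    then show "\<forall>\<^sub>F h in at (0 :: complex ^ 'n). norm (norm (f (z + h) - f z - L h) / norm h) \<le> K * norm h"
    proof eventually_elim
      case (elim h)
      then show ?case using est'[of h] K
        by (cases "h = 0") (auto simp: field_simps power2_eq_square)
    qed
    show "(\<lambda>h. K * norm h) \<midarrow>0\<rightarrow> 0" by (auto intro!: tendsto_eq_intros)
  qed
  then have "(f has_derivative L) (at z)"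
    using BL by (simp add: has_derivative_at)
  then show "\<exists>F'. (f has_derivative F') (at z) \<and> (\<forall>c v. F' (c *s v) = c * F' v)"
    using Lc by blast
qed

text \<open>Compactness of a countable product replaces the diagonal argument: a subsequence
  converges on a dense sequence of points, and the Lipschitz estimate carries convergence to all of
  \<open>U\<close>.\<close>

lemma holo_montel:
  fixes F :: "nat \<Rightarrow> complex ^ 'n \<Rightarrow> complex"
  assumes U: "open U" and F: "\<And>n. holo_on (F n) U" and bd: "\<And>n z. z \<in> U \<Longrightarrow> cmod (F n z) \<le> 1"
  shows "\<exists>r f. strict_mono r \<and> holo_on f U \<and> (\<forall>z\<in>U. (\<lambda>n. F (r n) z) \<longlonglongrightarrow> f z)"
proof -
  obtain Q :: "(complex ^ 'n) set" where Q: "countable Q" "\<And>S. open S \<Longrightarrow> S \<noteq> {} \<Longrightarrow> \<exists>q\<in>Q. q \<in> S"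
    using countable_dense_exists by metis
  have "Q \<noteq> {}" using Q(2)[of UNIV] by auto
  define q where "q = from_nat_into Q"
  have q: "range q = Q" unfolding q_def using Q(1) \<open>Q \<noteq> {}\<close> by (simp add: range_from_nat_into)
  define x where "x n = (\<lambda>i. if q i \<in> U then F n (q i) else 0)" for n
  have "seq_compact (PiE UNIV (\<lambda>i::nat. cball (0::complex) 1))"
    by (intro compact_imp_seq_compact compact_PiE_UNIV compact_cball)
  moreover have "\<forall>n. x n \<in> PiE UNIV (\<lambda>i::nat. cball (0::complex) 1)"
    using bd by (auto simp: x_def)
  ultimately obtain l r where r: "strict_mono r" and l: "(x \<circ> r) \<longlonglongrightarrow> l"
    unfolding seq_compact_def by metis
  have xi: "(\<lambda>n. x (r n) i) \<longlonglongrightarrow> l i" for i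
  proof -
    have "isCont (\<lambda>y :: nat \<Rightarrow> complex. y i) l"
      by (metis continuous_on_eq_continuous_at open_UNIV UNIV_I continuous_on_product_coordinates)
    from isCont_tendsto_compose [OF this l] show ?thesis by (simp add: o_def)
  qed
  have conv: "convergent (\<lambda>n. F (r n) z)" if z: "z \<in> U" for z
  proof (rule convergent_approx)
    fix \<epsilon> :: real assume \<epsilon>: "\<epsilon> > 0"
    obtain R where R: "R > 0" "ball z R \<subseteq> U" using U z open_contains_ball by blast
    \<comment> \<open>The first bound is the range of \<open>holo_estimates\<close>; the second
      makes \<open>2 / R\<close> times the distance at most \<epsilon>.\<close>
    define \<delta> where "\<delta> = min (R / 2) (\<epsilon> * R / 2)"
    have \<delta>: "\<delta> > 0" using R \<epsilon> by (simp add: \<delta>_def)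
    obtain y where "y \<in> Q" "y \<in> ball z \<delta>" using Q(2)[of "ball z \<delta>"] \<delta> by auto
    then obtain i where i: "q i \<in> ball z \<delta>" using q by auto
    define h where "h = q i - z"
    have h: "norm h < \<delta>" "q i = z + h" using i by (auto simp: h_def dist_norm norm_minus_commute)
    have qU: "q i \<in> U" using i R \<delta>_def by (auto simp: subset_iff)
    have "cmod (F (r n) z - x (r n) i) \<le> \<epsilon>" for n
    proof -
      have "cmod (F (r n) (z + h) - F (r n) z) \<le> 2 * 1 / R * norm h"
        by (rule holo_estimates(1) [OF F R]) (use bd R h in \<open>auto simp: \<delta>_def\<close>)
      also have "\<dots> \<le> 2 / R * (\<epsilon> * R / 2)"
        using h R by (intro mult_mono) (auto simp: \<delta>_def)
      finally show ?thesis using R qU by (simp add: x_def h(2) norm_minus_commute)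
    qed
    then show "\<exists>a. convergent a \<and> (\<forall>n. cmod (F (r n) z - a n) \<le> \<epsilon>)"
      using xi[of i] by (intro exI[of _ "\<lambda>n. x (r n) i"]) (auto simp: convergent_def)
  qed
  define f where "f z = lim (\<lambda>n. F (r n) z)" for z
  have f: "(\<lambda>n. F (r n) z) \<longlonglongrightarrow> f z" if "z \<in> U" for z
    using conv [OF that] unfolding f_def by (simp add: convergent_LIMSEQ_iff)
  have "holo_on f U"
  proof (rule holo_on_bounded_limit [of "\<lambda>n. F (r n)"])
    fix z assume "z \<in> U"
    then obtain R where "R > 0" "ball z R \<subseteq> U" using U open_contains_ball by blast
    then show "\<exists>R>0. \<exists>C>0. ball z R \<subseteq> U \<and> (\<forall>n. \<forall>w\<in>ball z R. cmod (F (r n) w) \<le> C)"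
      using bd by (intro exI[of _ R] conjI exI[of _ 1]) auto
  qed (use F f in auto)
  then show ?thesis using r f by blast
qed

text \<open>The points near which \<open>f\<close> vanishes form an open set. One-variable
  continuation along complex lines makes \<open>f\<close> vanish on every ball in \<open>W\<close>
  that meets it, so its complement in \<open>W\<close> is open too.\<close>

lemma holo_identity:
  fixes f :: "complex ^ 'n \<Rightarrow> complex"
  assumes f: "holo_on f W" and W: "open W" "connected W"
    and U: "open U" "U \<noteq> {}" "U \<subseteq> W" "\<And>z. z \<in> U \<Longrightarrow> f z = 0" and "w \<in> W"
  shows "f w = 0"
proof -
  define S where "S = {z \<in> W. \<exists>e>0. \<forall>w\<in>ball z e. f w = 0}"
  have ext: "f w = 0" if zR: "ball z R \<subseteq> W" and aS: "a \<in> S" and aw: "a \<in> ball z R" "w \<in> ball z R" for z R a w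
  proof -
    \<comment> \<open>The parameters for which the line through \<open>a\<close> and
      \<open>w\<close> stays in the ball: a convex, hence connected, set that contains 0 and
      1.\<close>
    define A where "A = (\<lambda>\<zeta>. a + \<zeta> *s (w - a)) -` ball z R"
    have cont: "continuous_on UNIV (\<lambda>\<zeta>. a + \<zeta> *s (w - a))"
      by (intro continuous_intros bounded_linear.continuous_on [OF bounded_linear_vec_scale])
    have "open A" unfolding A_def using cont by (intro open_vimage) auto
    have "convex A"
    proof (rule convexI)
      fix x y :: complex and u v :: real
      assume *: "x \<in> A" "y \<in> A" "0 \<le> u" "0 \<le> v" "u + v = 1"
      then have "u *\<^sub>R (a + x *s (w - a)) + v *\<^sub>R (a + y *s (w - a)) \<in> ball z R"
        by (intro convexD [OF convex_ball]) (auto simp: A_def)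
      also have "u *\<^sub>R (a + x *s (w - a)) + v *\<^sub>R (a + y *s (w - a)) = (u + v) *\<^sub>R a + (u *\<^sub>R x + v *\<^sub>R y) *s (w - a)"
        by (simp add: vec_eq_iff scaleR_conv_of_real [where 'a = complex] algebra_simps)
      finally show "u *\<^sub>R x + v *\<^sub>R y \<in> A" using * by (simp add: A_def)
    qed
    obtain e where e: "e > 0" "\<And>w. w \<in> ball a e \<Longrightarrow> f w = 0" using aS unfolding S_def by blast
    define B where "B = A \<inter> (\<lambda>\<zeta>. a + \<zeta> *s (w - a)) -` ball a e"
    have "open B" unfolding B_def using cont \<open>open A\<close> by (intro open_Int open_vimage) auto
    have 0: "0 \<in> B" and 1: "1 \<in> A" using aw e by (auto simp: A_def B_def)
    have "(\<lambda>\<zeta>. f (a + \<zeta> *s (w - a))) 1 = (\<lambda>_. 0) 1"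
    proof (rule analytic_continuation_open [where s = B and s' = A and g = "\<lambda>_. 0"
          and f = "\<lambda>\<zeta>. f (a + \<zeta> *s (w - a))"])
      show "(\<lambda>\<zeta>. f (a + \<zeta> *s (w - a))) holomorphic_on A"
        using zR by (intro holo_slice [OF f] \<open>open A\<close>) (auto simp: A_def)
      show "connected A" using \<open>convex A\<close> by (rule convex_connected)
      show "f (a + \<zeta> *s (w - a)) = 0" if "\<zeta> \<in> B" for \<zeta> using that e by (auto simp: B_def)
    qed (use 0 1 \<open>open A\<close> \<open>open B\<close> in \<open>auto simp: B_def\<close>)
    then show ?thesis by simp
  qed
  have "open S"
    unfolding open_contains_ball
  proof
    fix z assume "z \<in> S"
    then obtain e where e: "e > 0" "\<And>w. w \<in> ball z e \<Longrightarrow> f w = 0" and "z \<in> W" unfolding S_def by blast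
    obtain d where d: "d > 0" "ball z d \<subseteq> W" using W \<open>z \<in> W\<close> open_contains_ball by blast
    have "y \<in> S" if y: "y \<in> ball z (min d e)" for y
    proof -
      have "f w = 0" if "w \<in> ball y (e - dist z y)" for w
        using that dist_triangle[of z w y] by (intro e(2)) simp
      moreover have "e - dist z y > 0" "y \<in> W" using y d by auto
      ultimately show ?thesis unfolding S_def by blast
    qed
    then show "\<exists>e>0. ball z e \<subseteq> S" using d e by (intro exI[of _ "min d e"]) auto
  qed
  have "open (W - S)"
    unfolding open_contains_ball
  proof
    fix z assume z: "z \<in> W - S"
    then obtain R where R: "R > 0" "ball z R \<subseteq> W" using W open_contains_ball by blast
    have "a \<notin> S" if "a \<in> ball z R" for a
    proof
      assume "a \<in> S"
      then have "\<forall>w\<in>ball z R. f w = 0" using ext [OF R(2) _ that] by blast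
      then show False using R(1) z unfolding S_def by blast
    qed
    then show "\<exists>e>0. ball z e \<subseteq> W - S" using R by blast
  qed
  obtain u where u: "u \<in> U" using U by blast
  then obtain e where "e > 0" "ball u e \<subseteq> U" using U open_contains_ball by blast
  then have "u \<in> S" using u U(3,4) unfolding S_def by blast
  have "S \<inter> W = {} \<or> (W - S) \<inter> W = {}"
    by (rule connectedD [OF W(2) \<open>open S\<close> \<open>open (W - S)\<close>]) blast+
  then have "W - S = {}" using \<open>u \<in> S\<close> u U(3) by blast
  then have "w \<in> S" using \<open>w \<in> W\<close> by blast
  then obtain e where "e > 0" "\<forall>w\<in>ball w e. f w = 0" unfolding S_def by blast
  then show ?thesis by simp
qed

text \<open>The coefficients are conjugated so that the real part is the real inner product of
  separating hyperplanes.\<close>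

definition cform :: "complex ^ 'n \<Rightarrow> complex ^ 'n \<Rightarrow> complex" where
  "cform a z = (\<Sum>i\<in>UNIV. cnj (a $ i) * z $ i)"

lemma Re_cform: "Re (cform a z) = a \<bullet> z"
  by (simp add: cform_def inner_vec_def inner_complex_def)

lemma cform_scale: "cform a (c *s z) = c * cform a z"
  by (simp add: cform_def sum_distrib_left mult.left_commute)

lemma cform_add: "cform a (z + w) = cform a z + cform a w"
  by (simp add: cform_def sum.distrib algebra_simps)

lemma holo_on_cform: "holo_on (cform a) U"
  unfolding cform_def by (intro holo_on_sum holo_on_cmult holo_on_coord)

lemma open_convex_separation:
  fixes S :: "(complex ^ 'n) set"
  assumes "open S" "convex S" "p \<notin> S"
  shows "\<exists>a. \<forall>z\<in>S. Re (cform a z) < Re (cform a p)"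
proof (cases "S = {}")
  case False
  then obtain a b where a: "a \<noteq> 0" "\<And>z. z \<in> S \<Longrightarrow> a \<bullet> z \<le> b" "b \<le> a \<bullet> p"
    using separating_hyperplane_sets[of S "{p}"] assms by auto
  have "a \<bullet> z < b" if z: "z \<in> S" for z
  proof -
    obtain e where e: "e > 0" "ball z e \<subseteq> S" using assms(1) z open_contains_ball by blast
    \<comment> \<open>Openness makes the separation strict: a small step along \<open>a\<close>
      stays in \<open>S\<close> and raises the form.\<close>
    define t where "t = e / (2 * norm a)"
    have t: "t > 0" using e a by (simp add: t_def)
    have "z + t *\<^sub>R a \<in> ball z e" using e a by (simp add: dist_norm t_def)
    then have "a \<bullet> (z + t *\<^sub>R a) \<le> b" using e a(2) by blast
    moreover have "t * (a \<bullet> a) > 0" using t a by simp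
    ultimately show ?thesis by (simp add: inner_add_right)
  qed
  then have "\<forall>z\<in>S. a \<bullet> z < a \<bullet> p" using a(3) by (meson less_le_trans)
  then show ?thesis unfolding Re_cform by (rule exI[of _ a])
qed auto

text \<open>The reciprocal of a separating form minus its value at \<open>p\<close> cannot be
  continued to \<open>p\<close>: its product with that difference is 1 on \<open>U\<close>, hence on
  \<open>W\<close> by the identity theorem, but 0 at \<open>p\<close>.\<close>

lemma domain_of_holomorphy_convex:
  assumes "open \<Omega>" "convex \<Omega>" "\<Omega> \<noteq> {}"
  shows "domain_of_holomorphy \<Omega>"
  unfolding domain_of_holomorphy_def
proof (intro conjI notI)
  show "connected \<Omega>" using assms(2) by (rule convex_connected)
  assume "\<exists>U W. open U \<and> U \<noteq> {} \<and> U \<subseteq> \<Omega> \<inter> W \<and> open W \<and> connected W \<and> \<not> W \<subseteq> \<Omega> \<and>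
          (\<forall>f. holo_on f \<Omega> \<longrightarrow> (\<exists>g. holo_on g W \<and> (\<forall>z\<in>U. g z = f z)))"
  then obtain U W where UW: "open U" "U \<noteq> {}" "U \<subseteq> \<Omega> \<inter> W" "open W" "connected W" "\<not> W \<subseteq> \<Omega>"
    and ext: "\<And>f. holo_on f \<Omega> \<Longrightarrow> \<exists>g. holo_on g W \<and> (\<forall>z\<in>U. g z = f z)" by blast
  obtain p where p: "p \<in> W" "p \<notin> \<Omega>" using UW(6) by blast
  obtain a where a: "\<And>z. z \<in> \<Omega> \<Longrightarrow> Re (cform a z) < Re (cform a p)"
    using open_convex_separation [OF assms(1,2) p(2)] by blast
  have nz: "cform a z - cform a p \<noteq> 0" if "z \<in> \<Omega>" for z using a [OF that] by auto
  have lin: "holo_on (\<lambda>z. cform a z - cform a p) X" for X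
    by (intro holo_on_diff holo_on_cform holo_on_const)
  obtain g where g: "holo_on g W" "\<And>z. z \<in> U \<Longrightarrow> g z = inverse (cform a z - cform a p)"
    using ext [OF holo_on_inverse [OF lin nz]] by blast
  have "g p * (cform a p - cform a p) - 1 = 0"
  proof (rule holo_identity [of "\<lambda>z. g z * (cform a z - cform a p) - 1"])
    show "holo_on (\<lambda>z. g z * (cform a z - cform a p) - 1) W"
      by (intro holo_on_diff holo_on_mult g lin holo_on_const)
    show "g z * (cform a z - cform a p) - 1 = 0" if "z \<in> U" for z
      using g(2) [OF that] nz[of z] that UW(3) by auto
  qed (use UW p in auto)
  then show False by simp
qed (use assms in auto)

section \<open>Geometry of \<open>calG\<close>\<close>

text \<open>The Hermitian form with unit diagonal and off-diagonal entry \<beta>, the free entry of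
  the completion problem behind \<open>calG\<close>.\<close>

definition hform :: "complex \<Rightarrow> complex \<Rightarrow> complex \<Rightarrow> real" where
  "hform \<beta> y w = (cmod y)\<^sup>2 + (cmod w)\<^sup>2 + 2 * Re (\<beta> * y * cnj w)"

text \<open>The difference of the two sides is a Hermitian form with diagonal \<open>A\<close>,
  \<open>C\<close> and off-diagonal entry \<open>\<delta>\<close>; it is positive definite iff the
  diagonal and the determinant are positive. For given \<open>a\<close> and \<open>c\<close> this
  confines \<beta> to an open disc.\<close>

lemma row_form_iff:
  "(\<forall>y w. (y, w) \<noteq> (0, 0) \<longrightarrow> (cmod (a * y + c * w))\<^sup>2 < hform \<beta> y w) \<longleftrightarrow>
    cmod a < 1 \<and> cmod c < 1 \<and> (cmod (\<beta> - a * cnj c))\<^sup>2 < (1 - (cmod a)\<^sup>2) * (1 - (cmod c)\<^sup>2)"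
    (is "?L \<longleftrightarrow> ?R")
proof -
  define A C \<delta> where "A = 1 - (cmod a)\<^sup>2" and "C = 1 - (cmod c)\<^sup>2" and "\<delta> = \<beta> - a * cnj c"
  have diff: "hform \<beta> y w - (cmod (a * y + c * w))\<^sup>2 = A * (cmod y)\<^sup>2 + C * (cmod w)\<^sup>2 + 2 * Re (\<delta> * y * cnj w)"
    for y w
    unfolding hform_def A_def C_def \<delta>_def
    by (simp add: cmod_power2) (simp add: power2_eq_square algebra_simps)
  have square: "A * (A * (cmod y)\<^sup>2 + C * (cmod w)\<^sup>2 + 2 * Re (\<delta> * y * cnj w))
      = (cmod (of_real A * y + cnj \<delta> * w))\<^sup>2 + (A * C - (cmod \<delta>)\<^sup>2) * (cmod w)\<^sup>2" for y w
    by (simp add: cmod_power2) (simp add: power2_eq_square algebra_simps)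
  have lt: "cmod x < 1 \<longleftrightarrow> 0 < 1 - (cmod x)\<^sup>2" for x
    by (simp add: abs_square_less_1)
  show ?thesis
  proof
    assume L: ?L
    have pos: "0 < A * (cmod y)\<^sup>2 + C * (cmod w)\<^sup>2 + 2 * Re (\<delta> * y * cnj w)" if "(y, w) \<noteq> (0, 0)" for y w
    proof -
      have "(cmod (a * y + c * w))\<^sup>2 < hform \<beta> y w" using L that by blast
      then show ?thesis using diff[of y w] by linarith
    qed
    have A: "A > 0" using pos[of 1 0] by simp
    have C: "C > 0" using pos[of 0 1] by simp
    \<comment> \<open>This test vector annihilates the completed square, so that only the
      determinant remains.\<close>
    have "of_real A * (- cnj \<delta>) + cnj \<delta> * of_real A = 0" by simp
    then have "0 < A * (A * (cmod (- cnj \<delta>))\<^sup>2 + C * (cmod (of_real A))\<^sup>2 + 2 * Re (\<delta> * (- cnj \<delta>) * cnj (of_real A)))"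
      using A by (intro mult_pos_pos pos) auto
    then have "0 < (A * C - (cmod \<delta>)\<^sup>2) * (cmod (of_real A))\<^sup>2"
      unfolding square by simp
    then show ?R using A C lt
      by (simp add: zero_less_mult_iff) (simp add: A_def C_def \<delta>_def)
  next
    assume R: ?R
    then have A: "A > 0" and C: "C > 0" and D: "A * C - (cmod \<delta>)\<^sup>2 > 0"
      using lt by (simp_all add: A_def C_def \<delta>_def)
    show ?L
    proof (intro allI impI)
      fix y w :: complex assume yw: "(y, w) \<noteq> (0, 0)"
      have "0 < A * (A * (cmod y)\<^sup>2 + C * (cmod w)\<^sup>2 + 2 * Re (\<delta> * y * cnj w))"
      proof (cases "w = 0")
        case True
        then show ?thesis using yw A by simp
      next
        case False
        then show ?thesis unfolding square using D by (intro add_nonneg_pos mult_pos_pos) auto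
      qed
      then show "(cmod (a * y + c * w))\<^sup>2 < hform \<beta> y w"
        using A diff[of y w] by (simp add: zero_less_mult_iff)
    qed
  qed
qed

lemma discs_meet_iff:
  fixes p q :: complex
  assumes "r > 0" "s > 0"
  shows "(\<exists>\<beta>. cmod (\<beta> - p) < r \<and> cmod (\<beta> - q) < s) \<longleftrightarrow> cmod (p - q) < r + s"
proof
  assume "\<exists>\<beta>. cmod (\<beta> - p) < r \<and> cmod (\<beta> - q) < s"
  then obtain \<beta> where "cmod (\<beta> - p) < r" "cmod (\<beta> - q) < s" by blast
  then show "cmod (p - q) < r + s"
    using norm_triangle_ineq[of "p - \<beta>" "\<beta> - q"] by (simp add: norm_minus_commute[of p \<beta>])
next
  assume pq: "cmod (p - q) < r + s"
  \<comment> \<open>The point that divides the segment from \<open>p\<close> to \<open>q\<close> in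
    the ratio \<open>r : s\<close>.\<close>
  define \<beta> where "\<beta> = p + of_real (r / (r + s)) * (q - p)"
  have rs: "complex_of_real r + complex_of_real s \<noteq> 0"
    using assms by (simp flip: of_real_add)
  have "\<beta> - p = of_real (r / (r + s)) * (q - p)" by (simp add: \<beta>_def)
  then have "cmod (\<beta> - p) = r / (r + s) * cmod (p - q)"
    using assms by (simp add: norm_mult norm_minus_commute norm_divide del: of_real_add flip: of_real_add)
  moreover have "\<beta> - q = of_real (s / (r + s)) * (p - q)"
    using rs by (simp add: \<beta>_def field_simps)
  then have "cmod (\<beta> - q) = s / (r + s) * cmod (p - q)"
    using assms by (simp add: norm_mult norm_divide del: of_real_add flip: of_real_add)
  moreover have "r / (r + s) * cmod (p - q) < r" "s / (r + s) * cmod (p - q) < s"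
    using assms mult_strict_left_mono [OF pq assms(1)] mult_strict_left_mono [OF pq assms(2)]
    by (simp_all add: field_simps)
  ultimately show "\<exists>\<beta>. cmod (\<beta> - p) < r \<and> cmod (\<beta> - q) < s"
    by (intro exI[of _ \<beta>]) simp
qed

lemma tridisc_iff: "z \<in> tridisc \<longleftrightarrow> cmod (z $ 1) < 1 \<and> cmod (z $ 2) < 1 \<and> cmod (z $ 3) < 1"
  by (auto simp: tridisc_def forall_3)

text \<open>With \<open>x\<close>, \<open>y\<close>, \<open>w\<close> the square roots of 1 - |a|^2,
  1 - |b|^2, 1 - |c|^2, the discs have radii \<open>w * x\<close> and \<open>w * y\<close>. They
  meet iff their centres are closer than \<open>w * x + w * y\<close>. Squared, each side of this
  inequality differs from the matching side of the one defining \<open>calG\<close> by the same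
  quantity (\<open>id1\<close>, \<open>id2\<close>).\<close>

lemma calG_iff_discs:
  "z \<in> calG \<longleftrightarrow> z \<in> tridisc \<and> (\<exists>\<beta>.
    (cmod (\<beta> - z $ 1 * cnj (z $ 3)))\<^sup>2 < (1 - (cmod (z $ 1))\<^sup>2) * (1 - (cmod (z $ 3))\<^sup>2) \<and>
    (cmod (\<beta> - z $ 3 * cnj (z $ 2)))\<^sup>2 < (1 - (cmod (z $ 3))\<^sup>2) * (1 - (cmod (z $ 2))\<^sup>2))"
proof (cases "z \<in> tridisc")
  case False
  then show ?thesis by (simp add: calG_def)
next
  case True
  define a b c where "a = z $ 1" and "b = z $ 2" and "c = z $ 3"
  have abc: "cmod a < 1" "cmod b < 1" "cmod c < 1"
    using True by (simp_all add: tridisc_iff a_def b_def c_def)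
  define x y w where "x = sqrt (1 - (cmod a)\<^sup>2)" and "y = sqrt (1 - (cmod b)\<^sup>2)" and "w = sqrt (1 - (cmod c)\<^sup>2)"
  have pos: "0 < 1 - (cmod a)\<^sup>2" "0 < 1 - (cmod b)\<^sup>2" "0 < 1 - (cmod c)\<^sup>2"
    using abc by (simp_all add: abs_square_less_1)
  then have xyw: "x > 0" "y > 0" "w > 0" by (simp_all add: x_def y_def w_def)
  have sq: "x\<^sup>2 = 1 - (cmod a)\<^sup>2" "y\<^sup>2 = 1 - (cmod b)\<^sup>2" "w\<^sup>2 = 1 - (cmod c)\<^sup>2"
    using pos by (simp_all add: x_def y_def w_def)
  have id1: "(cmod (a * cnj c - c * cnj b))\<^sup>2 = (cmod (a * b - c\<^sup>2))\<^sup>2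
      + (cmod c)\<^sup>2 * ((cmod a)\<^sup>2 + (cmod b)\<^sup>2) - (cmod a)\<^sup>2 * (cmod b)\<^sup>2 - ((cmod c)\<^sup>2)\<^sup>2"
    by (simp add: cmod_power2 power2_eq_square[of c]) (simp add: power2_eq_square algebra_simps)
  have id2: "(w * x + w * y)\<^sup>2 = (w\<^sup>2 + x * y)\<^sup>2
      + (cmod c)\<^sup>2 * ((cmod a)\<^sup>2 + (cmod b)\<^sup>2) - (cmod a)\<^sup>2 * (cmod b)\<^sup>2 - ((cmod c)\<^sup>2)\<^sup>2"
  proof -
    have "(cmod a)\<^sup>2 = 1 - x\<^sup>2" "(cmod b)\<^sup>2 = 1 - y\<^sup>2" "(cmod c)\<^sup>2 = 1 - w\<^sup>2" using sq by simp_all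
    then show ?thesis by (simp only:) (simp add: power2_eq_square algebra_simps)
  qed
  have lt: "u < v \<longleftrightarrow> u\<^sup>2 < v\<^sup>2" if "0 \<le> u" "0 < v" for u v :: real
    using that by (meson less_imp_le power_less_imp_less_base power_strict_mono zero_less_numeral)
  have "z \<in> calG \<longleftrightarrow> cmod (a * b - c\<^sup>2) < w\<^sup>2 + x * y"
    using True by (simp add: calG_def sq(3)) (simp add: a_def b_def c_def x_def y_def)
  also have "\<dots> \<longleftrightarrow> (cmod (a * b - c\<^sup>2))\<^sup>2 < (w\<^sup>2 + x * y)\<^sup>2"
    using xyw by (intro lt add_pos_pos mult_pos_pos) simp_all
  also have "\<dots> \<longleftrightarrow> (cmod (a * cnj c - c * cnj b))\<^sup>2 < (w * x + w * y)\<^sup>2"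
    using id1 id2 by linarith
  also have "\<dots> \<longleftrightarrow> cmod (a * cnj c - c * cnj b) < w * x + w * y"
    using xyw by (intro lt [symmetric] add_pos_pos mult_pos_pos) simp_all
  also have "\<dots> \<longleftrightarrow> (\<exists>\<beta>. cmod (\<beta> - a * cnj c) < w * x \<and> cmod (\<beta> - c * cnj b) < w * y)"
    using xyw by (intro discs_meet_iff [symmetric] mult_pos_pos)
  also have "\<dots> \<longleftrightarrow> (\<exists>\<beta>. (cmod (\<beta> - a * cnj c))\<^sup>2 < (w * x)\<^sup>2 \<and> (cmod (\<beta> - c * cnj b))\<^sup>2 < (w * y)\<^sup>2)"
  proof -
    have "cmod u < w * x \<longleftrightarrow> (cmod u)\<^sup>2 < (w * x)\<^sup>2" "cmod u < w * y \<longleftrightarrow> (cmod u)\<^sup>2 < (w * y)\<^sup>2" for u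
      using xyw by (intro lt mult_pos_pos; simp)+
    then show ?thesis by simp
  qed
  finally show ?thesis
    using True by (simp add: power_mult_distrib sq mult.commute[of "1 - (cmod c)\<^sup>2" "1 - (cmod a)\<^sup>2"])
      (simp add: a_def b_def c_def)
qed

text \<open>The left sides are convex in \<open>z\<close> and shrink under scaling, and the right
  side is affine in \<beta>. This makes convexity and balancedness of \<open>calG\<close>
  accessible.\<close>

lemma calG_iff_forms:
  "z \<in> calG \<longleftrightarrow> (\<exists>\<beta>. \<forall>y w. (y, w) \<noteq> (0, 0) \<longrightarrow>
    (cmod (z $ 1 * y + z $ 3 * w))\<^sup>2 < hform \<beta> y w \<and> (cmod (z $ 3 * y + z $ 2 * w))\<^sup>2 < hform \<beta> y w)"
proof -
  have "z \<in> calG \<longleftrightarrow> (\<exists>\<beta>. (\<forall>y w. (y, w) \<noteq> (0, 0) \<longrightarrow> (cmod (z $ 1 * y + z $ 3 * w))\<^sup>2 < hform \<beta> y w) \<and>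
    (\<forall>y w. (y, w) \<noteq> (0, 0) \<longrightarrow> (cmod (z $ 3 * y + z $ 2 * w))\<^sup>2 < hform \<beta> y w))"
    unfolding row_form_iff calG_iff_discs tridisc_iff by blast
  then show ?thesis by (metis (no_types, lifting))
qed

lemma cmod_convex_combination:
  fixes x y :: complex
  assumes "0 \<le> u" "0 \<le> v" "u + v = 1"
  shows "(cmod (of_real u * x + of_real v * y))\<^sup>2 \<le> u * (cmod x)\<^sup>2 + v * (cmod y)\<^sup>2"
proof -
  have "cmod (of_real u * x + of_real v * y) \<le> u * cmod x + v * cmod y"
    using norm_triangle_ineq[of "of_real u * x" "of_real v * y"] assms by (simp add: norm_mult)
  then have "(cmod (of_real u * x + of_real v * y))\<^sup>2 \<le> (u * cmod x + v * cmod y)\<^sup>2"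
    by (rule power_mono) simp
  also have "\<dots> = u * (cmod x)\<^sup>2 + v * (cmod y)\<^sup>2 - u * v * (cmod x - cmod y)\<^sup>2"
  proof -
    have v: "v = 1 - u" using assms by simp
    show ?thesis unfolding v by (simp add: power2_eq_square algebra_simps)
  qed
  also have "\<dots> \<le> u * (cmod x)\<^sup>2 + v * (cmod y)\<^sup>2" using assms by simp
  finally show ?thesis .
qed

lemma convex_calG: "convex calG"
proof (rule convexI)
  fix z z' :: "complex ^ 3" and u v :: real
  assume z: "z \<in> calG" "z' \<in> calG" and uv: "0 \<le> u" "0 \<le> v" "u + v = 1"
  obtain \<beta> where \<beta>: "\<And>y w. (y, w) \<noteq> (0, 0) \<Longrightarrow> (cmod (z $ 1 * y + z $ 3 * w))\<^sup>2 < hform \<beta> y w"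
      "\<And>y w. (y, w) \<noteq> (0, 0) \<Longrightarrow> (cmod (z $ 3 * y + z $ 2 * w))\<^sup>2 < hform \<beta> y w"
    using z(1) unfolding calG_iff_forms by blast
  obtain \<beta>' where \<beta>': "\<And>y w. (y, w) \<noteq> (0, 0) \<Longrightarrow> (cmod (z' $ 1 * y + z' $ 3 * w))\<^sup>2 < hform \<beta>' y w"
      "\<And>y w. (y, w) \<noteq> (0, 0) \<Longrightarrow> (cmod (z' $ 3 * y + z' $ 2 * w))\<^sup>2 < hform \<beta>' y w"
    using z(2) unfolding calG_iff_forms by blast
  have hf: "hform (of_real u * \<beta> + of_real v * \<beta>') y w = u * hform \<beta> y w + v * hform \<beta>' y w" for y w
  proof -
    have v: "v = 1 - u" using uv by simp
    show ?thesis unfolding hform_def v by (simp add: algebra_simps)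
  qed
  have strict: "(cmod (of_real u * x + of_real v * x'))\<^sup>2 < u * s + v * s'"
    if "(cmod x)\<^sup>2 < s" "(cmod x')\<^sup>2 < s'" for x x' s s'
  proof -
    have "u * (cmod x)\<^sup>2 + v * (cmod x')\<^sup>2 < u * s + v * s'"
    proof (cases "u = 0")
      case True
      then show ?thesis using uv that by simp
    next
      case False
      then show ?thesis using uv that by (intro add_less_le_mono mult_strict_left_mono mult_left_mono) auto
    qed
    then show ?thesis using cmod_convex_combination [OF uv, of x x'] by linarith
  qed
  have comp: "(u *\<^sub>R z + v *\<^sub>R z') $ i = of_real u * z $ i + of_real v * z' $ i" for i
    by (simp add: scaleR_conv_of_real [where 'a = complex])
  have lin: "(of_real u * a + of_real v * a') * y + (of_real u * c + of_real v * c') * w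
     = of_real u * (a * y + c * w) + of_real v * (a' * y + c' * w)" for a a' c c' y w :: complex
    by (simp add: algebra_simps)
  show "u *\<^sub>R z + v *\<^sub>R z' \<in> calG"
    unfolding calG_iff_forms comp lin
    by (intro exI[of _ "of_real u * \<beta> + of_real v * \<beta>'"] allI impI conjI; unfold hf)
      (intro strict \<beta> \<beta>'; assumption)+
qed

lemma open_calG: "open calG"
proof -
  have "calG = {z. cmod (z $ 1) < 1} \<inter> {z. cmod (z $ 2) < 1} \<inter> {z. cmod (z $ 3) < 1} \<inter>
     {z. cmod (z $ 1 * z $ 2 - (z $ 3)\<^sup>2) <
       (1 - (cmod (z $ 3))\<^sup>2) + sqrt (1 - (cmod (z $ 1))\<^sup>2) * sqrt (1 - (cmod (z $ 2))\<^sup>2)}"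
    by (auto simp: calG_def tridisc_iff)
  also have "open \<dots>"
    by (intro open_Int open_Collect_less continuous_intros)
  finally show ?thesis .
qed

lemma balanced_calG: "balanced calG"
  unfolding balanced_def
proof (intro ballI allI impI)
  fix z :: "complex ^ 3" and \<zeta> :: complex assume z: "z \<in> calG" and \<zeta>: "cmod \<zeta> \<le> 1"
  have le: "(cmod (\<zeta> * x))\<^sup>2 \<le> (cmod x)\<^sup>2" for x
    using \<zeta> by (simp add: norm_mult power_mult_distrib mult_left_le_one_le power_le_one)
  have comp: "(\<zeta> *s z) $ i * y + (\<zeta> *s z) $ j * w = \<zeta> * (z $ i * y + z $ j * w)" for i j y w
    by (simp add: algebra_simps)
  show "\<zeta> *s z \<in> calG"
    using z unfolding calG_iff_forms comp using le le_less_trans by meson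
qed

lemma zero_in_calV: "0 \<in> calV"
  by (simp add: calV_def tridisc_iff)

lemma calV_subset_calG: "calV \<subseteq> calG"
proof
  fix z assume z: "z \<in> calV"
  then have "cmod (z $ 1) < 1" "cmod (z $ 2) < 1" "cmod (z $ 3) < 1"
    by (simp_all add: calV_def tridisc_iff)
  then have "0 < 1 - (cmod (z $ 3))\<^sup>2" "0 \<le> sqrt (1 - (cmod (z $ 1))\<^sup>2) * sqrt (1 - (cmod (z $ 2))\<^sup>2)"
    by (auto simp: abs_square_less_1 abs_square_le_1 less_imp_le)
  then show "z \<in> calG" using z by (simp add: calV_def calG_def)
qed

lemma balanced_calV: "balanced calV"
  unfolding balanced_def
proof (intro ballI allI impI)
  fix z :: "complex ^ 3" and \<zeta> :: complex assume z: "z \<in> calV" and \<zeta>: "cmod \<zeta> \<le> 1"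
  have "cmod (\<zeta> * x) < 1" if "cmod x < 1" for x
    using \<zeta> that mult_left_le_one_le[of "cmod x" "cmod \<zeta>"] by (simp add: norm_mult)
  then show "\<zeta> *s z \<in> calV"
    using z by (simp add: calV_def tridisc_iff power_mult_distrib) (simp add: power2_eq_square)
qed

text \<open>Since \<open>calG\<close> lies in the polydisc, \<open>calV\<close> is the zero set in
  \<open>G\<close> of a single function.\<close>

lemma Cartan_pair_calV:
  assumes "domain_of_holomorphy G" "calV \<subseteq> G" "G \<subseteq> calG"
  shows "Cartan_pair G calV"
proof -
  have G: "open G" using assms(1) by (simp add: domain_of_holomorphy_def)
  have eq: "calV = G \<inter> {z. (z $ 3)\<^sup>2 - z $ 1 * z $ 2 = 0}"
    using assms(2,3) by (auto simp: calV_def calG_def)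
  have "closed {z :: complex ^ 3. (z $ 3)\<^sup>2 - z $ 1 * z $ 2 = 0}"
    by (intro closed_Collect_eq continuous_intros)
  then have "closedin (top_of_set G) calV"
    unfolding eq by (rule closedin_closed_Int)
  moreover have "holo_on (\<lambda>z. (z $ 3)\<^sup>2 - z $ 1 * z $ 2) G"
    unfolding power2_eq_square by (intro holo_on_diff holo_on_mult holo_on_coord)
  then have "\<exists>U \<F>. open U \<and> p \<in> U \<and> U \<subseteq> G \<and> finite \<F> \<and> (\<forall>f\<in>\<F>. holo_on f U) \<and>
        calV \<inter> U = {z \<in> U. \<forall>f\<in>\<F>. f z = 0}" if "p \<in> calV" for p
    using that assms(2) G
    by (intro exI[of _ G] exI[of _ "{\<lambda>z. (z $ 3)\<^sup>2 - z $ 1 * z $ 2}"]) (auto simp: eq)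
  ultimately show ?thesis
    using assms(1) unfolding Cartan_pair_def analytic_set_in_def by blast
qed

section \<open>Schur factorization of the symmetric matrix of a point\<close>

definition symmat :: "complex ^ 3 \<Rightarrow> bool \<Rightarrow> bool \<Rightarrow> complex" where
  "symmat z b c = (if b = c then if b then z $ 1 else z $ 2 else z $ 3)"

text \<open>The vectors \<open>x\<close> are unit vectors in the plane whose inner product is given
  by \<beta>, and the equations for \<open>symmat\<close> then determine \<open>y\<close>. The bound
  on the length of \<open>y\<close> is the pair of disc conditions, rewritten by
  \<open>swap\<close>.\<close>

lemma calG_schur_factorization:
  assumes "z \<in> calG"
  shows "\<exists>x y :: bool \<Rightarrow> bool \<Rightarrow> complex. (\<forall>b c. symmat z b c = (\<Sum>k\<in>UNIV. x b k * y c k)) \<and>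
    (\<forall>b. (\<Sum>k\<in>UNIV. (cmod (x b k))\<^sup>2) \<le> 1) \<and> (\<forall>c. (\<Sum>k\<in>UNIV. (cmod (y c k))\<^sup>2) \<le> 1)"
proof -
  define a b c where "a = z $ 1" and "b = z $ 2" and "c = z $ 3"
  obtain \<beta> where \<beta>: "(cmod (\<beta> - a * cnj c))\<^sup>2 < (1 - (cmod a)\<^sup>2) * (1 - (cmod c)\<^sup>2)"
      "(cmod (\<beta> - c * cnj b))\<^sup>2 < (1 - (cmod c)\<^sup>2) * (1 - (cmod b)\<^sup>2)"
    and abc: "cmod a < 1" "cmod b < 1" "cmod c < 1"
    using assms unfolding calG_iff_discs tridisc_iff a_def b_def c_def by blast
  define \<alpha> where "\<alpha> = cnj \<beta>"
  \<comment> \<open>Both sides are the determinant of the Hermitian 3 by 3 matrix with unit diagonal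
    and off-diagonal entries \<open>p\<close>, \<open>q\<close>, \<beta>, up to conjugation.\<close>
  have swap: "(1 - (cmod p)\<^sup>2) * (1 - (cmod \<alpha>)\<^sup>2) - (cmod (q - \<alpha> * p))\<^sup>2
      = (1 - (cmod p)\<^sup>2) * (1 - (cmod q)\<^sup>2) - (cmod (\<beta> - p * cnj q))\<^sup>2" for p q
    unfolding \<alpha>_def by (simp add: cmod_power2) (simp add: power2_eq_square algebra_simps)
  have ca: "(cmod (c - \<alpha> * a))\<^sup>2 \<le> (1 - (cmod a)\<^sup>2) * (1 - (cmod \<alpha>)\<^sup>2)"
    and bc: "(cmod (b - \<alpha> * c))\<^sup>2 \<le> (1 - (cmod c)\<^sup>2) * (1 - (cmod \<alpha>)\<^sup>2)"
    and pos: "0 < (1 - (cmod a)\<^sup>2) * (1 - (cmod \<alpha>)\<^sup>2)"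
    using swap[of a c] swap[of c b] \<beta> zero_le_power2[of "cmod (c - \<alpha> * a)"] by linarith+
  have "0 < 1 - (cmod a)\<^sup>2" using abc by (simp add: abs_square_less_1)
  then have \<alpha>: "0 < 1 - (cmod \<alpha>)\<^sup>2" using pos by (simp add: zero_less_mult_iff)
  define \<nu> where "\<nu> = sqrt (1 - (cmod \<alpha>)\<^sup>2)"
  have \<nu>: "\<nu> > 0" "\<nu>\<^sup>2 = 1 - (cmod \<alpha>)\<^sup>2" using \<alpha> by (simp_all add: \<nu>_def)
  define x where "x i k = (if i then if k then 1 else 0 else if k then \<alpha> else of_real \<nu>)" for i k :: bool
  define y where "y j k = (if j then if k then a else (c - \<alpha> * a) / of_real \<nu>
      else if k then c else (b - \<alpha> * c) / of_real \<nu>)" for j k :: bool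
  have norm1: "(cmod p)\<^sup>2 + (cmod (q / of_real \<nu>))\<^sup>2 \<le> 1" if "(cmod q)\<^sup>2 \<le> (1 - (cmod p)\<^sup>2) * (1 - (cmod \<alpha>)\<^sup>2)" for p q
    using that \<alpha> by (simp add: norm_divide power_divide \<nu>(2) field_simps)
  have "symmat z i j = (\<Sum>k\<in>UNIV. x i k * y j k)" for i j
    using \<nu>(1) by (simp add: symmat_def x_def y_def UNIV_bool a_def b_def c_def)
  moreover have "(\<Sum>k\<in>UNIV. (cmod (x i k))\<^sup>2) \<le> 1" for i
    using \<nu> by (simp add: x_def UNIV_bool)
  moreover have "(\<Sum>k\<in>UNIV. (cmod (y j k))\<^sup>2) \<le> 1" for j
    using norm1 [OF ca] norm1 [OF bc] by (simp add: y_def UNIV_bool add.commute)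
  ultimately show ?thesis by blast
qed

text \<open>Openness leaves room for one dilation that serves all points near \<open>z\<close>, so
  the contraction constant \<open>r\<close> can be chosen locally uniformly.\<close>

lemma calG_scale:
  assumes "z \<in> calG"
  shows "\<exists>r R. 0 < r \<and> r < 1 \<and> R > 0 \<and> (\<forall>w\<in>ball z R. of_real (1 / r) *s w \<in> calG)"
proof -
  obtain e where e: "e > 0" "ball z e \<subseteq> calG" using open_calG assms open_contains_ball by blast
  define n where "n = norm z + 1"
  have n: "n > 0" "norm z \<le> n" by (simp_all add: n_def add_nonneg_pos)
  define \<delta> where "\<delta> = min 1 (e / (4 * n))"
  have \<delta>: "0 < \<delta>" "\<delta> \<le> 1" "\<delta> * norm z \<le> e / 4"
  proof -
    show "0 < \<delta>" "\<delta> \<le> 1" using e n by (simp_all add: \<delta>_def)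
    have "\<delta> * norm z \<le> e / (4 * n) * n"
      using e n by (intro mult_mono) (auto simp: \<delta>_def)
    then show "\<delta> * norm z \<le> e / 4" using n by simp
  qed
  define r where "r = 1 / (1 + \<delta>)"
  have r: "0 < r" "r < 1" "1 / r = 1 + \<delta>" using \<delta> by (simp_all add: r_def)
  have "of_real (1 / r) *s w \<in> calG" if w: "w \<in> ball z (e / 4)" for w
  proof -
    have eq: "of_real (1 / r) *s w - z = of_real (1 + \<delta>) *s (w - z) + of_real \<delta> *s z"
      unfolding r(3) by (simp add: vec_eq_iff algebra_simps)
    have "norm (of_real (1 / r) *s w - z) \<le> norm (of_real (1 + \<delta>) *s (w - z)) + norm (of_real \<delta> *s z)"
      unfolding eq by (rule norm_triangle_ineq)
    also have "\<dots> = (1 + \<delta>) * norm (w - z) + \<delta> * norm z"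
      unfolding norm_vec_scale norm_of_real using \<delta> by simp
    also have "(1 + \<delta>) * norm (w - z) \<le> 2 * (e / 4)"
      using w \<delta> e by (intro mult_mono) (auto simp: dist_norm norm_minus_commute)
    finally have "of_real (1 / r) *s w \<in> ball z e"
      using \<delta>(3) e by (simp add: dist_norm norm_minus_commute)
    then show ?thesis using e by blast
  qed
  then show ?thesis using r e by (intro exI[of _ r] exI[of _ "e / 4"]) auto
qed

section \<open>Norm preserving extension\<close>

definition pt :: "complex \<times> complex \<Rightarrow> complex ^ 3" where
  "pt p = (fst p)\<^sup>2 *s axis 1 1 + (snd p)\<^sup>2 *s axis 2 1 + (fst p * snd p) *s axis 3 1"

lemma pt_nth [simp]: "pt p $ 1 = (fst p)\<^sup>2" "pt p $ 2 = (snd p)\<^sup>2" "pt p $ 3 = fst p * snd p"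
  by (simp_all add: pt_def axis_def)

lemma pt_uminus: "pt (- p) = pt p"
  by (simp add: vec_eq_iff forall_3)

lemma pt_in_calV: "cmod (fst p) < 1 \<Longrightarrow> cmod (snd p) < 1 \<Longrightarrow> pt p \<in> calV"
  using mult_strict_mono[of "cmod (fst p)" 1 "cmod (snd p)" 1]
  by (simp add: calV_def tridisc_iff norm_power norm_mult abs_square_less_1 power_mult_distrib)

lemma calV_eq_pt:
  assumes "z \<in> calV"
  obtains p where "z = pt p" "cmod (fst p) < 1" "cmod (snd p) < 1"
proof -
  have z: "cmod (z $ 1) < 1" "cmod (z $ 2) < 1" "(z $ 3)\<^sup>2 = z $ 1 * z $ 2"
    using assms by (auto simp: calV_def tridisc_iff)
  define s t where "s = csqrt (z $ 1)" and "t = csqrt (z $ 2)"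
  have st: "s\<^sup>2 = z $ 1" "t\<^sup>2 = z $ 2" by (simp_all add: s_def t_def)
  have "cmod s < 1" "cmod t < 1"
    using z st by (metis abs_norm_cancel abs_square_less_1 norm_power)+
  moreover have "(z $ 3)\<^sup>2 = (s * t)\<^sup>2" using z(3) st by (simp add: power_mult_distrib)
  \<comment> \<open>The sign of the product is absorbed into the second root.\<close>
  then have "z $ 3 = s * t \<or> z $ 3 = s * (- t)" by (simp add: power2_eq_iff)
  then have "z = pt (s, t) \<or> z = pt (s, - t)"
    using st by (auto simp: vec_eq_iff forall_3)
  ultimately show ?thesis using that by (metis fst_conv norm_minus_cancel snd_conv)
qed

lemma vec_scale_derivative:
  fixes v :: "complex ^ 'n"
  assumes "(g has_field_derivative g') (at \<zeta>)"
  shows "((\<lambda>\<zeta>. g \<zeta> *s v) has_derivative (\<lambda>h. h *s (g' *s v))) (at \<zeta>)"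
  using bounded_linear.has_derivative [OF bounded_linear_vec_scale [of v], of g "(*) g'" "at \<zeta>"] assms
  by (simp add: has_field_derivative_def mult.commute)

lemma pt_derivative:
  "((\<lambda>s. pt (s, t)) has_derivative (\<lambda>h. h *s ((2 * s) *s axis 1 1 + t *s axis 3 1))) (at s)"
  "((\<lambda>t. pt (s, t)) has_derivative (\<lambda>h. h *s ((2 * t) *s axis 2 1 + s *s axis 3 1))) (at t)"
proof -
  have 1: "((\<lambda>s. s\<^sup>2 *s axis 1 1 + t\<^sup>2 *s axis 2 1 + (s * t) *s (axis 3 1 :: complex ^ 3)) has_derivative
    (\<lambda>h. h *s ((2 * s) *s axis 1 1) + 0 + h *s (t *s axis 3 1))) (at s)"
    by (intro has_derivative_add has_derivative_const vec_scale_derivative)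
      (auto intro!: derivative_eq_intros)
  then show "((\<lambda>s. pt (s, t)) has_derivative (\<lambda>h. h *s ((2 * s) *s axis 1 1 + t *s axis 3 1))) (at s)"
    by (simp add: pt_def vector_add_ldistrib)
  have 2: "((\<lambda>t. s\<^sup>2 *s axis 1 1 + t\<^sup>2 *s axis 2 1 + (s * t) *s (axis 3 1 :: complex ^ 3)) has_derivative
    (\<lambda>h. 0 + h *s ((2 * t) *s axis 2 1) + h *s (s *s axis 3 1))) (at t)"
    by (intro has_derivative_add has_derivative_const vec_scale_derivative)
      (auto intro!: derivative_eq_intros)
  then show "((\<lambda>t. pt (s, t)) has_derivative (\<lambda>h. h *s ((2 * t) *s axis 2 1 + s *s axis 3 1))) (at t)"
    by (simp add: pt_def vector_add_ldistrib)
qed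

lemma continuous_on_pt: "continuous_on A pt"
  unfolding pt_def
  by (intro continuous_on_add bounded_linear.continuous_on [OF bounded_linear_vec_scale] continuous_intros)

text \<open>Composing the local extensions of \<open>f\<close> with a curve in \<open>V\<close>
  gives a holomorphic function of one variable. For \<open>pt\<close> with one coordinate fixed this
  yields separate holomorphy on the bidisc.\<close>

lemma holo_on_variety_curve:
  assumes f: "holo_on_variety f V" and in_V: "\<And>\<zeta>. cmod \<zeta> < 1 \<Longrightarrow> \<gamma> \<zeta> \<in> V"
    and \<gamma>: "\<And>\<zeta>. (\<gamma> has_derivative (\<lambda>h. h *s w \<zeta>)) (at \<zeta>)"
  shows "(\<lambda>\<zeta>. f (\<gamma> \<zeta>)) holomorphic_on ball 0 1"
  unfolding holomorphic_on_open [OF open_ball]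
proof
  fix \<zeta> :: complex assume \<zeta>: "\<zeta> \<in> ball 0 1"
  then have "\<gamma> \<zeta> \<in> V" using in_V by simp
  then obtain U F where U: "open U" "\<gamma> \<zeta> \<in> U" and F: "holo_on F U" "\<And>z. z \<in> V \<inter> U \<Longrightarrow> F z = f z"
    using f unfolding holo_on_variety_def by meson
  obtain F' where F': "(F has_derivative F') (at (\<gamma> \<zeta>))" "\<And>c v. F' (c *s v) = c * F' v"
    using holo_onD [OF F(1) U(2)] by blast
  have "continuous_on UNIV \<gamma>"
    using \<gamma> by (meson continuous_at_imp_continuous_on has_derivative_continuous)
  then have "open (ball 0 1 \<inter> \<gamma> -` U)" using U by (intro open_Int open_vimage) auto
  then have "((\<lambda>\<zeta>. f (\<gamma> \<zeta>)) has_field_derivative F' (w \<zeta>)) (at \<zeta>)"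
    by (rule has_field_derivative_transform_within_open [OF holo_chain_curve [OF F' \<gamma>]])
      (use \<zeta> U F in_V in auto)
  then show "\<exists>f'. ((\<lambda>\<zeta>. f (\<gamma> \<zeta>)) has_field_derivative f') (at \<zeta>)" by blast
qed

lemma holo_on_variety_continuous:
  assumes f: "holo_on_variety f V"
  shows "continuous_on V f"
  unfolding continuous_on_eq_continuous_within
proof
  fix p assume p: "p \<in> V"
  then obtain U F where U: "open U" "p \<in> U" and F: "holo_on F U" "\<And>z. z \<in> V \<inter> U \<Longrightarrow> F z = f z"
    using f unfolding holo_on_variety_def by meson
  have "continuous (at p within V) F"
    by (rule continuous_at_imp_continuous_at_within [OF holo_on_imp_isCont [OF F(1) U(2)]])
  then have "(F \<longlongrightarrow> f p) (at p within V)"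
    using F(2)[of p] p U by (simp add: continuous_within)
  moreover have "\<forall>\<^sub>F x in at p within V. F x = f x"
    unfolding eventually_at_topological using U F(2) by (intro exI[of _ U]) auto
  ultimately have "(f \<longlongrightarrow> f p) (at p within V)" by (rule Lim_transform_eventually)
  then show "continuous (at p within V) f" by (simp add: continuous_within)
qed

lemma holo_on_clin:
  assumes T: "clin T" and I: "finite I" "\<And>z i. i \<notin> I \<Longrightarrow> x z i = 0"
    and x: "\<And>i. holo_on (\<lambda>z. x z i) U"
  shows "holo_on (\<lambda>z. T (x z) j) U"
proof -
  have "T (x z) j = (\<Sum>k\<in>I. x z k * T (\<lambda>i. if i = k then 1 else 0) j)" for z
  proof -
    have "x z = (\<lambda>i. \<Sum>k\<in>I. x z k * (if i = k then 1 else 0))"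
      using I by (auto simp: fun_eq_iff if_distrib cong: if_cong)
    then have "T (x z) = T (\<lambda>i. \<Sum>k\<in>I. x z k * (if i = k then 1 else 0))"
      by (rule arg_cong)
    then show ?thesis unfolding clin_sum [OF T I(1)] by simp
  qed
  moreover have "holo_on (\<lambda>z. \<Sum>k\<in>I. x z k * T (\<lambda>i. if i = k then 1 else 0) j) U"
    by (intro holo_on_sum holo_on_mult x holo_on_const)
  ultimately show ?thesis by simp
qed

lemma holo_on_symmat: "holo_on (\<lambda>z. symmat z b c) U"
  unfolding symmat_def by (cases "b = c"; cases b) (simp_all add: holo_on_coord)

text \<open>Every iterate is a polynomial in \<open>z\<close>. Vanishing outside \<open>H\<close> is
  carried through the induction because \<open>holo_on_clin\<close> expands a linear map over
  finitely many coordinates.\<close>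

lemma holo_on_transfer_state:
  fixes X :: "(bool \<times> 'j \<Rightarrow> complex) \<Rightarrow> bool \<times> 'j \<Rightarrow> complex"
  assumes J: "finite J" and X: "unitary_pair (UNIV \<times> J) X X'"
    and W: "unitary_pair (insert None (Some ` (UNIV \<times> J))) W W'"
  defines "v \<equiv> \<lambda>n z. vec1 1 (block_mult X (symmat z) (transfer_state W (block_mult X (symmat z)) n))"
  shows "holo_on (\<lambda>z. transfer W (block_mult X (symmat z)) n) U"
proof -
  define H where "H = (UNIV :: bool set) \<times> J"
  have H: "finite H" using J by (simp add: H_def)
  note XD = unitary_pairD [OF X, folded H_def] and WD = unitary_pairD [OF W, folded H_def]
  let ?I = "insert None (Some ` H)"
  have step: "(\<forall>i. holo_on (\<lambda>z. v n z i) U) \<and> (\<forall>z i. i \<notin> ?I \<longrightarrow> v n z i = 0)"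
    if u: "\<And>h. holo_on (\<lambda>z. transfer_state W (block_mult X (symmat z)) n h) U"
      "\<And>z h. h \<notin> H \<Longrightarrow> transfer_state W (block_mult X (symmat z)) n h = 0" for n
  proof -
    define y where "y = (\<lambda>z c k. if fst k = c then transfer_state W (block_mult X (symmat z)) n k else 0)"
    have y: "holo_on (\<lambda>z. y z c k) U" for c k
      unfolding y_def using u(1) by (cases "fst k = c") (simp_all add: holo_on_const)
    have y0: "y z c k = 0" if "k \<notin> H" for z c k
      unfolding y_def using u(2) [OF that] by simp
    have Xy: "holo_on (\<lambda>z. X (y z c) h) U" for c h
      by (rule holo_on_clin [OF XD(1) H y0 y])
    have v: "v n z = vec1 1 (\<lambda>h. \<Sum>c\<in>UNIV. symmat z (fst h) c * X (y z c) h)" for z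
      unfolding v_def block_mult_def y_def ..
    have "holo_on (\<lambda>z. v n z i) U" for i
      unfolding v by (cases i) (auto intro!: holo_on_const holo_on_sum holo_on_mult holo_on_symmat Xy)
    moreover have "v n z i = 0" if i: "i \<notin> ?I" for z i
    proof -
      obtain h where "i = Some h" "h \<notin> H" using i by (cases i) auto
      then show ?thesis using XD(6) y0 by (simp add: v)
    qed
    ultimately show ?thesis by blast
  qed
  have state: "(\<forall>h. holo_on (\<lambda>z. transfer_state W (block_mult X (symmat z)) n h) U) \<and>
      (\<forall>z h. h \<notin> H \<longrightarrow> transfer_state W (block_mult X (symmat z)) n h = 0)" for n
  proof (induction n)
    case 0
    then show ?case by (simp add: holo_on_const)
  next
    case (Suc n)
    have vn: "holo_on (\<lambda>z. v n z i) U" "i \<notin> ?I \<Longrightarrow> v n z i = 0" for i z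
      using step [OF conjunct1 [OF Suc, rule_format] conjunct2 [OF Suc, rule_format]] by simp_all
    have eq: "transfer_state W (block_mult X (symmat z)) (Suc n) h = W (v n z) (Some h)" for z h
      by (simp add: v_def)
    have "holo_on (\<lambda>z. W (v n z) (Some h)) U" for h
      by (rule holo_on_clin [OF WD(1), of ?I "v n"], use H in simp, erule vn(2), rule vn(1))
    moreover have "W (v n z) (Some h) = 0" if "h \<notin> H" for z h
    proof -
      have "Some h \<notin> ?I" using that by auto
      then show ?thesis using WD(6) vn(2) by simp
    qed
    ultimately show ?case unfolding eq by blast
  qed
  have vn: "holo_on (\<lambda>z. v n z i) U" "i \<notin> ?I \<Longrightarrow> v n z i = 0" for i z
    using step [OF conjunct1 [OF state, rule_format] conjunct2 [OF state, rule_format]] by simp_all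
  have "holo_on (\<lambda>z. W (v n z) None) U"
    by (rule holo_on_clin [OF WD(1), of ?I "v n"], use H in simp, erule vn(2), rule vn(1))
  then show ?thesis unfolding transfer_def v_def .
qed

text \<open>The Schur product is linear in its scalar matrix, so the contraction that the
  factorization gives at \<open>z / r\<close> becomes a contraction by \<open>r\<close> at
  \<open>z\<close>.\<close>

lemma contractive_transfer_symmat:
  fixes X :: "(bool \<times> 'j \<Rightarrow> complex) \<Rightarrow> bool \<times> 'j \<Rightarrow> complex"
  assumes J: "finite J" and X: "unitary_pair (UNIV \<times> J) X X'"
    and W: "unitary_pair (insert None (Some ` (UNIV \<times> J))) W W'"
    and r: "0 < r" "r < 1" and z: "of_real (1 / r) *s z \<in> calG"
  shows "contractive_transfer (UNIV \<times> J) W W' (block_mult X (symmat z)) r"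
proof
  show "finite ((UNIV :: bool set) \<times> J)" using J by simp
  show "clin (block_mult X (symmat z))"
    by (rule block_mult_clin [OF unitary_pairD(1) [OF X]])
  obtain x y :: "bool \<Rightarrow> bool \<Rightarrow> complex" where xy: "\<And>b c. symmat (of_real (1 / r) *s z) b c = (\<Sum>k\<in>UNIV. x b k * y c k)"
    "\<And>b. (\<Sum>k\<in>UNIV. (cmod (x b k))\<^sup>2) \<le> 1" "\<And>c. (\<Sum>k\<in>UNIV. (cmod (y c k))\<^sup>2) \<le> 1"
    using calG_schur_factorization [OF z] by blast
  have "symmat z = (\<lambda>b c. of_real r * symmat (of_real (1 / r) *s z) b c)"
    using r by (auto simp: fun_eq_iff symmat_def)
  then have eq: "block_mult X (symmat z) u = (\<lambda>h. of_real r * block_mult X (symmat (of_real (1 / r) *s z)) u h)" for u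
    by (metis block_mult_scale)
  show "nsq (UNIV \<times> J) (block_mult X (symmat z) u) \<le> r\<^sup>2 * nsq (UNIV \<times> J) u" for u
  proof -
    have "nsq (UNIV \<times> J) (block_mult X (symmat z) u)
      = r\<^sup>2 * nsq (UNIV \<times> J) (block_mult X (symmat (of_real (1 / r) *s z)) u)"
      unfolding eq by (simp add: nsq_def norm_mult power_mult_distrib sum_distrib_left)
    also have "\<dots> \<le> r\<^sup>2 * nsq (UNIV \<times> J) u"
      by (intro mult_left_mono block_mult_contractive [OF X xy]) simp
    finally show ?thesis .
  qed
qed (use r W in auto)

text \<open>\<open>F\<close> is the limit of the transfer approximants on all of
  \<open>calG\<close>. At \<open>pt p\<close> the matrix \<open>symmat\<close> has rank one with
  both factors \<open>lam p\<close>, so the realization supplies a self-reproducing state and the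
  limit is the prescribed value.\<close>

lemma interpolation_on_nodes:
  fixes \<phi> :: "complex \<Rightarrow> complex \<Rightarrow> complex"
  assumes J: "finite J" and JD: "J \<subseteq> ball 0 1 \<times> ball 0 1" and neg: "uminus ` J \<subseteq> J"
    and \<phi>: "schur_bidisc \<phi>"
    and even: "\<And>s t. \<phi> (- s) (- t) = \<phi> s t"
  shows "\<exists>F. holo_on F calG \<and> (\<forall>z\<in>calG. cmod (F z) \<le> 1) \<and> (\<forall>p\<in>J. F (pt p) = \<phi> (fst p) (snd p))"
proof -
  obtain X X' W W' where X: "unitary_pair (UNIV \<times> J) X X'"
    and W: "unitary_pair (insert None (Some ` (UNIV \<times> J))) W W'"
    and node: "\<forall>p\<in>J. \<exists>x. W (vec1 1 (block_mult X (\<lambda>b c. lam p b * lam p c) x)) = vec1 (\<phi> (fst p) (snd p)) x"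
    using even_realization [OF J JD neg \<phi> even] by (elim exE conjE)
  define T where "T n z = transfer W (block_mult X (symmat z)) n" for n z
  define F where "F z = lim (\<lambda>n. T n z)" for z
  have ct: "\<exists>r. contractive_transfer (UNIV \<times> J) W W' (block_mult X (symmat z)) r" if z: "z \<in> calG" for z
  proof -
    obtain r R where "0 < r" "r < 1" "R > 0" "\<forall>w\<in>ball z R. of_real (1 / r) *s w \<in> calG"
      using calG_scale [OF z] by blast
    then show ?thesis
      using contractive_transfer_symmat [OF J X W, of r z] by auto
  qed
  have lim: "(\<lambda>n. T n z) \<longlonglongrightarrow> F z" if z: "z \<in> calG" for z
  proof -
    obtain r where "contractive_transfer (UNIV \<times> J) W W' (block_mult X (symmat z)) r" using ct [OF z] by blast
    from contractive_transfer.transfer_convergent [OF this] show ?thesis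
      by (simp add: F_def T_def convergent_LIMSEQ_iff)
  qed
  have bd: "cmod (F z) \<le> 1" if z: "z \<in> calG" for z
  proof -
    obtain r where "contractive_transfer (UNIV \<times> J) W W' (block_mult X (symmat z)) r" using ct [OF z] by blast
    from contractive_transfer.transfer_limit_le_1 [OF this] show ?thesis
      using lim [OF z] by (simp add: T_def)
  qed
  have "holo_on F calG"
  proof (rule holo_on_bounded_limit [OF _ _ lim])
    show "holo_on (T n) calG" for n
      unfolding T_def by (rule holo_on_transfer_state [OF J X W])
    fix z assume z: "z \<in> calG"
    obtain r R where r: "0 < r" "r < 1" and R: "R > 0" "\<And>w. w \<in> ball z R \<Longrightarrow> of_real (1 / r) *s w \<in> calG"
      using calG_scale [OF z] by blast
    obtain R' where R': "R' > 0" "ball z R' \<subseteq> calG" using open_calG z open_contains_ball by blast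
    have bd: "cmod (T n w) \<le> 1 + 1 / (1 - r)" if "w \<in> ball z (min R R')" for n w
    proof -
      have "of_real (1 / r) *s w \<in> calG" using R(2)[of w] that by simp
      from contractive_transfer.transfer_bounded [OF contractive_transfer_symmat [OF J X W r this]]
      show ?thesis by (simp add: T_def)
    qed
    have "0 < 1 + 1 / (1 - r)" using r by (simp add: add_pos_pos)
    then show "\<exists>R>0. \<exists>C>0. ball z R \<subseteq> calG \<and> (\<forall>n. \<forall>w\<in>ball z R. cmod (T n w) \<le> C)"
      using bd R(1) R' by (intro exI[of _ "min R R'"] exI[of _ "1 + 1 / (1 - r)"] conjI) auto
  qed
  moreover have "F (pt p) = \<phi> (fst p) (snd p)" if p: "p \<in> J" for p
  proof -
    have "pt p \<in> calG" using p JD pt_in_calV[of p] calV_subset_calG by fastforce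
    then obtain r where r: "contractive_transfer (UNIV \<times> J) W W' (block_mult X (symmat (pt p))) r"
      and l: "(\<lambda>n. T n (pt p)) \<longlonglongrightarrow> F (pt p)" using ct lim by blast
    obtain x where x: "W (vec1 1 (block_mult X (\<lambda>b c. lam p b * lam p c) x)) = vec1 (\<phi> (fst p) (snd p)) x"
      using node p by blast
    have "symmat (pt p) = (\<lambda>b c. lam p b * lam p c)"
      by (auto simp: fun_eq_iff symmat_def lam_def power2_eq_square)
    then have "(\<lambda>n. T n (pt p)) \<longlonglongrightarrow> \<phi> (fst p) (snd p)"
      unfolding T_def using contractive_transfer.transfer_fixed_point [OF r] x by simp
    then show ?thesis using l LIMSEQ_unique by blast
  qed
  ultimately show ?thesis using bd by blast
qed

text \<open>Interpolants on growing node sets have a convergent subsequence. Its limit is correct on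
  a dense subset of the bidisc, by continuity on all of it, and hence on
  \<open>calV\<close>.\<close>

lemma extension_calV_calG:
  assumes f: "holo_on_variety f calV" and B: "\<And>z. z \<in> calV \<Longrightarrow> cmod (f z) \<le> 1"
  shows "\<exists>F. holo_on F calG \<and> (\<forall>z\<in>calG. cmod (F z) \<le> 1) \<and> (\<forall>z\<in>calV. F z = f z)"
proof -
  define D where "D = (ball 0 1 \<times> ball 0 1 :: (complex \<times> complex) set)"
  have D: "open D" unfolding D_def by (intro open_Times open_ball)
  have ptD: "pt p \<in> calV" if "p \<in> D" for p using that pt_in_calV[of p] by (auto simp: D_def)
  have contf: "continuous_on D (\<lambda>p. f (pt p))"
    by (rule continuous_on_compose2 [OF holo_on_variety_continuous [OF f] continuous_on_pt]) (use ptD in auto)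
  have nodes: "\<exists>F. holo_on F calG \<and> (\<forall>z\<in>calG. cmod (F z) \<le> 1) \<and> (\<forall>p\<in>J. F (pt p) = f (pt p))"
    if J: "finite J" "J \<subseteq> D" "uminus ` J \<subseteq> J" for J
  proof -
    have "schur_bidisc (\<lambda>s t. f (pt (s, t)))"
      unfolding schur_bidisc_def
    proof (intro conjI allI impI)
      show "(\<lambda>s. f (pt (s, t))) holomorphic_on ball 0 1" if "cmod t < 1" for t
        by (rule holo_on_variety_curve [OF f _ pt_derivative(1)]) (use pt_in_calV that in auto)
      show "(\<lambda>t. f (pt (s, t))) holomorphic_on ball 0 1" if "cmod s < 1" for s
        by (rule holo_on_variety_curve [OF f _ pt_derivative(2)]) (use pt_in_calV that in auto)
      show "cmod (f (pt (s, t))) \<le> 1" if "cmod s < 1" "cmod t < 1" for s t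
        using that by (intro B pt_in_calV) auto
      show "continuous_on (ball 0 1 \<times> ball 0 1) (\<lambda>(s, t). f (pt (s, t)))"
        using contf by (simp add: D_def case_prod_unfold)
    qed
    moreover have "f (pt (- s, - t)) = f (pt (s, t))" for s t
      using pt_uminus[of "(s, t)"] by simp
    ultimately show ?thesis
      using interpolation_on_nodes [OF J(1) J(2) [unfolded D_def] J(3), of "\<lambda>s t. f (pt (s, t))"] by simp
  qed
  obtain Q :: "(complex \<times> complex) set" where Q: "countable Q" "\<And>S. open S \<Longrightarrow> S \<noteq> {} \<Longrightarrow> \<exists>q\<in>Q. q \<in> S"
    using countable_dense_exists by metis
  have "Q \<noteq> {}" using Q(2)[of UNIV] by auto
  define q where "q = from_nat_into Q"
  have q: "range q = Q" unfolding q_def using Q(1) \<open>Q \<noteq> {}\<close> by (simp add: range_from_nat_into)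
  \<comment> \<open>Negatives are added because \<open>interpolation_on_nodes\<close> asks for
    symmetric node sets.\<close>
  define J where "J n = {p \<in> D. p \<in> q ` {..n} \<or> - p \<in> q ` {..n}}" for n
  have negD: "- p \<in> D" if "p \<in> D" for p using that by (auto simp: D_def mem_Times_iff)
  have "\<forall>n. \<exists>F. holo_on F calG \<and> (\<forall>z\<in>calG. cmod (F z) \<le> 1) \<and> (\<forall>p\<in>J n. F (pt p) = f (pt p))"
  proof (rule allI, rule nodes)
    fix n
    have "J n \<subseteq> q ` {..n} \<union> uminus ` q ` {..n}"
      unfolding J_def by (smt (verit) Un_iff image_eqI mem_Collect_eq minus_minus subsetI)
    then show "finite (J n)" by (rule finite_subset) simp
    show "J n \<subseteq> D" unfolding J_def by blast
    show "uminus ` J n \<subseteq> J n"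
      by (rule image_subsetI) (simp add: J_def negD disj_commute)
  qed
  from choice [OF this] obtain F where F': "\<forall>n. holo_on (F n) calG \<and> (\<forall>z\<in>calG. cmod (F n z) \<le> 1) \<and>
      (\<forall>p\<in>J n. F n (pt p) = f (pt p))"
    by (elim exE)
  have F: "holo_on (F n) calG" "z \<in> calG \<Longrightarrow> cmod (F n z) \<le> 1" "p \<in> J n \<Longrightarrow> F n (pt p) = f (pt p)" for n z p
    using spec [OF F', of n] by simp_all
  have "\<exists>r G. strict_mono r \<and> holo_on G calG \<and> (\<forall>z\<in>calG. (\<lambda>n. F (r n) z) \<longlonglongrightarrow> G z)"
    by (rule holo_montel [OF open_calG], rule F(1), erule F(2))
  then obtain r G where r: "strict_mono (r :: nat \<Rightarrow> nat)" and G: "holo_on G calG"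
    and lim: "\<And>z. z \<in> calG \<Longrightarrow> (\<lambda>n. F (r n) z) \<longlonglongrightarrow> G z"
    by blast
  have bd: "cmod (G z) \<le> 1" if z: "z \<in> calG" for z
    by (rule tendsto_upperbound [OF tendsto_norm [OF lim [OF z]]]) (use F(2) z in auto)
  have Gq: "G (pt (q i)) = f (pt (q i))" if i: "q i \<in> D" for i
  proof -
    have "\<forall>\<^sub>F n in sequentially. F (r n) (pt (q i)) = f (pt (q i))"
      using eventually_ge_at_top[of i]
    proof eventually_elim
      case (elim n)
      then have "i \<le> r n" using strict_mono_imp_increasing [OF r, of n] by simp
      then show ?case using i by (intro F(3)) (auto simp: J_def)
    qed
    then have "(\<lambda>n. F (r n) (pt (q i))) \<longlonglongrightarrow> f (pt (q i))" by (rule tendsto_eventually)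
    moreover have "pt (q i) \<in> calG" using ptD [OF i] calV_subset_calG by blast
    ultimately show ?thesis using lim LIMSEQ_unique by blast
  qed
  have contG: "continuous_on D (\<lambda>p. G (pt p))"
    by (rule continuous_on_compose2 [OF holo_on_imp_continuous_on [OF G] continuous_on_pt])
      (use ptD calV_subset_calG in auto)
  have GD: "G (pt p) = f (pt p)" if p: "p \<in> D" for p
  proof (rule ccontr)
    assume ne: "G (pt p) \<noteq> f (pt p)"
    have "continuous_on D (\<lambda>p. G (pt p) - f (pt p))" by (intro continuous_on_diff contG contf)
    then have "open (D \<inter> (\<lambda>p. G (pt p) - f (pt p)) -` (- {0}))"
      by (rule continuous_open_preimage [OF _ D]) auto
    moreover have "D \<inter> (\<lambda>p. G (pt p) - f (pt p)) -` (- {0}) \<noteq> {}" using p ne by auto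
    ultimately obtain x where "x \<in> Q" "x \<in> D \<inter> (\<lambda>p. G (pt p) - f (pt p)) -` (- {0})" using Q(2) by blast
    moreover then obtain i where "x = q i" using q by auto
    ultimately show False using Gq[of i] by auto
  qed
  have "G z = f z" if z: "z \<in> calV" for z
  proof -
    obtain p where "z = pt p" "cmod (fst p) < 1" "cmod (snd p) < 1" using calV_eq_pt [OF z] .
    then show ?thesis using GD[of p] by (auto simp: D_def mem_Times_iff)
  qed
  then show ?thesis using G bd by blast
qed

text \<open>An extension cannot lower the supremum, so a bound by \<open>M\<close> is enough.
  Division by \<open>M\<close> reduces to functions bounded by 1; \<open>M = 0\<close> is treated
  apart.\<close>

lemma np_pair_subset_calG:
  assumes G: "domain_of_holomorphy G" "calV \<subseteq> G" "G \<subseteq> calG"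
  shows "np_pair G calV"
  unfolding np_pair_def
proof (intro conjI allI impI)
  show "Cartan_pair G calV" by (rule Cartan_pair_calV [OF G])
  fix f :: "complex ^ 3 \<Rightarrow> complex"
  assume "holo_on_variety f calV \<and> bounded (f ` calV)"
  then have f: "holo_on_variety f calV" and bdd: "bounded (f ` calV)" by auto
  define S where "S = (SUP z\<in>calV. ennreal (cmod (f z)))"
  obtain b where b: "\<And>z. z \<in> calV \<Longrightarrow> cmod (f z) \<le> b" using bdd by (auto simp: bounded_iff)
  have "S \<le> ennreal b" unfolding S_def using b by (intro SUP_least ennreal_leI)
  then obtain M where M: "S = ennreal M" "M \<ge> 0" by (metis ennreal_cases ennreal_less_top leD top.extremum_unique)
  have fM: "cmod (f z) \<le> M" if "z \<in> calV" for z
  proof -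
    have "ennreal (cmod (f z)) \<le> S" unfolding S_def using that by (rule SUP_upper)
    then show ?thesis using M by simp
  qed
  have "\<exists>F. holo_on F calG \<and> (\<forall>z\<in>calG. cmod (F z) \<le> M) \<and> (\<forall>z\<in>calV. F z = f z)"
  proof (cases "M = 0")
    case True
    then show ?thesis using fM by (intro exI[of _ "\<lambda>_. 0"]) (auto simp: holo_on_const)
  next
    case False
    have "holo_on_variety (\<lambda>z. inverse (of_real M) * f z) calV"
      using f unfolding holo_on_variety_def by (metis holo_on_cmult)
    moreover have "cmod (inverse (of_real M) * f z) \<le> 1" if "z \<in> calV" for z
      using fM [OF that] M(2) False by (simp add: norm_divide norm_mult norm_inverse field_simps)
    ultimately obtain F where F: "holo_on F calG" "\<And>z. z \<in> calG \<Longrightarrow> cmod (F z) \<le> 1"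
        "\<And>z. z \<in> calV \<Longrightarrow> F z = inverse (of_real M) * f z"
      using extension_calV_calG[of "\<lambda>z. inverse (of_real M) * f z"] by blast
    show ?thesis
    proof (intro exI[of _ "\<lambda>z. of_real M * F z"] conjI ballI)
      show "holo_on (\<lambda>z. of_real M * F z) calG" by (rule holo_on_cmult [OF F(1)])
      show "cmod (of_real M * F z) \<le> M" if "z \<in> calG" for z
        using F(2) [OF that] M(2) by (simp add: norm_mult mult_left_le)
      show "of_real M * F z = f z" if "z \<in> calV" for z
        using F(3) [OF that] False by simp
    qed
  qed
  then obtain F where F: "holo_on F calG" "\<And>z. z \<in> calG \<Longrightarrow> cmod (F z) \<le> M" "\<And>z. z \<in> calV \<Longrightarrow> F z = f z"
    by blast
  have "(SUP z\<in>G. ennreal (cmod (F z))) = S"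
  proof (rule antisym)
    show "(SUP z\<in>G. ennreal (cmod (F z))) \<le> S"
      unfolding M(1) using F(2) G(3) by (intro SUP_least ennreal_leI) auto
    show "S \<le> (SUP z\<in>G. ennreal (cmod (F z)))"
      unfolding S_def
    proof (rule SUP_least)
      fix z assume z: "z \<in> calV"
      then have "ennreal (cmod (F z)) \<le> (SUP z\<in>G. ennreal (cmod (F z)))"
        using G(2) by (intro SUP_upper) auto
      then show "ennreal (cmod (f z)) \<le> (SUP z\<in>G. ennreal (cmod (F z)))"
        by (simp add: F(3) [OF z])
    qed
  qed
  then show "\<exists>F. holo_on F G \<and> (\<forall>z\<in>calV. F z = f z) \<and>
      (SUP z\<in>G. ennreal (cmod (F z))) = (SUP z\<in>calV. ennreal (cmod (f z)))"
    using F(1,3) holo_on_subset [OF F(1) G(3)] unfolding S_def by (intro exI[of _ F]) simp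
qed

text \<open>A complex linear form separating \<open>p\<close> from \<open>calG\<close> is bounded on \<open>calV\<close>; any extension of it agrees
  with it to first order at \<open>0\<close>, because the cone \<open>calV\<close> spans the whole space, and the Schwarz lemma on the
  discs through \<open>0\<close> then bounds the form on \<open>G\<close>.\<close>

lemma np_pair_imp_subset_calG:
  assumes G: "balanced G" "domain_of_holomorphy G" "calV \<subseteq> G" and np: "np_pair G calV"
  shows "G \<subseteq> calG"
proof (rule ccontr)
  assume "\<not> G \<subseteq> calG"
  then obtain p where p: "p \<in> G" "p \<notin> calG" by blast
  have openG: "open G" using G(2) by (simp add: domain_of_holomorphy_def)
  obtain a where a: "\<And>z. z \<in> calG \<Longrightarrow> Re (cform a z) < Re (cform a p)"
    using open_convex_separation [OF open_calG convex_calG p(2)] by blast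
  define \<rho> where "\<rho> = Re (cform a p)"
  have 0: "(0 :: complex ^ 3) \<in> calG" using zero_in_calV calV_subset_calG by blast
  have \<rho>: "\<rho> > 0" using a [OF 0] by (simp add: \<rho>_def cform_def)
  \<comment> \<open>Rotating \<open>z\<close> inside the balanced set turns the bound on the real
    part into one on the modulus.\<close>
  have bound: "cmod (cform a z) \<le> \<rho>" if z: "z \<in> calG" for z
  proof (cases "cform a z = 0")
    case False
    define \<zeta> where "\<zeta> = cnj (cform a z) / of_real (cmod (cform a z))"
    have "cmod \<zeta> = 1" using False by (simp add: \<zeta>_def norm_divide)
    then have "\<zeta> *s z \<in> calG" using balanced_calG z by (simp add: balanced_def)
    from a [OF this] have "Re (\<zeta> * cform a z) < \<rho>" by (simp add: cform_scale \<rho>_def)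
    moreover have "\<zeta> * cform a z = of_real (cmod (cform a z))"
      using False complex_norm_square[of "cform a z"] by (simp add: \<zeta>_def power2_eq_square field_simps)
    ultimately show ?thesis by simp
  qed (use \<rho> in simp)
  have "holo_on_variety (cform a) calV"
    unfolding holo_on_variety_def using holo_on_cform by blast
  moreover have "bounded (cform a ` calV)"
    using bound calV_subset_calG by (auto simp: bounded_iff)
  ultimately obtain F where F: "holo_on F G" "\<And>z. z \<in> calV \<Longrightarrow> F z = cform a z"
    and sup: "(SUP z\<in>G. ennreal (cmod (F z))) = (SUP z\<in>calV. ennreal (cmod (cform a z)))"
    using np unfolding np_pair_def by blast
  have FG: "cmod (F z) \<le> \<rho>" if "z \<in> G" for z
  proof -
    have "ennreal (cmod (F z)) \<le> (SUP z\<in>G. ennreal (cmod (F z)))" using that by (rule SUP_upper)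
    also have "\<dots> \<le> ennreal \<rho>"
      unfolding sup using bound calV_subset_calG by (intro SUP_least ennreal_leI) auto
    finally show ?thesis using \<rho> by simp
  qed
  have "(0 :: complex ^ 3) \<in> G" using zero_in_calV G(3) by blast
  then obtain L where L: "(F has_derivative L) (at 0)" "\<And>c v. L (c *s v) = c * L v"
    using holo_onD [OF F(1)] by blast
  have slice: "((\<lambda>\<zeta>. F (\<zeta> *s v)) has_field_derivative L v) (at 0)" for v
    using holo_slice_derivative[of F L 0 0 v] L by simp
  have Ladd: "L (v + w) = L v + L w" for v w
    using has_derivative_bounded_linear [OF L(1)] by (rule real_vector.linear_add [OF bounded_linear.linear])
  have LV: "L v = cform a v" if v: "v \<in> calV" for v
  proof -
    have "((\<lambda>\<zeta>. F (\<zeta> *s v)) has_field_derivative cform a v) (at 0)"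
    proof (rule has_field_derivative_transform_within_open)
      show "((\<lambda>\<zeta>. \<zeta> * cform a v) has_field_derivative cform a v) (at 0)"
        by (auto intro!: derivative_eq_intros)
      show "\<zeta> * cform a v = F (\<zeta> *s v)" if "\<zeta> \<in> ball 0 1" for \<zeta>
      proof -
        have "\<zeta> *s v \<in> calV" using balanced_calV v that by (simp add: balanced_def)
        then show ?thesis using F(2) by (simp add: cform_scale)
      qed
    qed auto
    then show ?thesis using slice DERIV_unique by blast
  qed
  have Lall: "L z = cform a z" for z
  proof -
    \<comment> \<open>A basis of the space inside \<open>calV\<close>; the factor 1/2 puts it into
      the polydisc.\<close>
    define v1 v2 v3 :: "complex ^ 3" where "v1 = (1/2) *s axis 1 1" and "v2 = (1/2) *s axis 2 1"
      and "v3 = (1/2) *s axis 1 1 + (1/2) *s axis 2 1 + (1/2) *s axis 3 1"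
    have V: "v1 \<in> calV" "v2 \<in> calV" "v3 \<in> calV"
      by (simp_all add: calV_def tridisc_iff v1_def v2_def v3_def axis_def power2_eq_square norm_divide)
    have z: "z = (2 * (z $ 1 - z $ 3)) *s v1 + ((2 * (z $ 2 - z $ 3)) *s v2 + (2 * z $ 3) *s v3)"
      by (simp add: vec_eq_iff forall_3 v1_def v2_def v3_def axis_def algebra_simps)
    show ?thesis
      by (subst (1 2) z) (simp only: Ladd L(2) cform_add cform_scale LV [OF V(1)] LV [OF V(2)] LV [OF V(3)])
  qed
  obtain e where e: "e > 0" "ball p e \<subseteq> G" using openG p(1) open_contains_ball by blast
  define n where "n = norm p + 1"
  have n: "n > 0" "norm p \<le> n" by (simp_all add: n_def add_nonneg_pos)
  \<comment> \<open>\<open>G\<close> is open, so it contains a point slightly beyond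
    \<open>p\<close>. At \<open>p\<close> itself the bound by \<rho> need not be a
    contradiction.\<close>
  define \<delta> where "\<delta> = e / (2 * n)"
  have \<delta>: "\<delta> > 0" using e n by (simp add: \<delta>_def)
  define p' where "p' = of_real (1 + \<delta>) *s p"
  have "norm (p' - p) < e"
  proof -
    have "p' - p = of_real \<delta> *s p" by (simp add: p'_def vec_eq_iff algebra_simps)
    then have "norm (p' - p) = \<delta> * norm p" using \<delta> by (simp add: norm_vec_scale)
    also have "\<dots> \<le> \<delta> * n" using \<delta> n by simp
    also have "\<dots> = e / 2" using n by (simp add: \<delta>_def)
    finally show ?thesis using e by simp
  qed
  then have p': "p' \<in> G" using e by (auto simp: dist_norm norm_minus_commute)
  define g where "g \<zeta> = F (0 + \<zeta> *s p') / of_real \<rho>" for \<zeta>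
  have inG: "\<zeta> *s p' \<in> G" if "cmod \<zeta> < 1" for \<zeta>
    using G(1) p' that by (simp add: balanced_def)
  have "g holomorphic_on ball 0 1"
    unfolding g_def using \<rho> inG by (intro holomorphic_intros holo_slice [OF F(1)]) auto
  moreover have "cmod (g \<zeta>) \<le> 1" if "cmod \<zeta> < 1" for \<zeta>
    using FG [OF inG [OF that]] \<rho> by (simp add: g_def norm_divide)
  \<comment> \<open>The Schwarz lemma, as the Cauchy bound on the first Taylor coefficient.\<close>
  ultimately have "cmod (tcoef g 1) \<le> 1" by (rule tcoef_bound)
  moreover have "tcoef g 1 = L p' / of_real \<rho>"
  proof -
    have "(g has_field_derivative L p' / of_real \<rho>) (at 0)"
      unfolding g_def using DERIV_cdivide [OF slice] by simp
    then show ?thesis by (simp add: tcoef_def DERIV_imp_deriv)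
  qed
  ultimately have "cmod (L p') \<le> \<rho>" using \<rho> by (simp add: norm_divide)
  moreover have "cmod (L p') = (1 + \<delta>) * cmod (cform a p)"
    using \<delta> unfolding Lall p'_def cform_scale norm_mult norm_of_real by simp
  moreover have "\<rho> \<le> cmod (cform a p)" by (simp add: \<rho>_def complex_Re_le_cmod)
  moreover have "cmod (cform a p) < (1 + \<delta>) * cmod (cform a p)"
  proof -
    have "0 < cmod (cform a p)" using \<rho> \<open>\<rho> \<le> cmod (cform a p)\<close> by linarith
    then have "0 < \<delta> * cmod (cform a p)" using \<delta> by (intro mult_pos_pos)
    then show ?thesis by (simp only: distrib_right mult_1_left)
  qed
  ultimately show False by linarith
qed

theorem mainTheorem5:
  shows "convex calG \<and> np_pair calG calV \<and>
    (\<forall>G :: (complex ^ 3) set.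
       balanced G \<and> domain_of_holomorphy G \<and> calV \<subseteq> G \<longrightarrow> (np_pair G calV \<longleftrightarrow> G \<subseteq> calG))"
proof (intro conjI allI impI)
  show "convex calG" by (rule convex_calG)
  have "domain_of_holomorphy calG"
    using open_calG convex_calG zero_in_calV calV_subset_calG
    by (intro domain_of_holomorphy_convex) auto
  then show "np_pair calG calV"
    using calV_subset_calG by (intro np_pair_subset_calG) auto
next
  fix G :: "(complex ^ 3) set"
  assume "balanced G \<and> domain_of_holomorphy G \<and> calV \<subseteq> G"
  then show "np_pair G calV \<longleftrightarrow> G \<subseteq> calG"
    using np_pair_imp_subset_calG np_pair_subset_calG by blast
qed

end
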